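(* Let $X_\Delta$ be a complete toric variety with fan $\Delta\subset N_{\mathbb R}$, and let $\mathcal E$ be a toric vector bundle of rank $r$ on $X_\Delta$. Suppose that $\mathcal E$ has trivial Chern class and affinely independent (global equivariant) Chern roots $\boldsymbol u=\{u_1,\dots,u_r\}\subset M$. Let $U:|\Delta|\to\mathbb R^r/\mathbb R\boldsymbol 1$ be the linear map given by $U(x)=(\langle u_1,x\rangle,\dots,\langle u_r,x\rangle)$. Then there exist (1) a complete fan $\Xi$ in $\mathbb R^r/\mathbb R\boldsymbol 1$ that coarsens the $(r-1)$-dimensional permutohedral fan $\Sigma_r$, (2) a toric vector bundle $\mathcal F$ of rank $r$ on $X_\Xi$, and (3) a character $u\in M$, such that the map $\pi_U:X_\Delta\to X_\Xi$ induced by $U$ is a surjective toric morphism and $\mathcal E\otimes\mathcal O(\operatorname{div}\chi^u)$ is equivariantly isomorphic to $\pi_U^*\mathcal F$.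
   Context: **Fans and toric varieties.** $N$ is a lattice with dual lattice $M$; fans are rational polyhedral fans (for $\mathbb R^r/\mathbb R\boldsymbol 1$ with respect to the lattice $\mathbb Z^r/\mathbb Z\boldsymbol 1$, $\boldsymbol 1$ the all-ones vector), possibly with nonzero lineality space $N_0$; in that case $X_\Delta$ denotes the toric variety of the strongly convex fan $\Delta/N_0$ but with the action of the larger torus associated to $N$ retained. Toric varieties are over a fixed base field. A complete fan $\Xi$ coarsens a complete fan $\Sigma$ if every cone of $\Sigma$ is contained in a cone of $\Xi$. The permutohedral fan $\Sigma_r\subset\mathbb R^r/\mathbb R\boldsymbol 1$ is the fan cut out by all hyperplanes $x_i-x_j=0$, $i<j$. **Toric vector bundles.** A toric vector bundle is a torus-equivariant vector bundle. Equivalently (Kaveh–Manon), a toric vector bundle $\mathcal E$ of rank $r$ on $X_\Delta$ with fiber $E$ over the identity, $\dim E=r$, is given by its piecewise linear map $\tilde\Phi:|\Delta|\to\tilde{\mathcal B}(E)$, where $\tilde{\mathcal B}(E)$ is the space of vector space valuations $v:E\to\mathbb R\cup\{\infty\}$ ($v(e+f)\ge\min(v(e),v(f))$, $v(ce)=v(e)$ for scalars $c\ne0$, $v(e)=\infty$ iff $e=0$), such that for each cone $\delta\in\Delta$ there are a frame $F=\{L_1,\dots,L_r\}$ of $E$ (one-dimensional subspaces with $E=\bigoplus L_i$) and an integral linear map $T_\delta=(u_1,\dots,u_r):\operatorname{span}|\delta|\to\mathbb R^r$ with $\tilde\Phi|_\delta=\tilde\phi_F\circ T_\delta$. Here $\tilde\phi_F(a)$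 is the valuation $\sum_i e_i\mapsto\min\{a_i\mid e_i\ne0\}$ ($e_i\in L_i$). The $u_i$ are the local equivariant Chern roots of $\mathcal E$ at $\delta$. The line bundle $\mathcal O(\operatorname{div}\chi^u)$, $u\in M$, has PL map $u:|\Delta|\to\mathbb R$. **Chern class.** The $i$-th equivariant Chern class $c_i^T(\mathcal E)$ is the piecewise polynomial function on $\Delta$ given on each cone $\delta$ by the $i$-th elementary symmetric polynomial in the local Chern roots at $\delta$; the total equivariant Chern class is $c^T=1+c_1^T+\dots+c_r^T$. $\mathcal E$ has trivial Chern class if $c^T$ is globally polynomial on $|\Delta|$. For complete $\Delta$ this is equivalent to the existence of a global multiset of equivariant Chern roots $\boldsymbol u=\{u_1,\dots,u_r\}\subset M$, i.e. (after ordering the frames) $T_\delta=(u_1,\dots,u_r)$ on $\operatorname{span}|\delta|$ for every $\delta\in\Delta$. *)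

theory Defs
  imports
    "HOL-Analysis.Analysis"
    "HOL-Algebra.Algebraic_Closure_Type"
begin

no_notation fps_nth (infixl \<open>$\<close> 75)

section \<open>Lattices and fans\<close>

text \<open>
  Throughout, \<open>N\<^sub>\<real>\<close> is a type of class \<open>real_vector\<close> and the lattice \<open>N\<close> is a full-rank
  subset of it.  The dual lattice \<open>M\<close> consists of the linear functionals that are integral on \<open>N\<close>.
\<close>

definition full_lattice :: "'n::real_vector set \<Rightarrow> bool" where
  "full_lattice N \<longleftrightarrow> (\<exists>B. finite B \<and> independent B \<and> span B = UNIV \<and>
     N = {(\<Sum>b\<in>B. of_int (c b) *\<^sub>R b) | c. True})"

definition integral_linear_on :: "'n::real_vector set \<Rightarrow> 'n set \<Rightarrow> ('n \<Rightarrow> real) \<Rightarrow> bool" where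
  "integral_linear_on N V m \<longleftrightarrow>
     (\<forall>x\<in>V. \<forall>y\<in>V. m (x + y) = m x + m y) \<and>
     (\<forall>c. \<forall>x\<in>V. m (c *\<^sub>R x) = c * m x) \<and>
     (\<forall>x\<in>V \<inter> N. m x \<in> \<int>)"

definition dual_lattice :: "'n::real_vector set \<Rightarrow> ('n \<Rightarrow> real) set" where
  "dual_lattice N = {m. integral_linear_on N UNIV m}"

definition rational_cone :: "'n::real_vector set \<Rightarrow> 'n set \<Rightarrow> bool" where
  "rational_cone N \<sigma> \<longleftrightarrow> (\<exists>A. finite A \<and> A \<subseteq> N \<and> \<sigma> = convex_cone hull A)"

text \<open>The library relation \<open>face_of\<close> also counts the empty set as a face.\<close>

definition cone_face :: "'n::real_vector set \<Rightarrow> 'n set \<Rightarrow> bool" where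
  "cone_face \<tau> \<sigma> \<longleftrightarrow> \<tau> face_of \<sigma> \<and> \<tau> \<noteq> {}"

text \<open>Cones are not required to be strongly convex: a fan may have a nonzero lineality space.\<close>

definition fan :: "'n::real_vector set \<Rightarrow> 'n set set \<Rightarrow> bool" where
  "fan N \<Delta> \<longleftrightarrow> finite \<Delta> \<and> \<Delta> \<noteq> {} \<and>
     (\<forall>\<sigma>\<in>\<Delta>. rational_cone N \<sigma>) \<and>
     (\<forall>\<sigma>\<in>\<Delta>. \<forall>\<tau>. cone_face \<tau> \<sigma> \<longrightarrow> \<tau> \<in> \<Delta>) \<and>
     (\<forall>\<sigma>\<in>\<Delta>. \<forall>\<sigma>'\<in>\<Delta>. cone_face (\<sigma> \<inter> \<sigma>') \<sigma> \<and> cone_face (\<sigma> \<inter> \<sigma>') \<sigma>')"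

definition complete_fan :: "'n::real_vector set \<Rightarrow> 'n set set \<Rightarrow> bool" where
  "complete_fan N \<Delta> \<longleftrightarrow> fan N \<Delta> \<and> \<Union>\<Delta> = UNIV"

definition coarsens :: "'n set set \<Rightarrow> 'n set set \<Rightarrow> bool" where
  "coarsens \<Xi> \<Sigma> \<longleftrightarrow> (\<forall>\<sigma>\<in>\<Sigma>. \<exists>\<xi>\<in>\<Xi>. \<sigma> \<subseteq> \<xi>)"


section \<open>Toric varieties\<close>

text \<open>
  A toric variety over \<open>'k\<close> is represented by its set of geometric points, i.e. points over the
  algebraic closure of \<open>'k\<close>.  The points of the affine chart of a cone \<open>\<sigma>\<close> are the monoid
  homomorphisms from \<open>\<sigma>\<^sup>\<or> \<inter> M\<close> to the multiplicative monoid of the field, and the charts are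
  glued along the faces.  Elements of \<open>\<sigma>\<^sup>\<or> \<inter> M\<close> vanish on the lineality space \<open>N\<^sub>0\<close> of \<open>\<sigma>\<close>, so for a
  fan with lineality this is the variety of the strongly convex fan \<open>\<Delta> / N\<^sub>0\<close>.
\<close>

type_synonym ('n, 'k) chart_point = "'n set \<times> (('n \<Rightarrow> real) \<Rightarrow> 'k alg_closure)"

definition cone_monoid :: "'n::real_vector set \<Rightarrow> 'n set \<Rightarrow> ('n \<Rightarrow> real) set" where
  "cone_monoid N \<sigma> = {m \<in> dual_lattice N. \<forall>x\<in>\<sigma>. 0 \<le> m x}"

definition affine_chart ::
    "'n::real_vector set \<Rightarrow> 'n set \<Rightarrow> (('n \<Rightarrow> real) \<Rightarrow> 'k::field alg_closure) set" where
  "affine_chart N \<sigma> = {\<gamma> \<in> extensional (cone_monoid N \<sigma>).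
     \<gamma> (\<lambda>x. 0) = 1 \<and>
     (\<forall>m\<in>cone_monoid N \<sigma>. \<forall>m'\<in>cone_monoid N \<sigma>. \<gamma> (\<lambda>x. m x + m' x) = \<gamma> m * \<gamma> m')}"

definition face_inclusion ::
    "'n::real_vector set \<Rightarrow> 'n set set \<Rightarrow> ('n, 'k::field) chart_point rel" where
  "face_inclusion N \<Delta> = {((\<tau>, \<gamma>), (\<sigma>, restrict \<gamma> (cone_monoid N \<sigma>))) | \<tau> \<sigma> \<gamma>.
     \<tau> \<in> \<Delta> \<and> \<sigma> \<in> \<Delta> \<and> cone_face \<tau> \<sigma> \<and> \<gamma> \<in> affine_chart N \<tau>}"

definition glue ::
    "'n::real_vector set \<Rightarrow> 'n set set \<Rightarrow> ('n, 'k::field) chart_point rel" where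
  "glue N \<Delta> = (face_inclusion N \<Delta> \<union> (face_inclusion N \<Delta>)\<inverse>)\<^sup>*"

definition toric_variety ::
    "'n::real_vector set \<Rightarrow> 'n set set \<Rightarrow> ('n, 'k::field) chart_point set set" where
  "toric_variety N \<Delta> = (SIGMA \<sigma>:\<Delta>. affine_chart N \<sigma>) // glue N \<Delta>"

definition fan_map :: "'n::real_vector set \<Rightarrow> 'n set set \<Rightarrow>
    'm::real_vector set \<Rightarrow> 'm set set \<Rightarrow> ('n \<Rightarrow> 'm) \<Rightarrow> bool" where
  "fan_map N \<Delta> N' \<Xi> U \<longleftrightarrow> linear U \<and> U ` N \<subseteq> N' \<and> (\<forall>\<sigma>\<in>\<Delta>. \<exists>\<xi>\<in>\<Xi>. U ` \<sigma> \<subseteq> \<xi>)"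

text \<open>
  The toric morphism induced by a map of fans \<open>U\<close>: on the chart of \<open>\<sigma>\<close> it is \<open>\<gamma> \<mapsto> \<gamma> \<circ> U\<^sup>*\<close>, with
  values in the chart of any \<open>\<xi>\<close> containing \<open>U \<sigma>\<close>.  The unions select the common value of this
  recipe over all representatives of a point and all admissible \<open>\<xi>\<close>.
\<close>

definition toric_morphism :: "'n::real_vector set \<Rightarrow> 'n set set \<Rightarrow>
    'm::real_vector set \<Rightarrow> 'm set set \<Rightarrow> ('n \<Rightarrow> 'm) \<Rightarrow>
    ('n, 'k::field) chart_point set \<Rightarrow> ('m, 'k) chart_point set" where
  "toric_morphism N \<Delta> N' \<Xi> U P =
     (\<Union>(\<sigma>, \<gamma>)\<in>P. \<Union>\<xi>\<in>{\<xi>\<in>\<Xi>. U ` \<sigma> \<subseteq> \<xi>}.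
        glue N' \<Xi> `` {(\<xi>, restrict (\<lambda>m. \<gamma> (m \<circ> U)) (cone_monoid N' \<xi>))})"

text \<open>
  Surjectivity is tested on geometric points, which for morphisms of varieties over \<open>'k\<close> is
  surjectivity of the morphism of schemes.
\<close>

definition surjective_toric_morphism :: "'k::field itself \<Rightarrow> 'n::real_vector set \<Rightarrow> 'n set set \<Rightarrow>
    'm::real_vector set \<Rightarrow> 'm set set \<Rightarrow> ('n \<Rightarrow> 'm) \<Rightarrow> bool" where
  "surjective_toric_morphism K N \<Delta> N' \<Xi> U \<longleftrightarrow>
     fan_map N \<Delta> N' \<Xi> U \<and>
     toric_morphism N \<Delta> N' \<Xi> U ` (toric_variety N \<Delta> :: ('n, 'k) chart_point set set) =
       toric_variety N' \<Xi>"


section \<open>Toric vector bundles\<close>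

text \<open>
  A toric vector bundle is given by the vector space \<open>E\<close> (the whole type \<open>'e\<close>, with scalar
  multiplication \<open>scl\<close>) and its piecewise linear map \<open>\<Phi>\<close>, where \<open>\<Phi> x\<close> is a valuation on \<open>E\<close>.
  Values of \<open>\<Phi>\<close> outside the support of the fan are irrelevant.
\<close>

definition valuation :: "('k::field \<Rightarrow> 'e::ab_group_add \<Rightarrow> 'e) \<Rightarrow> ('e \<Rightarrow> ereal) \<Rightarrow> bool" where
  "valuation scl v \<longleftrightarrow>
     (\<forall>e. v e \<noteq> -\<infinity>) \<and>
     (\<forall>e f. v (e + f) \<ge> min (v e) (v f)) \<and>
     (\<forall>c e. c \<noteq> 0 \<longrightarrow> v (scl c e) = v e) \<and>
     (\<forall>e. v e = \<infinity> \<longleftrightarrow> e = 0)"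

definition decomposes :: "'e::ab_group_add set set \<Rightarrow> 'e \<Rightarrow> ('e set \<Rightarrow> 'e) \<Rightarrow> bool" where
  "decomposes F e d \<longleftrightarrow> (\<forall>L\<in>F. d L \<in> L) \<and> (\<forall>L. L \<notin> F \<longrightarrow> d L = 0) \<and> (\<Sum>L\<in>F. d L) = e"

definition frame :: "('k::field \<Rightarrow> 'e::ab_group_add \<Rightarrow> 'e) \<Rightarrow> 'e set set \<Rightarrow> bool" where
  "frame scl F \<longleftrightarrow> finite F \<and>
     (\<forall>L\<in>F. module.subspace scl L \<and> vector_space.dim scl L = 1) \<and>
     (\<forall>e. \<exists>!d. decomposes F e d)"

text \<open>The valuation \<open>\<phi>\<^sub>F(a)\<close>; the infimum of the empty set is \<open>\<infinity>\<close>.\<close>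

definition adapted_valuation ::
    "'e::ab_group_add set set \<Rightarrow> ('e set \<Rightarrow> real) \<Rightarrow> 'e \<Rightarrow> ereal" where
  "adapted_valuation F a e = Inf {ereal (a L) | L. L \<in> F \<and> (THE d. decomposes F e d) L \<noteq> 0}"

text \<open>
  \<open>T\<close> is the family of local equivariant Chern roots on the cone \<open>\<delta>\<close>, indexed by the lines of the
  frame \<open>F\<close>.
\<close>

definition local_chern_roots :: "('k::field \<Rightarrow> 'e::ab_group_add \<Rightarrow> 'e) \<Rightarrow> 'n::real_vector set \<Rightarrow>
    ('n \<Rightarrow> 'e \<Rightarrow> ereal) \<Rightarrow> 'n set \<Rightarrow> 'e set set \<Rightarrow> ('e set \<Rightarrow> 'n \<Rightarrow> real) \<Rightarrow> bool" where
  "local_chern_roots scl N \<Phi> \<delta> F T \<longleftrightarrow> frame scl F \<and>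
     (\<forall>L\<in>F. integral_linear_on N (span \<delta>) (T L)) \<and>
     (\<forall>x\<in>\<delta>. \<Phi> x = adapted_valuation F (\<lambda>L. T L x))"

definition toric_vector_bundle :: "('k::field \<Rightarrow> 'e::ab_group_add \<Rightarrow> 'e) \<Rightarrow> nat \<Rightarrow>
    'n::real_vector set \<Rightarrow> 'n set set \<Rightarrow> ('n \<Rightarrow> 'e \<Rightarrow> ereal) \<Rightarrow> bool" where
  "toric_vector_bundle scl r N \<Delta> \<Phi> \<longleftrightarrow>
     vector_space scl \<and> vector_space.dim scl UNIV = r \<and>
     (\<forall>x\<in>\<Union>\<Delta>. valuation scl (\<Phi> x)) \<and>
     (\<forall>\<delta>\<in>\<Delta>. \<exists>F T. local_chern_roots scl N \<Phi> \<delta> F T)"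

definition equivariantly_isomorphic ::
    "('k::field \<Rightarrow> 'e::ab_group_add \<Rightarrow> 'e) \<Rightarrow> ('k \<Rightarrow> 'f::ab_group_add \<Rightarrow> 'f) \<Rightarrow>
     'n set set \<Rightarrow> ('n \<Rightarrow> 'e \<Rightarrow> ereal) \<Rightarrow> ('n \<Rightarrow> 'f \<Rightarrow> ereal) \<Rightarrow> bool" where
  "equivariantly_isomorphic scl scl' \<Delta> \<Phi> \<Psi> \<longleftrightarrow>
     (\<exists>A. Vector_Spaces.linear scl scl' A \<and> bij A \<and> (\<forall>x\<in>\<Union>\<Delta>. \<forall>e. \<Psi> x (A e) = \<Phi> x e))"

definition pullback :: "('n \<Rightarrow> 'm) \<Rightarrow> ('m \<Rightarrow> 'e \<Rightarrow> ereal) \<Rightarrow> 'n \<Rightarrow> 'e \<Rightarrow> ereal" where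
  "pullback U \<Psi> = \<Psi> \<circ> U"

text \<open>
  Tensor product with \<open>O(div \<chi>\<^sup>u)\<close>: that line bundle has piecewise linear map \<open>u\<close>, and the fibre
  \<open>E \<otimes> k\<close> is identified with \<open>E\<close>.
\<close>

definition twist :: "('n \<Rightarrow> 'e \<Rightarrow> ereal) \<Rightarrow> ('n \<Rightarrow> real) \<Rightarrow> 'n \<Rightarrow> 'e \<Rightarrow> ereal" where
  "twist \<Phi> u x e = \<Phi> x e + ereal (u x)"


section \<open>Chern classes\<close>

text \<open>
  The multiset of values at \<open>x\<close> of the local Chern roots is determined by \<open>\<Phi> x\<close>, so the
  description below does not depend on the choices of \<open>\<delta>\<close>, \<open>F\<close> and \<open>T\<close>.
\<close>

definition chern_class :: "('k::field \<Rightarrow> 'e::ab_group_add \<Rightarrow> 'e) \<Rightarrow> 'n::real_vector set \<Rightarrow>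
    'n set set \<Rightarrow> ('n \<Rightarrow> 'e \<Rightarrow> ereal) \<Rightarrow> nat \<Rightarrow> 'n \<Rightarrow> real" where
  "chern_class scl N \<Delta> \<Phi> i x =
     (THE y. \<exists>\<delta>\<in>\<Delta>. x \<in> \<delta> \<and> (\<exists>F T. local_chern_roots scl N \<Phi> \<delta> F T \<and>
        y = (\<Sum>S | S \<subseteq> F \<and> card S = i. \<Prod>L\<in>S. T L x)))"

definition total_chern_class :: "('k::field \<Rightarrow> 'e::ab_group_add \<Rightarrow> 'e) \<Rightarrow> 'n::real_vector set \<Rightarrow>
    'n set set \<Rightarrow> ('n \<Rightarrow> 'e \<Rightarrow> ereal) \<Rightarrow> 'n \<Rightarrow> real" where
  "total_chern_class scl N \<Delta> \<Phi> x =
     1 + (\<Sum>i = 1..vector_space.dim scl (UNIV :: 'e set). chern_class scl N \<Delta> \<Phi> i x)"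

inductive polynomial_map :: "('n::real_vector \<Rightarrow> real) \<Rightarrow> bool" where
  linear: "linear f \<Longrightarrow> polynomial_map f"
| const: "polynomial_map (\<lambda>x. c)"
| add: "polynomial_map f \<Longrightarrow> polynomial_map g \<Longrightarrow> polynomial_map (\<lambda>x. f x + g x)"
| mult: "polynomial_map f \<Longrightarrow> polynomial_map g \<Longrightarrow> polynomial_map (\<lambda>x. f x * g x)"

definition trivial_chern_class :: "('k::field \<Rightarrow> 'e::ab_group_add \<Rightarrow> 'e) \<Rightarrow> 'n::real_vector set \<Rightarrow>
    'n set set \<Rightarrow> ('n \<Rightarrow> 'e \<Rightarrow> ereal) \<Rightarrow> bool" where
  "trivial_chern_class scl N \<Delta> \<Phi> \<longleftrightarrow>
     (\<exists>p. polynomial_map p \<and> (\<forall>x\<in>\<Union>\<Delta>. total_chern_class scl N \<Delta> \<Phi> x = p x))"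

definition global_chern_roots :: "('k::field \<Rightarrow> 'e::ab_group_add \<Rightarrow> 'e) \<Rightarrow> 'n::real_vector set \<Rightarrow>
    'n set set \<Rightarrow> ('n \<Rightarrow> 'e \<Rightarrow> ereal) \<Rightarrow> ('r \<Rightarrow> 'n \<Rightarrow> real) \<Rightarrow> bool" where
  "global_chern_roots scl N \<Delta> \<Phi> u \<longleftrightarrow>
     (\<forall>i. u i \<in> dual_lattice N) \<and>
     (\<forall>\<delta>\<in>\<Delta>. \<exists>F T L. local_chern_roots scl N \<Phi> \<delta> F T \<and> bij_betw L UNIV F \<and>
        (\<forall>i. \<forall>x\<in>span \<delta>. T (L i) x = u i x))"

definition affinely_independent_family :: "('r::finite \<Rightarrow> 'n \<Rightarrow> real) \<Rightarrow> bool" where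
  "affinely_independent_family u \<longleftrightarrow>
     (\<forall>c :: 'r \<Rightarrow> real. (\<Sum>i\<in>UNIV. c i) = 0 \<and> (\<forall>x. (\<Sum>i\<in>UNIV. c i * u i x) = 0) \<longrightarrow> (\<forall>i. c i = 0))"


section \<open>The space \<open>\<real>\<^sup>r/\<real>\<one>\<close> and the permutohedral fan\<close>

text \<open>The constant \<open>1\<close> of type \<open>real ^ 'r\<close> is the all-ones vector.\<close>

quotient_type 'r quot_ones = "real ^ 'r" / "\<lambda>x y. \<exists>c. x - y = c *\<^sub>R 1"
proof (rule equivpI)
  show "reflp (\<lambda>x y :: real ^ 'r. \<exists>c. x - y = c *\<^sub>R 1)"
    by (rule reflpI) (auto intro: exI[of _ 0])
  show "symp (\<lambda>x y :: real ^ 'r. \<exists>c. x - y = c *\<^sub>R 1)"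
  proof (rule sympI)
    fix x y :: "real ^ 'r" assume "\<exists>c. x - y = c *\<^sub>R 1"
    then obtain c where "x - y = c *\<^sub>R 1" ..
    moreover have "y - x = - (x - y)" by simp
    ultimately have "y - x = (- c) *\<^sub>R 1" by (simp only: scaleR_minus_left)
    then show "\<exists>c. y - x = c *\<^sub>R 1" ..
  qed
  show "transp (\<lambda>x y :: real ^ 'r. \<exists>c. x - y = c *\<^sub>R 1)"
  proof (rule transpI)
    fix x y z :: "real ^ 'r" assume "\<exists>c. x - y = c *\<^sub>R 1" "\<exists>c. y - z = c *\<^sub>R 1"
    then obtain c d where "x - y = c *\<^sub>R 1" "y - z = d *\<^sub>R 1" by blast
    moreover have "x - z = (x - y) + (y - z)" by simp
    ultimately have "x - z = (c + d) *\<^sub>R 1" by (simp only: scaleR_left_distrib)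
    then show "\<exists>c. x - z = c *\<^sub>R 1" ..
  qed
qed

instantiation quot_ones :: (finite) real_vector
begin

lift_definition zero_quot_ones :: "'a quot_ones" is 0 .

lift_definition plus_quot_ones :: "'a quot_ones \<Rightarrow> 'a quot_ones \<Rightarrow> 'a quot_ones" is "(+)"
proof -
  fix a b c d :: "real ^ 'a"
  assume "\<exists>s. a - b = s *\<^sub>R 1" "\<exists>t. c - d = t *\<^sub>R 1"
  then obtain s t where "a - b = s *\<^sub>R 1" "c - d = t *\<^sub>R 1" by blast
  then have "(a + c) - (b + d) = (s + t) *\<^sub>R 1" by (simp only: add_diff_add scaleR_left_distrib)
  then show "\<exists>s. (a + c) - (b + d) = s *\<^sub>R 1" ..
qed

lift_definition uminus_quot_ones :: "'a quot_ones \<Rightarrow> 'a quot_ones" is uminus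
proof -
  fix a b :: "real ^ 'a"
  assume "\<exists>s. a - b = s *\<^sub>R 1"
  then obtain s where "a - b = s *\<^sub>R 1" ..
  then have "- a - - b = (- s) *\<^sub>R 1" by (simp only: minus_diff_minus scaleR_minus_left)
  then show "\<exists>s. - a - - b = s *\<^sub>R 1" ..
qed

lift_definition minus_quot_ones :: "'a quot_ones \<Rightarrow> 'a quot_ones \<Rightarrow> 'a quot_ones" is "(-)"
proof -
  fix a b c d :: "real ^ 'a"
  assume "\<exists>s. a - b = s *\<^sub>R 1" "\<exists>t. c - d = t *\<^sub>R 1"
  then obtain s t where "a - b = s *\<^sub>R 1" "c - d = t *\<^sub>R 1" by blast
  moreover have "(a - c) - (b - d) = (a - b) - (c - d)" by simp
  ultimately have "(a - c) - (b - d) = (s - t) *\<^sub>R 1" by (simp only: scaleR_left_diff_distrib)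
  then show "\<exists>s. (a - c) - (b - d) = s *\<^sub>R 1" ..
qed

lift_definition scaleR_quot_ones :: "real \<Rightarrow> 'a quot_ones \<Rightarrow> 'a quot_ones" is scaleR
proof -
  fix r and a b :: "real ^ 'a"
  assume "\<exists>s. a - b = s *\<^sub>R 1"
  then obtain s where "a - b = s *\<^sub>R 1" ..
  then have "r *\<^sub>R a - r *\<^sub>R b = (r * s) *\<^sub>R 1"
    by (simp only: scaleR_right_diff_distrib[symmetric] scaleR_scaleR)
  then show "\<exists>s. r *\<^sub>R a - r *\<^sub>R b = s *\<^sub>R 1" ..
qed

instance
  by standard (transfer, rule exI[of _ 0], simp add: algebra_simps)+

end

lift_definition coord_diff :: "'r::finite \<Rightarrow> 'r \<Rightarrow> 'r quot_ones \<Rightarrow> real" is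
  "\<lambda>i j x. x $ i - x $ j"
proof -
  fix i j and x y :: "real ^ 'r"
  assume "\<exists>c. x - y = c *\<^sub>R 1"
  then obtain c where "x - y = c *\<^sub>R 1" ..
  then have "(x - y) $ k = (c *\<^sub>R 1) $ k" for k by simp
  then have "x $ k - y $ k = c" for k by simp
  from this[of i] this[of j] show "x $ i - x $ j = y $ i - y $ j" by simp
qed

definition quot_ones_lattice :: "'r::finite quot_ones set" where
  "quot_ones_lattice = abs_quot_ones ` {x. \<forall>i. x $ i \<in> \<int>}"

text \<open>
  Each point \<open>x\<close> lies in the relative interior of exactly one cone of the fan of the arrangement
  \<open>x\<^sub>i = x\<^sub>j\<close>, namely the set of all \<open>y\<close> that satisfy every weak inequality between two
  coordinates that \<open>x\<close> satisfies.
\<close>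

definition permutohedral_fan :: "'r::finite quot_ones set set" where
  "permutohedral_fan = range (\<lambda>x. {y. \<forall>i j. 0 \<le> coord_diff i j x \<longrightarrow> 0 \<le> coord_diff i j y})"

definition chern_root_map :: "('r::finite \<Rightarrow> 'n \<Rightarrow> real) \<Rightarrow> 'n \<Rightarrow> 'r quot_ones" where
  "chern_root_map u x = abs_quot_ones (\<chi> i. u i x)"

end

theory Submission
  imports Defs "HOL-Library.Function_Algebras"
begin

text \<open>
  Let \<open>E\<^sub>x\<^sub>,\<^sub>t = {e. t \<le> \<E> x e}\<close>.  By the global Chern roots, \<open>E\<^sub>x\<^sub>,\<^sub>t\<close> is spanned on each cone by the frame
  lines with index in \<open>I = {i. t \<le> u\<^sub>i(x)}\<close>; following a segment through the closed cones of \<open>\<Delta>\<close>, one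
  sees that it depends only on \<open>I\<close>.  So \<open>\<E>\<close> amounts to a monotone map \<open>V\<close> from the subsets of the index
  set to the subspaces of \<open>E\<close>, with \<open>dim (V I) = |I|\<close>; by affine independence every \<open>I\<close> occurs.  As
  \<open>V\<close> only sees the differences \<open>u\<^sub>i - u\<^sub>j\<close>, the twist of \<open>\<E>\<close> by \<open>-u\<^sub>j\<close> descends to \<open>\<real>\<^sup>r/\<real>\<one>\<close>.

  For a full flag of index sets, the sets \<open>J\<close> with \<open>V I \<inter> V J = V (I \<inter> J)\<close> for all \<open>I\<close> in the flag form a
  distributive lattice on which \<open>V\<close> is a lattice homomorphism, hence is split by a single frame.  The
  points of \<open>\<real>\<^sup>r/\<real>\<one>\<close> all of whose level sets lie in this lattice form a cone.  These cones and their
  faces are the fan \<open>\<Xi>\<close>; both the fan axioms and the fact that \<open>U\<close> maps each cone of \<open>\<Delta>\<close> into one of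
  them follow from one statement about summands of points of such a cone.
\<close>

section \<open>Finitely generated cones\<close>

text \<open>A cone of \<open>\<Delta>\<close> comes with its own frame, unrelated to any flag, so it
  is not clear that its image fits into a cone built from a flag. The summand statement
  \<open>summand_in_level_cone\<close> removes this obstacle: let \<open>a\<close> and
  \<open>b\<close> have all level sets in one lattice on which \<open>V\<close> is a homomorphism;
  if the level sets of \<open>a + b\<close> are compatible with a flag, so are those of
  \<open>a\<close>. A face of a convex cone is the same as a subcone closed under summands. With the
  lattice of a second flag the statement therefore shows that cones of two flags meet in a common
  face; with the lattice of a frame, and an interior point of a cone of \<open>\<Delta>\<close>, it
  shows that the whole image follows that point into one cone. Surjectivity on geometric points is a
  separate matter: a point in the orbit of a face is a character on a monoid, and it is lifted over
  a point of \<open>\<Delta>\<close> lying above the relative interior of the face. The character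
  extends because an algebraically closed field contains all roots of its elements.\<close>

lemma convex_cone_sum:
  assumes "convex_cone C" "finite A" "\<And>a. a \<in> A \<Longrightarrow> f a \<in> C"
  shows "(\<Sum>a\<in>A. f a) \<in> C"
  using assms(2,3)
  by (induction) (auto intro: convex_cone_add[OF assms(1)] convex_cone_contains_0[OF assms(1)])

lemma convex_cone_hull_finite:
  fixes A :: "'a::real_vector set"
  assumes "finite A"
  shows "convex_cone hull A = {(\<Sum>a\<in>A. c a *\<^sub>R a) | c. \<forall>a\<in>A. 0 \<le> c a}"
proof (intro equalityI hull_minimal subsetI)
  fix a assume a: "a \<in> A"
  have "a = (\<Sum>b\<in>A. (if b = a then 1 else 0) *\<^sub>R b)"
    using assms a by (simp add: if_distrib[of "\<lambda>c. c *\<^sub>R _"] cong: if_cong)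
  then show "a \<in> {(\<Sum>a\<in>A. c a *\<^sub>R a) | c. \<forall>a\<in>A. 0 \<le> c a}" by fastforce
next
  show "convex_cone {(\<Sum>a\<in>A. c a *\<^sub>R a) | c. \<forall>a\<in>A. 0 \<le> c a}"
    unfolding convex_cone_iff
  proof (intro conjI ballI allI impI)
    show "0 \<in> {(\<Sum>a\<in>A. c a *\<^sub>R a) | c. \<forall>a\<in>A. 0 \<le> c a}"
      by (auto intro!: exI[of _ "\<lambda>_. 0"])
  next
    fix x y assume "x \<in> {(\<Sum>a\<in>A. c a *\<^sub>R a) | c. \<forall>a\<in>A. 0 \<le> c a}"
      "y \<in> {(\<Sum>a\<in>A. c a *\<^sub>R a) | c. \<forall>a\<in>A. 0 \<le> c a}"
    then obtain c d where "x = (\<Sum>a\<in>A. c a *\<^sub>R a)" "y = (\<Sum>a\<in>A. d a *\<^sub>R a)"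
      "\<forall>a\<in>A. 0 \<le> c a" "\<forall>a\<in>A. 0 \<le> d a" by blast
    then show "x + y \<in> {(\<Sum>a\<in>A. c a *\<^sub>R a) | c. \<forall>a\<in>A. 0 \<le> c a}"
      by (auto intro!: exI[of _ "\<lambda>a. c a + d a"] simp: scaleR_left_distrib sum.distrib)
  next
    fix x and t :: real assume "x \<in> {(\<Sum>a\<in>A. c a *\<^sub>R a) | c. \<forall>a\<in>A. 0 \<le> c a}" and t: "0 \<le> t"
    then obtain c where "x = (\<Sum>a\<in>A. c a *\<^sub>R a)" "\<forall>a\<in>A. 0 \<le> c a" by blast
    then show "t *\<^sub>R x \<in> {(\<Sum>a\<in>A. c a *\<^sub>R a) | c. \<forall>a\<in>A. 0 \<le> c a}"
      using t by (auto intro!: exI[of _ "\<lambda>a. t * c a"] simp: scaleR_right.sum)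
  qed
next
  fix x assume "x \<in> {(\<Sum>a\<in>A. c a *\<^sub>R a) | c. \<forall>a\<in>A. 0 \<le> c a}"
  then show "x \<in> convex_cone hull A"
    by (clarsimp intro!: convex_cone_sum[OF convex_cone_convex_cone_hull assms])
       (auto intro: convex_cone_hull_mul hull_inc)
qed

text \<open>A nonnegative combination is moved along a linear relation among the generators until
  the first coefficient reaches zero. Which generator is dropped depends on
  \<open>x\<close>.\<close>

lemma convex_cone_hull_dependent:
  fixes A :: "'a::real_vector set"
  assumes A: "finite A" and dep: "dependent A" and x: "x \<in> convex_cone hull A"
  shows "\<exists>a\<in>A. x \<in> convex_cone hull (A - {a})"
proof -
  obtain c where c: "x = (\<Sum>a\<in>A. c a *\<^sub>R a)" "\<forall>a\<in>A. 0 \<le> c a"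
    using x unfolding convex_cone_hull_finite[OF A] by blast
  obtain g v where g: "v \<in> A" "g v \<noteq> 0" "(\<Sum>a\<in>A. g a *\<^sub>R a) = 0"
    using dep unfolding dependent_finite[OF A] by blast
  obtain u where u: "0 < u v" "(\<Sum>a\<in>A. u a *\<^sub>R a) = 0"
  proof (cases "0 < g v")
    case True
    then show thesis using g that by blast
  next
    case False
    then show thesis using g by (intro that[of "\<lambda>a. - g a"]) (auto simp: sum_negf)
  qed
  define P where "P = {a \<in> A. 0 < u a}"
  \<comment> \<open>The largest multiple of the relation that can be subtracted without making a
    coefficient negative. It is attained at \<open>w\<close>, whose new coefficient is zero.\<close>
  define \<theta> where "\<theta> = Min ((\<lambda>a. c a / u a) ` P)"
  have P: "finite P" "P \<noteq> {}" using A u g by (auto simp: P_def)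
  have "\<theta> \<in> (\<lambda>a. c a / u a) ` P" unfolding \<theta>_def using P by (intro Min_in) auto
  then obtain w where w: "w \<in> P" "\<theta> = c w / u w" by blast
  have \<theta>_le: "\<theta> \<le> c a / u a" if "a \<in> P" for a
    unfolding \<theta>_def using P that by (intro Min_le) auto
  have "0 \<le> \<theta>" using w c by (auto simp: P_def)
  have nonneg: "0 \<le> c a - \<theta> * u a" if "a \<in> A" for a
  proof (cases "0 < u a")
    case True
    then show ?thesis using \<theta>_le[of a] that by (simp add: P_def field_simps)
  next
    case False
    then have "\<theta> * u a \<le> 0" using \<open>0 \<le> \<theta>\<close> by (simp add: mult_nonneg_nonpos)
    moreover have "0 \<le> c a" using c that by blast
    ultimately show ?thesis by linarith
  qed
  have "x = (\<Sum>a\<in>A. (c a - \<theta> * u a) *\<^sub>R a)"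
    using c(1) u(2) by (simp add: scaleR_left_diff_distrib sum_subtractf
        flip: scaleR_scaleR scaleR_right.sum)
  also have "\<dots> = (\<Sum>a\<in>A - {w}. (c a - \<theta> * u a) *\<^sub>R a)"
    using A w by (intro sum.mono_neutral_right) (auto simp: P_def)
  finally have "x \<in> convex_cone hull (A - {w})"
    using A nonneg by (subst convex_cone_hull_finite) auto
  then show ?thesis using w by (auto simp: P_def)
qed

text \<open>
  Finitely generated cones are closed; since the ambient space carries no topology, closedness is
  expressed along lines.  By Caratheodory's argument the generators may be taken independent.
\<close>

lemma convex_cone_hull_line_limit:
  fixes A :: "'a::real_vector set"
  assumes "finite A"
    and "\<And>\<epsilon>. 0 < \<epsilon> \<Longrightarrow> \<exists>s. s \<noteq> 0 \<and> \<bar>s\<bar> < \<epsilon> \<and> p + s *\<^sub>R q \<in> convex_cone hull A"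
  shows "p \<in> convex_cone hull A"
  using assms
proof (induction A rule: finite_psubset_induct)
  case (psubset A)
  note A = \<open>finite A\<close> and lim = psubset.prems
  show ?case
  proof (cases "dependent A")
    case True
    \<comment> \<open>The generator dropped may vary with \<open>s\<close>, but one of the finitely
      many must serve for arbitrarily small \<open>s\<close>: otherwise the least of the bounds
      \<open>\<epsilon> a\<close> contradicts \<open>lim\<close>.\<close>
    have "\<exists>a\<in>A. \<forall>\<epsilon>>0. \<exists>s. s \<noteq> 0 \<and> \<bar>s\<bar> < \<epsilon> \<and> p + s *\<^sub>R q \<in> convex_cone hull (A - {a})"
    proof (rule ccontr)
      assume "\<not> ?thesis"
      then obtain \<epsilon> where \<epsilon>: "\<And>a. a \<in> A \<Longrightarrow> 0 < \<epsilon> a"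
        "\<And>a s. a \<in> A \<Longrightarrow> s \<noteq> 0 \<Longrightarrow> \<bar>s\<bar> < \<epsilon> a \<Longrightarrow> p + s *\<^sub>R q \<notin> convex_cone hull (A - {a})"
        by metis
      define \<delta> where "\<delta> = Min (insert 1 (\<epsilon> ` A))"
      have "0 < \<delta>" unfolding \<delta>_def using A \<epsilon>(1) by (subst Min_gr_iff) auto
      then obtain s where s: "s \<noteq> 0" "\<bar>s\<bar> < \<delta>" "p + s *\<^sub>R q \<in> convex_cone hull A"
        using lim by blast
      obtain a where a: "a \<in> A" "p + s *\<^sub>R q \<in> convex_cone hull (A - {a})"
        using convex_cone_hull_dependent[OF A True s(3)] by blast
      moreover have "\<delta> \<le> \<epsilon> a" unfolding \<delta>_def using A a by (intro Min_le) auto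
      ultimately show False using \<epsilon>(2)[OF a(1) s(1)] s(2) by simp
    qed
    then obtain a where a: "a \<in> A"
      and "\<And>\<epsilon>. 0 < \<epsilon> \<Longrightarrow> \<exists>s. s \<noteq> 0 \<and> \<bar>s\<bar> < \<epsilon> \<and> p + s *\<^sub>R q \<in> convex_cone hull (A - {a})"
      by blast
    then have "p \<in> convex_cone hull (A - {a})"
      by (intro psubset.IH) auto
    then show ?thesis using hull_mono[of "A - {a}" A convex_cone] by auto
  next
    case False
    \<comment> \<open>Two distinct parameters with points in the cone put \<open>q\<close>, and then
      \<open>p\<close>, into the span of the generators.\<close>
    obtain s1 where s1: "s1 \<noteq> 0" "p + s1 *\<^sub>R q \<in> convex_cone hull A"
      using lim[of 1] by auto
    obtain s2 where s2: "\<bar>s2\<bar> < \<bar>s1\<bar>" "p + s2 *\<^sub>R q \<in> convex_cone hull A"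
      using lim[of "\<bar>s1\<bar>"] s1 by auto
    have hs: "convex_cone hull A \<subseteq> span A"
      by (intro hull_minimal span_superset convex_cone_span)
    have "(p + s1 *\<^sub>R q) - (p + s2 *\<^sub>R q) \<in> span A"
      using s1(2) s2(2) hs by (intro span_diff) auto
    then have "(s1 - s2) *\<^sub>R q \<in> span A" by (simp add: scaleR_left_diff_distrib)
    moreover have "s1 - s2 \<noteq> 0" using s2(1) by auto
    ultimately have q: "q \<in> span A"
      using span_scale[of "(s1 - s2) *\<^sub>R q" A "1 / (s1 - s2)"] by simp
    have "(p + s1 *\<^sub>R q) - s1 *\<^sub>R q \<in> span A"
      using s1(2) hs q by (intro span_diff span_scale) auto
    then have p: "p \<in> span A" by simp
    obtain P Q where PQ: "p = (\<Sum>a\<in>A. P a *\<^sub>R a)" "q = (\<Sum>a\<in>A. Q a *\<^sub>R a)"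
      using p q unfolding span_finite[OF A] by auto
    have "0 \<le> P a" if a: "a \<in> A" for a
    proof (rule ccontr)
      assume neg: "\<not> 0 \<le> P a"
      \<comment> \<open>For \<open>\<bar>s\<bar> < \<epsilon>\<close> the coefficient
        \<open>P a + s * Q a\<close> is still negative, against uniqueness of coefficients. The
        summand 1 prevents division by zero.\<close>
      define \<epsilon> where "\<epsilon> = - P a / (\<bar>Q a\<bar> + 1)"
      have "0 < \<epsilon>" unfolding \<epsilon>_def by (intro divide_pos_pos) (use neg in auto)
      then obtain s where s: "\<bar>s\<bar> < \<epsilon>" "p + s *\<^sub>R q \<in> convex_cone hull A" using lim by blast
      then obtain c where c: "p + s *\<^sub>R q = (\<Sum>a\<in>A. c a *\<^sub>R a)" "\<forall>a\<in>A. 0 \<le> c a"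
        unfolding convex_cone_hull_finite[OF A] by blast
      have "(\<Sum>a\<in>A. (P a + s * Q a - c a) *\<^sub>R a) = 0"
        using c(1) unfolding PQ
        by (simp add: scaleR_left_diff_distrib scaleR_left_distrib sum_subtractf sum.distrib
            scaleR_right.sum)
      then have "P a + s * Q a = c a"
        using independentD[OF _ A order_refl, of "\<lambda>a. P a + s * Q a - c a" a] False a by simp
      moreover have "s * Q a \<le> \<bar>s\<bar> * (\<bar>Q a\<bar> + 1)"
        using abs_ge_self[of "s * Q a"] by (simp add: abs_mult distrib_left)
      moreover have "\<bar>s\<bar> * (\<bar>Q a\<bar> + 1) < - P a"
        using s(1) unfolding \<epsilon>_def by (subst (asm) pos_less_divide_eq) auto
      moreover have "0 \<le> c a" using c(2) a by blast
      ultimately show False by linarith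
    qed
    then show ?thesis using PQ(1) unfolding convex_cone_hull_finite[OF A] by blast
  qed
qed

text \<open>Transfers closedness of the cone to the real parameter, where a topology is available.
  The connectedness argument along segments rests on it.\<close>

lemma closed_convex_cone_hull_line:
  fixes A :: "'a::real_vector set"
  assumes "finite A"
  shows "closed {s. p + s *\<^sub>R q \<in> convex_cone hull A}"
  unfolding closed_limpt
proof (intro allI impI)
  fix s assume "s islimpt {s. p + s *\<^sub>R q \<in> convex_cone hull A}"
  then have lim: "\<exists>t. p + t *\<^sub>R q \<in> convex_cone hull A \<and> t \<noteq> s \<and> dist t s < \<epsilon>" if "0 < \<epsilon>" for \<epsilon>
    using that unfolding islimpt_approachable by blast
  have "p + s *\<^sub>R q \<in> convex_cone hull A"
  proof (rule convex_cone_hull_line_limit[OF assms])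
    fix \<epsilon> :: real assume "0 < \<epsilon>"
    then obtain t where "p + t *\<^sub>R q \<in> convex_cone hull A" "t \<noteq> s" "dist t s < \<epsilon>"
      using lim by blast
    then show "\<exists>r. r \<noteq> 0 \<and> \<bar>r\<bar> < \<epsilon> \<and> p + s *\<^sub>R q + r *\<^sub>R q \<in> convex_cone hull A"
      by (intro exI[of _ "t - s"])
         (auto simp: dist_real_def scaleR_left_diff_distrib)
  qed
  then show "s \<in> {s. p + s *\<^sub>R q \<in> convex_cone hull A}" by simp
qed

section \<open>Faces of convex cones described by sums\<close>

lemma face_of_convex_cone_add:
  assumes C: "convex_cone C" and \<tau>: "\<tau> face_of C" and ab: "a \<in> C" "b \<in> C" "a + b \<in> \<tau>"
  shows "a \<in> \<tau>"
proof -
  \<comment> \<open>The point \<open>2 *\<^sub>R x\<close> is the midpoint of \<open>x\<close> and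
    \<open>3 *\<^sub>R x\<close>. Halving is needed because \<open>a + b\<close> is the midpoint of
    \<open>2 *\<^sub>R a\<close> and \<open>2 *\<^sub>R b\<close>, which only puts
    \<open>2 *\<^sub>R a\<close> into the face.\<close>
  have half: "x \<in> \<tau>" if x: "x \<in> C" "2 *\<^sub>R x \<in> \<tau>" for x
  proof (cases "x = 0")
    case False
    have "3 *\<^sub>R x = x + 2 *\<^sub>R x" using scaleR_left_distrib[of 1 2 x] by simp
    then have "x \<noteq> 3 *\<^sub>R x" using False by simp
    moreover have "2 *\<^sub>R x = (1 - 1/2) *\<^sub>R x + (1/2) *\<^sub>R (3 *\<^sub>R x)"
      by (simp flip: scaleR_left_distrib)
    ultimately have "2 *\<^sub>R x \<in> open_segment x (3 *\<^sub>R x)"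
      unfolding in_segment by (intro conjI exI[of _ "1/2"]) auto
    moreover have "3 *\<^sub>R x \<in> C" using C x by (intro convex_cone_scaleR) auto
    ultimately show ?thesis using \<tau> x unfolding face_of_def by blast
  qed (use x in simp)
  show ?thesis
  proof (cases "a = b")
    case True
    then show ?thesis using half ab by (simp add: scaleR_2)
  next
    case False
    have 2: "2 *\<^sub>R a \<in> C" "2 *\<^sub>R b \<in> C" using C ab by (auto intro: convex_cone_scaleR)
    have "a + b \<in> open_segment (2 *\<^sub>R a) (2 *\<^sub>R b)"
      using False by (auto simp: in_segment intro!: exI[of _ "1/2"])
    then have "2 *\<^sub>R a \<in> \<tau>" using \<tau> ab 2 unfolding face_of_def by blast
    then show ?thesis using half ab by blast
  qed
qed

text \<open>Replaces open segments by addition. In this form the face condition follows directly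
  from statements about summands of points of a cone.\<close>

lemma face_of_convex_cone_iff:
  assumes C: "convex_cone C"
  shows "\<tau> face_of C \<and> \<tau> \<noteq> {} \<longleftrightarrow>
    convex_cone \<tau> \<and> \<tau> \<subseteq> C \<and> (\<forall>a\<in>C. \<forall>b\<in>C. a + b \<in> \<tau> \<longrightarrow> a \<in> \<tau>)"
    (is "?L \<longleftrightarrow> ?R")
proof
  assume L: ?L
  note add = face_of_convex_cone_add[OF C conjunct1[OF L]]
  have sub: "\<tau> \<subseteq> C" and conv: "convex \<tau>" using L by (auto simp: face_of_def)
  have 0: "0 \<in> \<tau>"
    using L add[of 0] sub convex_cone_contains_0[OF C] by fastforce
  have dbl: "2 *\<^sub>R x \<in> \<tau>" if "x \<in> \<tau>" for x
  proof (cases "x = 0")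
    case False
    have "x \<in> open_segment 0 (2 *\<^sub>R x)"
      using False by (auto simp: in_segment intro!: exI[of _ "1/2"])
    moreover have "2 *\<^sub>R x \<in> C" using C sub that by (intro convex_cone_scaleR) auto
    ultimately show ?thesis using L that convex_cone_contains_0[OF C] unfolding face_of_def by blast
  qed (use 0 in simp)
  have plus: "x + y \<in> \<tau>" if "x \<in> \<tau>" "y \<in> \<tau>" for x y
  proof -
    have "(1/2) *\<^sub>R (2 *\<^sub>R x) + (1/2) *\<^sub>R (2 *\<^sub>R y) \<in> \<tau>"
      using dbl that by (intro convexD[OF conv]) auto
    then show ?thesis by simp
  qed
  \<comment> \<open>Sums only give natural multiples; \<open>c *\<^sub>R x\<close> is recovered as a
    summand of \<open>real n *\<^sub>R x\<close> for some \<open>n\<close> at least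
    \<open>c\<close>.\<close>
  have "c *\<^sub>R x \<in> \<tau>" if x: "x \<in> \<tau>" and c: "0 \<le> c" for x c
  proof -
    obtain n :: nat where n: "c \<le> n" using real_arch_simple by blast
    have "real n *\<^sub>R x \<in> \<tau>"
    proof (induction n)
      case (Suc n)
      have "real (Suc n) *\<^sub>R x = x + real n *\<^sub>R x" by (simp add: scaleR_left_distrib)
      then show ?case using plus[OF x Suc] by simp
    qed (use 0 in simp)
    moreover have "real n *\<^sub>R x = c *\<^sub>R x + (real n - c) *\<^sub>R x"
      by (simp add: scaleR_left_diff_distrib)
    ultimately show ?thesis
      using n c sub x by (intro add[of "c *\<^sub>R x" "(real n - c) *\<^sub>R x"])
        (auto intro: convex_cone_scaleR[OF C])
  qed
  then show ?R using 0 plus sub add unfolding convex_cone_iff by blast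
next
  assume R: ?R
  then have cc: "convex_cone \<tau>" by blast
  have "x \<in> \<tau>"
    if "x \<in> C" "y \<in> C" "(1 - t) *\<^sub>R x + t *\<^sub>R y \<in> \<tau>" "0 < t" "t < 1" for x y t
  proof -
    have "(1 - t) *\<^sub>R x \<in> C" "t *\<^sub>R y \<in> C"
      using that by (auto intro: convex_cone_scaleR[OF C])
    then have "(1 - t) *\<^sub>R x \<in> \<tau>" using R that(3) by blast
    then have "(1 / (1 - t)) *\<^sub>R ((1 - t) *\<^sub>R x) \<in> \<tau>"
      using that by (intro convex_cone_scaleR[OF cc, of "1 / (1 - t)"]) auto
    moreover have "(1 / (1 - t)) *\<^sub>R ((1 - t) *\<^sub>R x) = x" using that by simp
    ultimately show ?thesis by (simp only:)
  qed
  note seg = this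
  have "\<tau> face_of C"
    unfolding face_of_def
  proof (intro conjI ballI impI)
    fix a b x assume H: "a \<in> C" "b \<in> C" "x \<in> \<tau>" "x \<in> open_segment a b"
    then obtain t where t: "0 < t" "t < 1" "x = (1 - t) *\<^sub>R a + t *\<^sub>R b"
      by (auto simp: in_segment)
    show "a \<in> \<tau>" using seg[of a b t] H t by simp
    show "b \<in> \<tau>" using seg[of b a "1 - t"] H t by (simp add: add.commute)
  qed (use R cc in \<open>auto simp: convex_cone_def\<close>)
  then show ?L using convex_cone_nonempty[OF cc] by blast
qed

text \<open>In a nonnegative combination representing a point of the face, each generator with
  nonzero coefficient is, up to scaling, a summand of that point and so lies in the face. Hence a
  finitely generated cone has finitely many faces, and they inherit rationality.\<close>

lemma face_of_convex_cone_hull: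
  fixes A :: "'a::real_vector set"
  assumes A: "finite A" and \<tau>: "\<tau> face_of (convex_cone hull A)" "\<tau> \<noteq> {}"
  shows "\<tau> = convex_cone hull (A \<inter> \<tau>)"
proof
  have C: "convex_cone (convex_cone hull A)" by (rule convex_cone_convex_cone_hull)
  have cc: "convex_cone \<tau>" and sub: "\<tau> \<subseteq> convex_cone hull A"
    and add: "\<And>a b. a \<in> convex_cone hull A \<Longrightarrow> b \<in> convex_cone hull A \<Longrightarrow> a + b \<in> \<tau> \<Longrightarrow> a \<in> \<tau>"
    using face_of_convex_cone_iff[OF C, of \<tau>] \<tau> by blast+
  show "convex_cone hull (A \<inter> \<tau>) \<subseteq> \<tau>" by (intro hull_minimal cc) simp
  show "\<tau> \<subseteq> convex_cone hull (A \<inter> \<tau>)"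
  proof
    fix x assume x: "x \<in> \<tau>"
    then obtain c where c: "x = (\<Sum>a\<in>A. c a *\<^sub>R a)" "\<forall>a\<in>A. 0 \<le> c a"
      using sub unfolding convex_cone_hull_finite[OF A] by blast
    have term_in: "c a *\<^sub>R a \<in> convex_cone hull A" if "a \<in> A" for a
      using that c by (intro convex_cone_hull_mul hull_inc) auto
    have zero: "c a = 0" if a: "a \<in> A" "a \<notin> \<tau>" for a
    proof (rule ccontr)
      assume "c a \<noteq> 0"
      have "x = c a *\<^sub>R a + (\<Sum>b\<in>A - {a}. c b *\<^sub>R b)"
        using c(1) sum.remove[OF A a(1)] by metis
      moreover have "(\<Sum>b\<in>A - {a}. c b *\<^sub>R b) \<in> convex_cone hull A"
        using A term_in by (intro convex_cone_sum[OF C]) auto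
      ultimately have "c a *\<^sub>R a \<in> \<tau>" using add[OF term_in[OF a(1)]] x by blast
      then have "(1 / c a) *\<^sub>R (c a *\<^sub>R a) \<in> \<tau>"
        using c a by (intro convex_cone_scaleR[OF cc, of "1 / c a"]) auto
      moreover have "(1 / c a) *\<^sub>R (c a *\<^sub>R a) = a" using \<open>c a \<noteq> 0\<close> by simp
      ultimately show False using a by (simp only:)
    qed
    have "x = (\<Sum>a\<in>A \<inter> \<tau>. c a *\<^sub>R a)"
      unfolding c(1) using A zero by (intro sum.mono_neutral_right) auto
    then show "x \<in> convex_cone hull (A \<inter> \<tau>)"
      using A c(2) by (subst convex_cone_hull_finite) auto
  qed
qed

text \<open>Makes \<open>\<Sum>A\<close> a relative interior point without any topology: every
  \<open>x\<close> in the cone is, up to a positive factor, a summand of it. The factor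
  \<open>1 / (1 + sum c A)\<close> keeps all coefficients \<open>1 - \<epsilon> * c a\<close>
  nonnegative.\<close>

lemma sum_generators_interior:
  fixes A :: "'a::real_vector set"
  assumes A: "finite A" and x: "x \<in> convex_cone hull A"
  obtains \<epsilon> where "0 < \<epsilon>" "\<Sum>A - \<epsilon> *\<^sub>R x \<in> convex_cone hull A"
proof -
  obtain c where c: "x = (\<Sum>a\<in>A. c a *\<^sub>R a)" "\<forall>a\<in>A. 0 \<le> c a"
    using x unfolding convex_cone_hull_finite[OF A] by blast
  define \<epsilon> where "\<epsilon> = 1 / (1 + sum c A)"
  have s: "0 \<le> sum c A" using c by (simp add: sum_nonneg)
  then have "0 < \<epsilon>" by (simp add: \<epsilon>_def)
  have "0 \<le> 1 - \<epsilon> * c a" if "a \<in> A" for a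
  proof -
    have "c a \<le> sum c A" using A c that by (intro member_le_sum) auto
    then show ?thesis using s by (simp add: \<epsilon>_def)
  qed
  moreover have "\<Sum>A - \<epsilon> *\<^sub>R x = (\<Sum>a\<in>A. (1 - \<epsilon> * c a) *\<^sub>R a)"
    by (simp add: c(1) scaleR_left_diff_distrib sum_subtractf scaleR_right.sum)
  ultimately have "\<Sum>A - \<epsilon> *\<^sub>R x \<in> convex_cone hull A"
    unfolding convex_cone_hull_finite[OF A] by (intro CollectI exI[of _ "\<lambda>a. 1 - \<epsilon> * c a"]) simp
  with \<open>0 < \<epsilon>\<close> show thesis by (rule that)
qed

section \<open>Monotone families of subspaces\<close>

definition upper_level :: "('r \<Rightarrow> real) \<Rightarrow> real \<Rightarrow> 'r set" where
  "upper_level z t = {i. t \<le> z i}"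

text \<open>Such a list encodes a full flag of index sets, whose members are the sets
  \<open>set (take k ys)\<close>.\<close>

definition enumerates :: "'r list \<Rightarrow> bool" where
  "enumerates ys \<longleftrightarrow> distinct ys \<and> set ys = UNIV"

locale subspace_assignment = finite_dimensional_vector_space scl Basis
  for scl :: "'k::field \<Rightarrow> 'e::ab_group_add \<Rightarrow> 'e" and Basis :: "'e set" +
  fixes V :: "'r::finite set \<Rightarrow> 'e set"
  assumes subspace_V: "subspace (V I)"
    and dim_V: "dim (V I) = card I"
    and mono_V: "I \<subseteq> J \<Longrightarrow> V I \<subseteq> V J"
begin

text \<open>One inclusion suffices, since monotonicity of \<open>V\<close> gives the other.\<close>

definition meets :: "'r set \<Rightarrow> 'r set \<Rightarrow> bool" where
  "meets I J \<longleftrightarrow> V I \<inter> V J \<subseteq> V (I \<inter> J)"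

definition vsum :: "'e set \<Rightarrow> 'e set \<Rightarrow> 'e set" where
  "vsum A B = {x + y | x y. x \<in> A \<and> y \<in> B}"

lemma subspace_vsum: "subspace A \<Longrightarrow> subspace B \<Longrightarrow> subspace (vsum A B)"
  unfolding vsum_def by (rule subspace_sums)

lemma vsum_subset: "subspace C \<Longrightarrow> A \<subseteq> C \<Longrightarrow> B \<subseteq> C \<Longrightarrow> vsum A B \<subseteq> C"
  unfolding vsum_def using subspace_add by blast

lemma vsum_mono: "A \<subseteq> A' \<Longrightarrow> B \<subseteq> B' \<Longrightarrow> vsum A B \<subseteq> vsum A' B'"
  unfolding vsum_def by blast

lemma subset_vsum: "subspace A \<Longrightarrow> B \<subseteq> vsum A B"
  unfolding vsum_def using subspace_0 by force

lemma dim_vsum: "subspace A \<Longrightarrow> subspace B \<Longrightarrow> dim (vsum A B) + dim (A \<inter> B) = dim A + dim B"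
  unfolding vsum_def by (rule dim_sums_Int)

lemma meets_commute: "meets I J \<longleftrightarrow> meets J I"
  by (simp add: meets_def Int_commute)

lemma meets_subset: "I \<subseteq> J \<Longrightarrow> meets I J"
  by (auto simp: meets_def Int_absorb2)

lemma meets_eq: "meets I J \<Longrightarrow> V I \<inter> V J = V (I \<inter> J)"
  using mono_V[of "I \<inter> J" I] mono_V[of "I \<inter> J" J] by (auto simp: meets_def)

lemma vsum_V_subset: "vsum (V I) (V J) \<subseteq> V (I \<union> J)"
  by (intro vsum_subset subspace_V mono_V) auto

text \<open>The device that turns an upper bound on the dimension of an intersection into equality
  with the expected subspace.\<close>

lemma eq_V:
  assumes "subspace W" "V I \<subseteq> W" "dim W \<le> card I"
  shows "W = V I"
  using subspace_dim_equal[OF subspace_V assms(1,2)] assms(3) by (simp add: dim_V)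

text \<open>The dimensions of sum and intersection obey the same formula as the cardinalities of
  union and intersection, so one of the two subspaces has its expected dimension exactly when the
  other has.\<close>

lemma meets_iff_vsum: "meets I J \<longleftrightarrow> vsum (V I) (V J) = V (I \<union> J)"
proof -
  have d: "dim (vsum (V I) (V J)) + dim (V I \<inter> V J) = card I + card J"
    using dim_vsum[OF subspace_V subspace_V] by (simp add: dim_V)
  have c: "card (I \<union> J) + card (I \<inter> J) = card I + card J"
    using card_Un_Int[of I J] by simp
  show ?thesis
  proof
    assume "meets I J"
    then have "dim (vsum (V I) (V J)) = card (I \<union> J)"
      using d c by (simp add: meets_eq dim_V)
    then show "vsum (V I) (V J) = V (I \<union> J)"
      by (intro subspace_dim_equal subspace_vsum subspace_V vsum_V_subset) (simp add: dim_V)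
  next
    assume "vsum (V I) (V J) = V (I \<union> J)"
    then have "dim (V I \<inter> V J) \<le> card (I \<inter> J)"
      using d c by (simp add: dim_V)
    moreover have "V (I \<inter> J) \<subseteq> V I \<inter> V J"
      by (simp add: mono_V)
    ultimately show "meets I J"
      unfolding meets_def using eq_V[OF subspace_inter[OF subspace_V subspace_V]] by blast
  qed
qed

lemma meetsI_vsum:
  assumes "V (I \<union> J) \<subseteq> vsum (V I) (V J)"
  shows "meets I J"
  unfolding meets_iff_vsum using assms vsum_V_subset by blast

text \<open>The set \<open>I\<close> is the union of \<open>I \<inter> J\<close> and
  \<open>I \<inter> J'\<close>, which meet because \<open>J\<close> and \<open>J'\<close> do; so
  \<open>V I\<close> is the sum of their subspaces. If a vector of \<open>V I\<close> is also in
  \<open>V J\<close>, its component from \<open>I \<inter> J'\<close> lies in \<open>V J\<close> and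
  \<open>V J'\<close>, hence in \<open>V (J \<inter> J')\<close>, which is contained in
  \<open>V (I \<inter> J)\<close>.\<close>

lemma meets_between:
  assumes "meets J J'" "J \<inter> J' \<subseteq> I" "I \<subseteq> J \<union> J'"
  shows "meets I J"
proof -
  have IJ: "(I \<inter> J) \<union> (I \<inter> J') = I" and IJ': "(I \<inter> J) \<inter> (I \<inter> J') = J \<inter> J'"
    using assms(2,3) by auto
  have "V (I \<inter> J) \<inter> V (I \<inter> J') \<subseteq> V J \<inter> V J'"
    using mono_V[of "I \<inter> J" J] mono_V[of "I \<inter> J'" J'] by auto
  then have "meets (I \<inter> J) (I \<inter> J')"
    unfolding meets_def IJ' using assms(1) by (auto simp: meets_def)
  then have V: "vsum (V (I \<inter> J)) (V (I \<inter> J')) = V I"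
    by (simp add: meets_iff_vsum IJ)
  show ?thesis
    unfolding meets_def
  proof
    fix v assume v: "v \<in> V I \<inter> V J"
    then obtain x y where xy: "v = x + y" "x \<in> V (I \<inter> J)" "y \<in> V (I \<inter> J')"
      using V unfolding vsum_def by blast
    have "x \<in> V J" using xy(2) mono_V[of "I \<inter> J" J] by auto
    then have "v - x \<in> V J"
      using v subspace_diff[OF subspace_V] by auto
    then have "y \<in> V J" using xy(1) by simp
    moreover have "y \<in> V J'" using xy(3) mono_V[of "I \<inter> J'" J'] by auto
    ultimately have "y \<in> V (J \<inter> J')"
      using assms(1) by (auto simp: meets_def)
    then have "y \<in> V (I \<inter> J)"
      using mono_V[of "J \<inter> J'" "I \<inter> J"] assms(2) by auto
    then show "v \<in> V (I \<inter> J)"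
      using xy subspace_add[OF subspace_V] by auto
  qed
qed

section \<open>The lattice of index sets compatible with a flag\<close>

definition homlattice :: "'r set set \<Rightarrow> bool" where
  "homlattice \<L> \<longleftrightarrow> {} \<in> \<L> \<and> UNIV \<in> \<L> \<and>
     (\<forall>I\<in>\<L>. \<forall>J\<in>\<L>. I \<inter> J \<in> \<L> \<and> I \<union> J \<in> \<L> \<and> meets I J)"

definition compatible :: "'r list \<Rightarrow> 'r set set" where
  "compatible ys = {J. \<forall>k. meets (set (take k ys)) J}"

lemma set_take_Suc:
  "k < length ys \<Longrightarrow> set (take (Suc k) ys) = insert (ys ! k) (set (take k ys))"
  by (simp add: take_Suc_conv_app_nth)

lemma nth_notin_take:
  "enumerates ys \<Longrightarrow> k < length ys \<Longrightarrow> ys ! k \<notin> set (take k ys)"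
  by (auto simp: enumerates_def in_set_conv_nth nth_eq_iff_index_eq)

text \<open>Induction along the flag. A new index \<open>i\<close> raises the dimension of the
  triple intersection by at most one. If \<open>i\<close> is in both \<open>J\<close> and
  \<open>J'\<close>, the expected dimension also rises by one; if not, compatibility of the set
  missing \<open>i\<close> already forces the intersection into the previous member of the
  flag.\<close>

lemma compatible_Int_meets:
  assumes ys: "enumerates ys" and J: "J \<in> compatible ys" and J': "J' \<in> compatible ys"
  shows "V (set (take k ys)) \<inter> V J \<inter> V J' \<subseteq> V (set (take k ys) \<inter> J \<inter> J')"
proof (induction k)
  case 0
  then show ?case by auto
next
  case (Suc k)
  show ?case
  proof (cases "k < length ys")
    case False
    then have "set (take (Suc k) ys) = set (take k ys)" by simp
    then show ?thesis using Suc by (simp only:)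
  next
    case True
    define i A B where "i = ys ! k" and "A = set (take k ys)" and "B = set (take (Suc k) ys)"
    have B: "B = insert i A" and i: "i \<notin> A"
      using True set_take_Suc nth_notin_take[OF ys] by (auto simp: B_def A_def i_def)
    have AB: "V A \<subseteq> V B" using B by (intro mono_V) auto
    have m: "V B \<inter> V J \<subseteq> V (B \<inter> J)" "V B \<inter> V J' \<subseteq> V (B \<inter> J')"
      using J J' by (simp_all add: compatible_def meets_def B_def)
    have IH: "V A \<inter> V J \<inter> V J' \<subseteq> V (A \<inter> J \<inter> J')"
      using Suc by (simp add: A_def)
    define W where "W = V B \<inter> V J \<inter> V J'"
    have W: "subspace W" unfolding W_def by (intro subspace_inter subspace_V)
    have "W \<subseteq> V (B \<inter> J \<inter> J')"
    proof (cases "i \<in> J \<inter> J'")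
      case False
      then have "B \<inter> J \<subseteq> A \<or> B \<inter> J' \<subseteq> A" using B by auto
      then have "W \<subseteq> V A"
        using m mono_V[of "B \<inter> J" A] mono_V[of "B \<inter> J'" A] unfolding W_def by blast
      then have "W \<subseteq> V (A \<inter> J \<inter> J')" using IH unfolding W_def by blast
      then show ?thesis using mono_V[of "A \<inter> J \<inter> J'" "B \<inter> J \<inter> J'"] B by blast
    next
      case True
      have "vsum W (V A) \<subseteq> V B"
        using AB by (intro vsum_subset subspace_V) (auto simp: W_def)
      from dim_subset[OF this] have "dim (vsum W (V A)) \<le> card A + 1"
        using B i by (simp add: dim_V)
      moreover have "dim (vsum W (V A)) + dim (W \<inter> V A) = dim W + card A"
        using dim_vsum[OF W subspace_V] by (simp add: dim_V)
      moreover have "dim (W \<inter> V A) \<le> card (A \<inter> J \<inter> J')"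
      proof -
        have "W \<inter> V A \<subseteq> V (A \<inter> J \<inter> J')" using IH by (auto simp: W_def)
        from dim_subset[OF this] show ?thesis by (simp add: dim_V)
      qed
      moreover have "B \<inter> J \<inter> J' = insert i (A \<inter> J \<inter> J')" using True B by auto
      then have "card (B \<inter> J \<inter> J') = card (A \<inter> J \<inter> J') + 1" using i by simp
      ultimately have "dim W \<le> card (B \<inter> J \<inter> J')" by linarith
      moreover have "V (B \<inter> J \<inter> J') \<subseteq> W"
        unfolding W_def by (simp add: mono_V le_infI1)
      ultimately show ?thesis using eq_V[OF W] by blast
    qed
    then show ?thesis by (simp add: W_def B_def)
  qed
qed

lemma compatible_meets:
  assumes "enumerates ys" "J \<in> compatible ys" "J' \<in> compatible ys"
  shows "meets J J'"
proof -
  have "set (take (length ys) ys) = UNIV" using assms(1) by (simp add: enumerates_def)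
  then show ?thesis
    using compatible_Int_meets[OF assms, of "length ys"] mono_V[of J UNIV]
    unfolding meets_def by auto
qed

lemma compatible_Int:
  assumes "enumerates ys" "J \<in> compatible ys" "J' \<in> compatible ys"
  shows "J \<inter> J' \<in> compatible ys"
  unfolding compatible_def meets_def
proof (intro CollectI allI)
  fix k
  have "V (J \<inter> J') \<subseteq> V J \<inter> V J'" by (simp add: mono_V)
  then show "V (set (take k ys)) \<inter> V (J \<inter> J') \<subseteq> V (set (take k ys) \<inter> (J \<inter> J'))"
    using compatible_Int_meets[OF assms, of k] by (auto simp: Int_assoc)
qed

text \<open>Descending induction from the whole index set. If the removed index \<open>i\<close> is
  outside the union \<open>K\<close>, the intersection with \<open>K\<close> does not change. If it
  is in \<open>K\<close>, it belongs to \<open>J\<close> or \<open>J'\<close>, and the sum of that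
  subspace with \<open>V A\<close> contains \<open>V B\<close>; so the sum with \<open>V K\<close>
  stays as large as possible, which suffices by duality.\<close>

lemma compatible_Un:
  assumes ys: "enumerates ys" and J: "J \<in> compatible ys" and J': "J' \<in> compatible ys"
  shows "J \<union> J' \<in> compatible ys"
proof -
  define K where "K = J \<union> J'"
  have "meets (set (take k ys)) K" for k
  proof (cases "k \<le> length ys")
    case False
    then have "set (take k ys) = UNIV" using ys by (simp add: enumerates_def)
    then show ?thesis using meets_subset[of K UNIV] by (simp add: meets_commute)
  next
    case True
    then show ?thesis
    proof (induction rule: inc_induct)
      case base
      have "set (take (length ys) ys) = UNIV" using ys by (simp add: enumerates_def)
      then show ?case using meets_subset[of K UNIV] by (simp add: meets_commute)
    next
      case (step k)
      define i A B where "i = ys ! k" and "A = set (take k ys)" and "B = set (take (Suc k) ys)"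
      have B: "B = insert i A" and i: "i \<notin> A"
        using step set_take_Suc nth_notin_take[OF ys] by (auto simp: B_def A_def i_def)
      have BK: "meets B K" using step by (simp add: B_def)
      have "meets A K"
      proof (cases "i \<in> K")
        case False
        have "V A \<inter> V K \<subseteq> V B \<inter> V K" using B mono_V[of A B] by auto
        also have "\<dots> \<subseteq> V (B \<inter> K)" using BK by (simp add: meets_def)
        also have "B \<inter> K = A \<inter> K" using False B by auto
        finally show ?thesis by (simp add: meets_def)
      next
        case True
        then obtain I where I: "I \<in> {J, J'}" "i \<in> I" by (auto simp: K_def)
        have IK: "V I \<subseteq> V K" using I by (intro mono_V) (auto simp: K_def)
        have AI: "vsum (V A) (V I) = V (A \<union> I)"
          using I J J' unfolding meets_iff_vsum[symmetric] by (auto simp: compatible_def A_def)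
        have "V (A \<union> K) = V (B \<union> K)" using True B by (simp add: insert_absorb)
        also have "\<dots> = vsum (V B) (V K)" using BK by (simp add: meets_iff_vsum)
        also have "\<dots> \<subseteq> vsum (V (A \<union> I)) (V K)"
          using mono_V[of B "A \<union> I"] B I unfolding vsum_def by blast
        also have "\<dots> \<subseteq> vsum (V A) (V K)"
          unfolding AI[symmetric]
          by (intro vsum_subset subspace_vsum subspace_V vsum_mono order_refl IK subset_vsum)
        finally show ?thesis by (rule meetsI_vsum)
      qed
      then show ?case by (simp add: A_def)
    qed
  qed
  then show ?thesis by (simp add: compatible_def K_def)
qed

text \<open>By \<open>meets_iff_vsum\<close> this means that on compatible sets \<open>V\<close>
  sends unions to sums as well as intersections to intersections.\<close>

lemma homlattice_compatible:
  assumes "enumerates ys" shows "homlattice (compatible ys)"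
  unfolding homlattice_def
proof (intro conjI ballI)
  show "{} \<in> compatible ys"
    unfolding compatible_def using meets_subset[of "{}"] meets_commute by blast
  show "UNIV \<in> compatible ys"
    unfolding compatible_def using meets_subset[of _ UNIV] by blast
qed (rule compatible_Int[OF assms] compatible_Un[OF assms] compatible_meets[OF assms]; assumption)+

lemma take_in_compatible: "set (take k ys) \<in> compatible ys"
proof -
  have "set (take l ys) \<subseteq> set (take k ys) \<or> set (take k ys) \<subseteq> set (take l ys)" for l
    by (meson nat_le_linear set_take_subset_set_take)
  moreover have "meets A B" if "A \<subseteq> B \<or> B \<subseteq> A" for A B
    using that meets_subset[of A B] meets_subset[of B A] meets_commute[of A B] by blast
  ultimately show ?thesis
    by (simp add: compatible_def)
qed

lemma homlattice_Inter:
  assumes "homlattice \<L>" "\<A> \<subseteq> \<L>"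
  shows "\<Inter>\<A> \<in> \<L>"
proof -
  have "finite \<A>" by (rule finite)
  then show ?thesis using assms(2)
  proof induction
    case empty
    then show ?case using assms(1) by (simp add: homlattice_def)
  next
    case (insert A \<A>)
    then show ?case using assms(1) unfolding homlattice_def by simp
  qed
qed

lemma homlattice_Union:
  assumes "homlattice \<L>" "\<A> \<subseteq> \<L>"
  shows "\<Union>\<A> \<in> \<L>"
proof -
  have "finite \<A>" by (rule finite)
  then show ?thesis using assms(2)
  proof induction
    case empty
    then show ?case using assms(1) by (simp add: homlattice_def)
  next
    case (insert A \<A>)
    then show ?case using assms(1) unfolding homlattice_def by simp
  qed
qed

text \<open>Each \<open>b i\<close> is chosen in \<open>V (up i)\<close>, where \<open>up i\<close>
  is the least compatible set containing \<open>i\<close>, and new at the stage of the flag where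
  \<open>i\<close> enters. Newness makes the family triangular, hence independent; minimality of
  \<open>up i\<close> puts \<open>b i\<close> into \<open>V J\<close> for every compatible
  \<open>J\<close> containing \<open>i\<close>; a dimension count does the rest.\<close>

lemma compatible_basis:
  assumes ys: "enumerates ys"
  obtains b where "inj b" "independent (range b)" "\<And>J. J \<in> compatible ys \<Longrightarrow> V J = span (b ` J)"
proof -
  note hl = homlattice_compatible[OF ys]
  define up where "up i = \<Inter>{J \<in> compatible ys. i \<in> J}" for i
  have up: "up i \<in> compatible ys" "i \<in> up i" for i
    unfolding up_def by (auto intro: homlattice_Inter[OF hl])
  have up_subset: "up i \<subseteq> J" if "J \<in> compatible ys" "i \<in> J" for i J
    unfolding up_def using that by blast
  have "\<exists>e. e \<in> V (up i) \<and> (\<forall>k<length ys. ys ! k = i \<longrightarrow>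
      e \<in> V (set (take (Suc k) ys)) \<and> e \<notin> V (set (take k ys)))" for i
  proof -
    obtain k where k: "k < length ys" "ys ! k = i"
      using ys by (metis UNIV_I enumerates_def in_set_conv_nth)
    define A B where "A = set (take k ys)" and "B = set (take (Suc k) ys)"
    have B: "B = insert i A" and i: "i \<notin> A"
      using k set_take_Suc nth_notin_take[OF ys] by (auto simp: B_def A_def)
    have m: "meets A (up i)" "meets B (up i)"
      using up(1)[of i] by (simp_all add: compatible_def A_def B_def)
    \<comment> \<open>Without a new vector the subspace of \<open>B \<inter> up i\<close> would be
      contained in that of \<open>A \<inter> up i\<close>, although the first set has one element
      more.\<close>
    have "\<not> V B \<inter> V (up i) \<subseteq> V A"
    proof
      assume "V B \<inter> V (up i) \<subseteq> V A"
      then have "V (B \<inter> up i) \<subseteq> V (A \<inter> up i)"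
        using meets_eq[OF m(1)] meets_eq[OF m(2)] by blast
      from dim_subset[OF this] have "card (B \<inter> up i) \<le> card (A \<inter> up i)"
        by (simp add: dim_V)
      moreover have "B \<inter> up i = insert i (A \<inter> up i)" using B up by auto
      ultimately show False using i by simp
    qed
    then obtain e where e: "e \<in> V B" "e \<in> V (up i)" "e \<notin> V A" by blast
    have "k' = k" if "k' < length ys" "ys ! k' = i" for k'
      using that k ys by (auto simp: enumerates_def nth_eq_iff_index_eq)
    then show ?thesis using e unfolding A_def B_def by blast
  qed
  then obtain b where b: "b i \<in> V (up i)"
      "\<And>k. k < length ys \<Longrightarrow> ys ! k = i \<Longrightarrow>
        b i \<in> V (set (take (Suc k) ys)) \<and> b i \<notin> V (set (take k ys))" for i
    by metis
  have "independent (b ` set (take k ys)) \<and> inj_on b (set (take k ys)) \<and>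
      b ` set (take k ys) \<subseteq> V (set (take k ys))" if "k \<le> length ys" for k
    using that
  proof (induction k)
    case 0
    then show ?case by (simp add: independent_empty)
  next
    case (Suc k)
    define i A where "i = ys ! k" and "A = set (take k ys)"
    have B: "set (take (Suc k) ys) = insert i A"
      using Suc.prems set_take_Suc[of k ys] by (simp add: i_def A_def)
    have bi: "b i \<in> V (insert i A)" "b i \<notin> V A"
      using b(2)[of k i] Suc.prems B by (auto simp: i_def A_def)
    have IH: "independent (b ` A)" "inj_on b A" "b ` A \<subseteq> V A"
      using Suc by (auto simp: A_def)
    have "b i \<notin> span (b ` A)"
      using bi(2) span_minimal[OF IH(3) subspace_V] by blast
    then show ?case
      using IH bi mono_V[of A "insert i A"] span_superset[of "b ` A"] unfolding B
      by (auto simp: independent_insert)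
  qed
  from this[of "length ys"] have ind: "independent (range b)" and inj: "inj b"
    using ys by (auto simp: enumerates_def)
  have "V J = span (b ` J)" if J: "J \<in> compatible ys" for J
  proof -
    have "b ` J \<subseteq> V J"
      using b(1) up_subset[OF J] mono_V[of "up _" J] by blast
    then have "span (b ` J) \<subseteq> V J" by (rule span_minimal[OF _ subspace_V])
    moreover have "dim (span (b ` J)) = card J"
      using independent_mono[OF ind, of "b ` J"] inj
      by (simp add: dim_eq_card_independent card_image inj_on_subset[OF _ subset_UNIV] image_mono)
    ultimately show ?thesis
      using subspace_dim_equal[OF subspace_span subspace_V, of "b ` J" J] by (simp add: dim_V)
  qed
  with ind inj show thesis by (intro that)
qed

text \<open>A lattice of sets that contains the empty and the whole set consists of the up-sets of a
  preorder on the indices. For such \<open>\<L>\<close> this is the cone of functions monotone for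
  the preorder, cut out by inequalities between two coordinates. The form by level sets avoids
  introducing the preorder.\<close>

definition level_cone :: "'r set set \<Rightarrow> ('r \<Rightarrow> real) set" where
  "level_cone \<L> = {z. \<forall>t. upper_level z t \<in> \<L>}"

lemma level_coneD: "z \<in> level_cone \<L> \<Longrightarrow> upper_level z t \<in> \<L>"
  by (simp add: level_cone_def)

text \<open>With finitely many indices a strict level set is empty or is the weak level set at the
  least value above \<open>t\<close>.\<close>

lemma level_cone_strict:
  assumes "homlattice \<L>" "z \<in> level_cone \<L>"
  shows "{i. t < z i} \<in> \<L>"
proof (cases "{i. t < z i} = {}")
  case True
  then show ?thesis using assms(1) unfolding homlattice_def by (simp only:)
next
  case False
  define s where "s = Min (z ` {i. t < z i})"
  have "s \<in> z ` {i. t < z i}"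
    unfolding s_def by (rule Min_in) (use False in auto)
  then have "t < s" by auto
  moreover have "s \<le> z i" if "t < z i" for i
    unfolding s_def by (rule Min_le) (use that in auto)
  ultimately have "{i. t < z i} = upper_level z s"
    unfolding upper_level_def by fastforce
  then show ?thesis using level_coneD[OF assms(2)] by simp
qed

text \<open>A level set of the sum is the union, over its elements \<open>j\<close>, of the
  intersections of the level sets of \<open>a\<close> at \<open>a j\<close> and of \<open>b\<close>
  at \<open>b j\<close>. Both lattice operations are used.\<close>

lemma level_cone_add:
  assumes "homlattice \<L>" "a \<in> level_cone \<L>" "b \<in> level_cone \<L>"
  shows "(\<lambda>i. a i + b i) \<in> level_cone \<L>"
  unfolding level_cone_def
proof (intro CollectI allI)
  fix t
  have "upper_level (\<lambda>i. a i + b i) t =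
      \<Union>((\<lambda>j. upper_level a (a j) \<inter> upper_level b (b j)) ` {j. t \<le> a j + b j})"
    unfolding upper_level_def by fastforce
  moreover have "\<dots> \<in> \<L>"
    using assms by (intro homlattice_Union) (auto simp: homlattice_def level_cone_def)
  ultimately show "upper_level (\<lambda>i. a i + b i) t \<in> \<L>" by simp
qed

lemma level_cone_scale:
  assumes "homlattice \<L>" "a \<in> level_cone \<L>" "0 \<le> c"
  shows "(\<lambda>i. c * a i) \<in> level_cone \<L>"
  unfolding level_cone_def
proof (intro CollectI allI)
  fix t
  show "upper_level (\<lambda>i. c * a i) t \<in> \<L>"
  proof (cases "c = 0")
    case True
    then have "upper_level (\<lambda>i. c * a i) t = UNIV \<or> upper_level (\<lambda>i. c * a i) t = {}"
      by (auto simp: upper_level_def)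
    then show ?thesis using assms(1) by (auto simp: homlattice_def)
  next
    case False
    then have "upper_level (\<lambda>i. c * a i) t = upper_level a (t / c)"
      using assms(3) by (auto simp: upper_level_def field_simps)
    then show ?thesis using level_coneD[OF assms(2)] by simp
  qed
qed

lemma level_cone_shift:
  assumes "a \<in> level_cone \<L>"
  shows "(\<lambda>i. a i + c) \<in> level_cone \<L>"
proof -
  have "upper_level (\<lambda>i. a i + c) t = upper_level a (t - c)" for t
    by (auto simp: upper_level_def)
  then show ?thesis using assms by (simp add: level_cone_def)
qed

lemma level_cone_const:
  assumes "homlattice \<L>"
  shows "(\<lambda>i. c) \<in> level_cone \<L>"
  unfolding level_cone_def
proof (intro CollectI allI)
  fix t
  have "upper_level (\<lambda>i :: 'r. c) t = UNIV \<or> upper_level (\<lambda>i :: 'r. c) t = {}"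
    by (auto simp: upper_level_def)
  then show "upper_level (\<lambda>i :: 'r. c) t \<in> \<L>"
    using assms by (elim disjE) (simp_all add: homlattice_def)
qed

lemma level_cone_indicator:
  assumes "homlattice \<L>" "J \<in> \<L>"
  shows "(\<lambda>i. if i \<in> J then 1 else 0) \<in> level_cone \<L>"
  unfolding level_cone_def
proof (intro CollectI allI)
  fix t
  define L where "L = upper_level (\<lambda>i. if i \<in> J then 1 else 0) t"
  have "L = UNIV \<or> L = J \<or> L = {}"
    by (auto simp: upper_level_def L_def split: if_splits)
  then show "L \<in> \<L>"
    using assms by (elim disjE) (simp_all add: homlattice_def)
qed

text \<open>Fix a level set \<open>J\<close> of \<open>a\<close> and a compatible \<open>I\<close>.
  The level sets of \<open>z = a + b\<close> lie in both lattices, and the intersection of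
  \<open>V I\<close> and \<open>V J\<close> is computed inside \<open>V K\<close> for growing level
  sets \<open>K\<close> of \<open>z\<close>. Where \<open>z\<close> is constant, large
  \<open>a\<close> means small \<open>b\<close>; so level sets of \<open>a\<close> and of
  \<open>b\<close> split the step from \<open>K'\<close> to \<open>K\<close> into complementary
  parts, and \<open>meets_between\<close> controls the dimension gained.\<close>

lemma summand_in_level_cone:
  assumes hl: "homlattice \<L>" and a: "a \<in> level_cone \<L>" and b: "b \<in> level_cone \<L>"
    and ys: "enumerates ys" and ab: "(\<lambda>i. a i + b i) \<in> level_cone (compatible ys)"
  shows "a \<in> level_cone (compatible ys)"
proof -
  define z where "z = (\<lambda>i. a i + b i)"
  note hl' = homlattice_compatible[OF ys]
  have z: "z \<in> level_cone \<L>" using level_cone_add[OF hl a b] by (simp add: z_def)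
  have z': "z \<in> level_cone (compatible ys)" using ab by (simp add: z_def)
  have meets: "meets I J" if J: "J = upper_level a s" and I: "I \<in> compatible ys" for I J s
  proof -
    have J_L: "J \<in> \<L>" using level_coneD[OF a] J by simp
    \<comment> \<open>Strong induction on size, passing from a level set to the next smaller one or
      to the empty set. The case needed is \<open>K = UNIV\<close>, the level set at the minimum of
      \<open>z\<close>.\<close>
    have "V I \<inter> V J \<inter> V K \<subseteq> V (I \<inter> J \<inter> K)" if "K = {} \<or> (\<exists>t. K = upper_level z t)" for K
      using that
    proof (induction "card K" arbitrary: K rule: less_induct)
      case less
      show ?case
      proof (cases "K = {}")
        case True
        then show ?thesis by simp
      next
        case False
        then obtain t where t: "K = upper_level z t" using less.prems by blast
        define m where "m = Min (z ` K)"
        have "m \<in> z ` K" unfolding m_def using False by (intro Min_in) auto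
        then obtain j where j: "j \<in> K" "z j = m" by blast
        have "t \<le> m" using j t by (auto simp: upper_level_def)
        have m_le: "m \<le> z i" if "i \<in> K" for i
          unfolding m_def using that by (intro Min_le) auto
        have K: "K = upper_level z m"
          using m_le \<open>t \<le> m\<close> by (auto simp: t upper_level_def)
        define K' where "K' = {i. m < z i}"
        have K'K: "K' \<subseteq> K" "j \<notin> K'"
          using j by (auto simp: K K'_def upper_level_def)
        have "K' = {} \<or> (\<exists>t. K' = upper_level z t)"
        proof (cases "K' = {}")
          case ne: False
          have "Min (z ` K') \<in> z ` K'" using ne by (intro Min_in) auto
          then have "m < Min (z ` K')" by (auto simp: K'_def)
          moreover have "Min (z ` K') \<le> z i" if "i \<in> K'" for i
            using that by (intro Min_le) auto
          ultimately have "K' = upper_level z (Min (z ` K'))"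
            by (fastforce simp: K'_def upper_level_def)
          then show ?thesis by blast
        qed simp
        moreover have "card K' < card K"
          using K'K j by (intro psubset_card_mono) auto
        ultimately have IH: "V I \<inter> V J \<inter> V K' \<subseteq> V (I \<inter> J \<inter> K')"
          by (rule less.hyps[rotated])
        have KL: "K \<in> \<L>" "K \<in> compatible ys" "K' \<in> \<L>" "K' \<in> compatible ys"
          using level_coneD[OF z] level_coneD[OF z'] level_cone_strict[OF hl z]
            level_cone_strict[OF hl' z'] by (auto simp: K K'_def)
        define J' where "J' = {i. m - s < b i}"
        have J'_L: "J' \<in> \<L>" unfolding J'_def by (rule level_cone_strict[OF hl b])
        \<comment> \<open>On the part of \<open>K\<close> where \<open>z\<close> is constant, the sets \<open>J\<close> and \<open>J'\<close> are complementary.\<close>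
        have "K \<inter> J \<inter> J' \<subseteq> K'" "K \<subseteq> K' \<union> J \<union> J'"
          by (auto simp: K K'_def J J'_def upper_level_def z_def)
        \<comment> \<open>The sets are moved into the interval from \<open>K'\<close> to
          \<open>K\<close>. There \<open>J1\<close> and \<open>J1'\<close> have intersection
          \<open>K'\<close> and union \<open>K\<close>, so \<open>meets_between\<close> applies to
          \<open>I1\<close> although \<open>I\<close> is unrelated to \<open>\<L>\<close>.\<close>
        define J1 J1' I1 where "J1 = K' \<union> (J \<inter> K)" and "J1' = K' \<union> (J' \<inter> K)"
          and "I1 = K' \<union> (I \<inter> K)"
        have eqs: "J1 \<inter> J1' = K'" "J1 \<union> J1' = K" "K' \<subseteq> I1" "I1 \<subseteq> K"
          using K'K(1) \<open>K \<inter> J \<inter> J' \<subseteq> K'\<close> \<open>K \<subseteq> K' \<union> J \<union> J'\<close>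
          by (auto simp: J1_def J1'_def I1_def)
        have "J1 \<in> \<L>" "J1' \<in> \<L>"
          using hl J_L J'_L KL by (auto simp: homlattice_def J1_def J1'_def)
        then have "meets J1 J1'" using hl by (auto simp: homlattice_def)
        then have m1: "meets I1 J1" using eqs by (intro meets_between[of J1 J1']) auto
        have m2: "meets I K" "meets J K"
          using I KL hl hl' J_L by (auto simp: homlattice_def)
        define W where "W = V I \<inter> V J \<inter> V K"
        have W: "subspace W" unfolding W_def by (intro subspace_inter subspace_V)
        have "W \<subseteq> V (I \<inter> K)" "W \<subseteq> V (J \<inter> K)"
          using m2 by (auto simp: W_def meets_def)
        then have "W \<subseteq> V I1" "W \<subseteq> V J1"
          using mono_V[of "I \<inter> K" I1] mono_V[of "J \<inter> K" J1] by (auto simp: I1_def J1_def)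
        then have "W \<subseteq> V (I1 \<inter> J1)" using m1 by (auto simp: meets_def)
        moreover have "V K' \<subseteq> V (I1 \<inter> J1)" by (intro mono_V) (auto simp: I1_def J1_def)
        ultimately have "vsum W (V K') \<subseteq> V (I1 \<inter> J1)"
          by (intro vsum_subset subspace_V)
        from dim_subset[OF this] have d1: "dim (vsum W (V K')) \<le> card (I1 \<inter> J1)"
          by (simp add: dim_V)
        have "W \<inter> V K' \<subseteq> V (I \<inter> J \<inter> K')" using IH by (auto simp: W_def)
        from dim_subset[OF this] have d2: "dim (W \<inter> V K') \<le> card (I \<inter> J \<inter> K')"
          by (simp add: dim_V)
        have d3: "dim (vsum W (V K')) + dim (W \<inter> V K') = dim W + card K'"
          using dim_vsum[OF W subspace_V] by (simp add: dim_V)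
        \<comment> \<open>Together with the dimension formula \<open>d3\<close> for
          \<open>vsum W (V K')\<close>, this turns the bounds \<open>d1\<close> and
          \<open>d2\<close> into the expected bound on \<open>dim W\<close>.\<close>
        have "card (I1 \<inter> J1) + card (I \<inter> J \<inter> K') = card K' + card (I \<inter> J \<inter> K)"
        proof -
          have "I1 \<inter> J1 = K' \<union> (I \<inter> J \<inter> K)" "I \<inter> J \<inter> K' = K' \<inter> (I \<inter> J \<inter> K)"
            using K'K(1) by (auto simp: I1_def J1_def)
          then show ?thesis using card_Un_Int[of K' "I \<inter> J \<inter> K"] by simp
        qed
        then have "dim W \<le> card (I \<inter> J \<inter> K)" using d1 d2 d3 by linarith
        moreover have "V (I \<inter> J \<inter> K) \<subseteq> W"
          unfolding W_def by (simp add: mono_V le_infI1)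
        ultimately have "W = V (I \<inter> J \<inter> K)" by (intro eq_V[OF W])
        then show ?thesis by (simp add: W_def)
      qed
    qed
    moreover have "UNIV = upper_level z (Min (range z))"
      by (auto simp: upper_level_def)
    ultimately have "V I \<inter> V J \<inter> V UNIV \<subseteq> V (I \<inter> J \<inter> UNIV)" by blast
    then show "meets I J" using mono_V[of I UNIV] by (auto simp: meets_def)
  qed
  show ?thesis
    unfolding level_cone_def compatible_def
    by (intro CollectI allI meets[OF refl take_in_compatible])
qed

end

section \<open>Flags that refine the level sets of a function\<close>

lemma sorted_enumeration:
  fixes z :: "'r::finite \<Rightarrow> real"
  obtains ys where "enumerates ys" "sorted_wrt (\<lambda>i j. z j \<le> z i) ys"
proof -
  obtain xs :: "'r list" where xs: "set xs = UNIV" "distinct xs"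
    using finite_distinct_list[OF finite, of "UNIV :: 'r set"] by blast
  define ys where "ys = sort_key (\<lambda>i. - z i) xs"
  have "sorted (map (\<lambda>i. - z i) ys)" unfolding ys_def by (rule sorted_sort_key)
  then have "sorted_wrt (\<lambda>i j. z j \<le> z i) ys" by (simp add: sorted_wrt_map)
  moreover have "enumerates ys" using xs by (simp add: enumerates_def ys_def)
  ultimately show thesis by (rule that[rotated])
qed

lemma upper_level_eq_take:
  assumes "enumerates ys" "sorted_wrt (\<lambda>i j. z j \<le> z i) ys"
  obtains k where "upper_level z t = set (take k ys)"
proof -
  have "set (filter (\<lambda>i. t \<le> z i) ys) = set (take (length (filter (\<lambda>i. t \<le> z i) ys)) ys)"
    using assms(2)
  proof (induction ys)
    case (Cons y ys)
    show ?case
    proof (cases "t \<le> z y")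
      case True
      then show ?thesis using Cons by simp
    next
      case False
      then have "\<forall>i\<in>set ys. \<not> t \<le> z i" using Cons.prems by fastforce
      then show ?thesis using False by (simp add: filter_False)
    qed
  qed simp
  moreover have "upper_level z t = set (filter (\<lambda>i. t \<le> z i) ys)"
    using assms(1) by (auto simp: upper_level_def enumerates_def)
  ultimately show thesis using that by blast
qed

text \<open>The level sets of \<open>z\<close> are members of the flag, and these are compatible
  with it, however ties were broken. Hence every function lies in the cone of some flag, which is
  the source of completeness.\<close>

lemma (in subspace_assignment) sorted_in_level_cone:
  assumes "enumerates ys" "sorted_wrt (\<lambda>i j. z j \<le> z i) ys"
  shows "z \<in> level_cone (compatible ys)"
  unfolding level_cone_def
proof (intro CollectI allI)
  fix t
  obtain k where "upper_level z t = set (take k ys)"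
    by (rule upper_level_eq_take[OF assms])
  then show "upper_level z t \<in> compatible ys" using take_in_compatible by simp
qed

section \<open>Extension of characters\<close>

text \<open>Here \<open>H\<close> is a submonoid; closure under negation is stated separately where
  it matters. The class \<open>ring_1\<close> serves to write integer multiples as
  \<open>of_int n * x\<close>; the instance needed is the pointwise ring of functions containing the
  dual lattice.\<close>

definition character_on :: "'a::ring_1 set \<Rightarrow> ('a \<Rightarrow> 'f::field) \<Rightarrow> bool" where
  "character_on H \<psi> \<longleftrightarrow> 0 \<in> H \<and> (\<forall>x\<in>H. \<psi> x \<noteq> 0) \<and>
     (\<forall>x\<in>H. \<forall>y\<in>H. x + y \<in> H \<and> \<psi> (x + y) = \<psi> x * \<psi> y)"

lemma character_on_zero: "character_on H \<psi> \<Longrightarrow> \<psi> 0 = 1"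
  unfolding character_on_def by (metis add_0 mult_cancel_right2)

lemma character_on_minus:
  assumes "character_on H \<psi>" "x \<in> H" "- x \<in> H"
  shows "\<psi> (- x) = inverse (\<psi> x)"
proof -
  have "\<psi> x * \<psi> (- x) = \<psi> (x + - x)"
    using assms unfolding character_on_def by metis
  then have "\<psi> x * \<psi> (- x) = 1" using character_on_zero[OF assms(1)] by simp
  then show ?thesis by (metis inverse_unique)
qed

lemma character_on_nat_mult:
  assumes "character_on H \<psi>" "x \<in> H"
  shows "of_nat n * x \<in> H \<and> \<psi> (of_nat n * x) = \<psi> x ^ n"
proof (induction n)
  case 0
  then show ?case using assms(1) character_on_zero[OF assms(1)] by (simp add: character_on_def)
next
  case (Suc n)
  have "of_nat (Suc n) * x = x + of_nat n * x" by (simp add: algebra_simps)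
  then show ?case using Suc assms by (simp add: character_on_def)
qed

lemma character_on_int_mult:
  assumes \<psi>: "character_on H \<psi>" and neg: "\<And>x. x \<in> H \<Longrightarrow> - x \<in> H" and x: "x \<in> H"
  shows "of_int n * x \<in> H \<and> \<psi> (of_int n * x) = \<psi> x powi n"
proof (cases "0 \<le> n")
  case True
  then obtain k where "n = int k" by (metis zero_le_imp_eq_int)
  then show ?thesis using character_on_nat_mult[OF \<psi> x, of k] by simp
next
  case False
  then have "n \<le> 0" by simp
  then obtain k where k: "n = - int k" by (rule nonpos_int_cases)
  have kx: "of_nat k * x \<in> H" "\<psi> (of_nat k * x) = \<psi> x ^ k"
    using character_on_nat_mult[OF \<psi> x, of k] by auto
  have "of_int n * x = - (of_nat k * x)" by (simp add: k)
  then show ?thesis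
    using kx neg[OF kx(1)] character_on_minus[OF \<psi> kx(1) neg[OF kx(1)]]
    by (simp add: k power_int_minus)
qed

text \<open>Adjoins one element \<open>g\<close>. Its value \<open>c\<close> has to satisfy
  \<open>c powi n = \<psi> (of_int n * g)\<close> for every multiple of \<open>g\<close> in
  \<open>H\<close>; then sending \<open>h + of_int n * g\<close> to
  \<open>\<psi> h * c powi n\<close> is well defined.\<close>

lemma character_extension_step:
  fixes \<psi> :: "'a::ring_1 \<Rightarrow> 'f::alg_closed_field"
  assumes \<psi>: "character_on H \<psi>" and neg: "\<And>x. x \<in> H \<Longrightarrow> - x \<in> H"
  obtains H' \<psi>' where "character_on H' \<psi>'" "\<And>x. x \<in> H' \<Longrightarrow> - x \<in> H'" "H \<subseteq> H'" "g \<in> H'"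
    "\<And>x. x \<in> H \<Longrightarrow> \<psi>' x = \<psi> x"
proof -
  have H: "0 \<in> H" "\<And>x y. x \<in> H \<Longrightarrow> y \<in> H \<Longrightarrow> x + y \<in> H"
    "\<And>x. x \<in> H \<Longrightarrow> \<psi> x \<noteq> 0"
    "\<And>x y. x \<in> H \<Longrightarrow> y \<in> H \<Longrightarrow> \<psi> (x + y) = \<psi> x * \<psi> y"
    using \<psi> by (auto simp: character_on_def)
  have diff: "x - y \<in> H" if "x \<in> H" "y \<in> H" for x y
    using H(2)[OF that(1) neg[OF that(2)]] by simp
  obtain c where c: "c \<noteq> 0" "\<And>n. of_int n * g \<in> H \<Longrightarrow> \<psi> (of_int n * g) = c powi n"
  proof (cases "\<exists>n::nat>0. of_nat n * g \<in> H")
    case False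
    have "n = 0" if "of_int n * g \<in> H" for n
    proof (rule ccontr)
      assume "n \<noteq> 0"
      have "of_nat (nat \<bar>n\<bar>) * g = of_int n * g \<or> of_nat (nat \<bar>n\<bar>) * g = - (of_int n * g)"
        by (cases "0 \<le> n") (auto simp: of_nat_nat)
      then have "of_nat (nat \<bar>n\<bar>) * g \<in> H" using that neg by auto
      moreover have "0 < nat \<bar>n\<bar>" using \<open>n \<noteq> 0\<close> by simp
      ultimately show False using False by blast
    qed
    \<comment> \<open>No nonzero integer multiplier takes \<open>g\<close> into \<open>H\<close>, so
      every nonzero value is admissible.\<close>
    then show thesis using character_on_zero[OF \<psi>] by (intro that[of 1]) fastforce+
  next
    case True
    \<comment> \<open>The multipliers that take \<open>g\<close> into \<open>H\<close> are the
      multiples of the least positive one, so a \<open>d\<close>-th root of the value there meets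
      all conditions at once.\<close>
    define d :: nat where "d = (LEAST n. 0 < n \<and> of_nat n * g \<in> H)"
    have d: "0 < d" "of_nat d * g \<in> H"
      unfolding d_def using LeastI_ex[OF True] by auto
    have d_le: "d \<le> n" if "0 < n" "of_nat n * g \<in> H" for n
      unfolding d_def using that by (intro Least_le) auto
    obtain c where c: "c ^ d = \<psi> (of_nat d * g)" using nth_root_exists[OF d(1)] by blast
    have c0: "c \<noteq> 0" using c H(3)[OF d(2)] d(1) by (metis power_0_left less_irrefl)
    show thesis
    proof (rule that[OF c0])
      fix n assume n: "of_int n * g \<in> H"
      define q r where "q = n div int d" and "r = nat (n mod int d)"
      have n_eq: "n = q * int d + int r" and r: "r < d"
        using d(1) by (auto simp: q_def r_def nat_less_iff)
      have qd: "of_int q * (of_nat d * g) \<in> H"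
        "\<psi> (of_int q * (of_nat d * g)) = \<psi> (of_nat d * g) powi q"
        using character_on_int_mult[OF \<psi> neg d(2)] by blast+
      have "of_nat r * g = of_int n * g - of_int q * (of_nat d * g)"
        by (simp add: n_eq algebra_simps)
      then have "of_nat r * g \<in> H" using diff[OF n qd(1)] by simp
      then have "r = 0" using d_le[of r] r by auto
      then have "of_int n * g = of_int q * (of_nat d * g)" by (simp add: n_eq mult.assoc)
      then have "\<psi> (of_int n * g) = (c ^ d) powi q" using qd c by simp
      also have "\<dots> = (c powi int d) powi q" by simp
      also have "\<dots> = c powi (int d * q)" by (rule power_int_mult[symmetric])
      also have "int d * q = n" using \<open>r = 0\<close> by (simp add: n_eq)
      finally show "\<psi> (of_int n * g) = c powi n" .
    qed
  qed
  define H' where "H' = {h + of_int n * g | h n. h \<in> H}"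
  define \<psi>' where "\<psi>' y = (let (h, n) = (SOME (h, n). h \<in> H \<and> y = h + of_int n * g) in \<psi> h * c powi n)" for y
  have eq: "\<psi> h * c powi n = \<psi> h' * c powi n'"
    if "h \<in> H" "h' \<in> H" "h + of_int n * g = h' + of_int n' * g" for h h' n n'
  proof -
    have e: "of_int (n - n') * g = h' - h" using that(3) by (simp add: algebra_simps)
    then have "of_int (n - n') * g \<in> H" using diff that by simp
    from c(2)[OF this] have "\<psi> (h' - h) = c powi (n - n')" by (simp only: e)
    moreover have "\<psi> h' = \<psi> h * \<psi> (h' - h)" using H(4)[OF that(1) diff[OF that(2,1)]] by simp
    ultimately show ?thesis using c(1) by (simp add: power_int_diff)
  qed
  have \<psi>': "\<psi>' (h + of_int n * g) = \<psi> h * c powi n" if "h \<in> H" for h n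
  proof -
    define P where "P = (\<lambda>(h', n'). h' \<in> H \<and> h + of_int n * g = h' + of_int n' * g)"
    obtain h' n' where hn: "Eps P = (h', n')" by fastforce
    have "P (h, n)" using that by (simp add: P_def)
    then have "P (h', n')" using someI[of P "(h, n)"] hn by simp
    moreover have "\<psi>' (h + of_int n * g) = \<psi> h' * c powi n'"
      using hn by (simp add: \<psi>'_def P_def Let_def)
    ultimately show ?thesis using eq[of h h' n n'] that by (simp add: P_def)
  qed
  have H'I: "h + of_int n * g \<in> H'" if "h \<in> H" for h n
    unfolding H'_def using that by blast
  show thesis
  proof (rule that[of H' \<psi>'])
    show "character_on H' \<psi>'"
      unfolding character_on_def
    proof (intro conjI ballI)
      show "0 \<in> H'" using H'I[OF H(1), of 0] by simp
      show "\<psi>' x \<noteq> 0" if "x \<in> H'" for x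
        using that \<psi>' c(1) H(3) by (auto simp: H'_def)
      fix x y assume "x \<in> H'" "y \<in> H'"
      then obtain h n k l where xy: "x = h + of_int n * g" "h \<in> H" "y = k + of_int l * g" "k \<in> H"
        by (auto simp: H'_def)
      then have s: "x + y = (h + k) + of_int (n + l) * g" by (simp add: algebra_simps)
      show "x + y \<in> H'" unfolding s using xy H(2) by (intro H'I) auto
      show "\<psi>' (x + y) = \<psi>' x * \<psi>' y"
        unfolding s using xy H(2,4) c(1) by (simp add: \<psi>' power_int_add del: of_int_add)
    qed
    show "- x \<in> H'" if x: "x \<in> H'" for x
    proof -
      obtain h n where "x = h + of_int n * g" "h \<in> H" using x by (auto simp: H'_def)
      then show ?thesis using H'I[OF neg, of h "- n"] by simp
    qed
    show "H \<subseteq> H'" using H'I[of _ 0] by auto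
    show "g \<in> H'" using H'I[OF H(1), of 1] by simp
    show "\<psi>' x = \<psi> x" if "x \<in> H" for x using \<psi>'[OF that, of 0] by simp
  qed
qed

text \<open>The multiplicative group of an algebraically closed field is divisible.\<close>

lemma character_extension:
  fixes \<gamma> :: "'a::ring_1 \<Rightarrow> 'f::alg_closed_field"
  assumes \<gamma>: "character_on S \<gamma>" and G: "finite G"
  obtains H \<psi> where "character_on H \<psi>" "\<And>x. x \<in> H \<Longrightarrow> - x \<in> H" "S \<subseteq> H" "G \<subseteq> H"
    "\<And>x. x \<in> S \<Longrightarrow> \<psi> x = \<gamma> x"
proof -
  have S: "0 \<in> S" "\<And>x y. x \<in> S \<Longrightarrow> y \<in> S \<Longrightarrow> x + y \<in> S"
    "\<And>x. x \<in> S \<Longrightarrow> \<gamma> x \<noteq> 0"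
    "\<And>x y. x \<in> S \<Longrightarrow> y \<in> S \<Longrightarrow> \<gamma> (x + y) = \<gamma> x * \<gamma> y"
    using \<gamma> by (auto simp: character_on_def)
  \<comment> \<open>The group of differences of \<open>S\<close>. As \<open>\<gamma>\<close> has no
    zero on \<open>S\<close>, it extends there by quotients.\<close>
  define H0 where "H0 = {s - t | s t. s \<in> S \<and> t \<in> S}"
  define \<psi>0 where "\<psi>0 y = (let (s, t) = (SOME (s, t). s \<in> S \<and> t \<in> S \<and> y = s - t) in \<gamma> s / \<gamma> t)" for y
  have \<psi>0: "\<psi>0 (s - t) = \<gamma> s / \<gamma> t" if "s \<in> S" "t \<in> S" for s t
  proof -
    define P where "P = (\<lambda>(s', t'). s' \<in> S \<and> t' \<in> S \<and> s - t = s' - t')"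
    obtain s' t' where st: "Eps P = (s', t')" by fastforce
    have "P (s, t)" using that by (simp add: P_def)
    then have P: "P (s', t')" using someI[of P "(s, t)"] st by simp
    have "\<psi>0 (s - t) = \<gamma> s' / \<gamma> t'" using st by (simp add: \<psi>0_def P_def Let_def)
    moreover have "s + t' = s' + t" using P by (simp add: P_def algebra_simps)
    then have "\<gamma> s * \<gamma> t' = \<gamma> s' * \<gamma> t" using S(4) P that by (metis (mono_tags) P_def case_prod_conv)
    moreover have "\<gamma> t \<noteq> 0" "\<gamma> t' \<noteq> 0" using S(3) P that by (auto simp: P_def)
    ultimately show ?thesis by (simp add: frac_eq_eq)
  qed
  have "character_on H0 \<psi>0"
    unfolding character_on_def
  proof (intro conjI ballI)
    show "0 \<in> H0" unfolding H0_def using S(1) by force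
    show "\<psi>0 x \<noteq> 0" if "x \<in> H0" for x using that S(3) by (auto simp: H0_def \<psi>0)
    fix x y assume "x \<in> H0" "y \<in> H0"
    then obtain s t s' t' where xy: "x = s - t" "y = s' - t'" "s \<in> S" "t \<in> S" "s' \<in> S" "t' \<in> S"
      by (auto simp: H0_def)
    have e: "x + y = (s + s') - (t + t')" unfolding xy(1,2) by (simp add: algebra_simps)
    show "x + y \<in> H0" unfolding e H0_def using xy S(2) by blast
    show "\<psi>0 (x + y) = \<psi>0 x * \<psi>0 y" unfolding e using xy by (simp add: \<psi>0 S)
  qed
  moreover have "- x \<in> H0" if x: "x \<in> H0" for x
  proof -
    obtain s t where "x = s - t" "s \<in> S" "t \<in> S" using x unfolding H0_def by blast
    then have "- x = t - s" "t \<in> S" "s \<in> S" by auto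
    then show ?thesis unfolding H0_def by blast
  qed
  moreover have "x \<in> H0 \<and> \<psi>0 x = \<gamma> x" if "x \<in> S" for x
  proof -
    have "x = x - 0" by simp
    then have "x \<in> H0" unfolding H0_def using that S(1) by blast
    then show ?thesis using \<psi>0[OF that S(1)] character_on_zero[OF \<gamma>] by simp
  qed
  ultimately obtain H1 \<psi>1 where 1: "character_on H1 \<psi>1" "\<And>x. x \<in> H1 \<Longrightarrow> - x \<in> H1" "S \<subseteq> H1"
    "\<And>x. x \<in> S \<Longrightarrow> \<psi>1 x = \<gamma> x" by blast
  from G have "\<exists>H \<psi>. character_on H \<psi> \<and> (\<forall>x\<in>H. - x \<in> H) \<and> S \<subseteq> H \<and> G \<subseteq> H \<and> (\<forall>x\<in>S. \<psi> x = \<gamma> x)"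
  proof induction
    case empty
    then show ?case using 1 by blast
  next
    case (insert g G)
    then obtain H \<psi> where IH: "character_on H \<psi>" "\<forall>x\<in>H. - x \<in> H" "S \<subseteq> H" "G \<subseteq> H"
      "\<forall>x\<in>S. \<psi> x = \<gamma> x" by blast
    obtain H' \<psi>' where "character_on H' \<psi>'" "\<And>x. x \<in> H' \<Longrightarrow> - x \<in> H'" "H \<subseteq> H'" "g \<in> H'"
      "\<And>x. x \<in> H \<Longrightarrow> \<psi>' x = \<psi> x"
      using character_extension_step[OF IH(1), of g] IH(2) by blast
    then show ?case using IH by (intro exI[of _ H'] exI[of _ \<psi>']) auto
  qed
  then show thesis using that by blast
qed

section \<open>Surjective toric morphisms\<close>

lemma dual_latticeD:
  assumes "m \<in> dual_lattice N"
  shows "linear m" "m (x + y) = m x + m y" "m (c *\<^sub>R x) = c * m x" "m 0 = 0"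
    "x \<in> N \<Longrightarrow> m x \<in> \<int>"
proof -
  have *: "\<And>x y. m (x + y) = m x + m y" "\<And>c x. m (c *\<^sub>R x) = c * m x" "\<And>x. x \<in> N \<Longrightarrow> m x \<in> \<int>"
    using assms by (auto simp: dual_lattice_def integral_linear_on_def)
  show "linear m" by (rule linearI) (simp_all add: *)
  then show "m 0 = 0" by (rule linear_0)
  show "m (x + y) = m x + m y" "m (c *\<^sub>R x) = c * m x" "x \<in> N \<Longrightarrow> m x \<in> \<int>" by (auto simp: *)
qed

lemma dual_latticeI:
  "linear m \<Longrightarrow> (\<And>x. x \<in> N \<Longrightarrow> m x \<in> \<int>) \<Longrightarrow> m \<in> dual_lattice N"
  by (simp add: dual_lattice_def integral_linear_on_def linear_add linear_scale)

lemma dual_lattice_zero: "(\<lambda>x. 0) \<in> dual_lattice N"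
  by (simp add: dual_lattice_def integral_linear_on_def)

lemma dual_lattice_add:
  "m \<in> dual_lattice N \<Longrightarrow> m' \<in> dual_lattice N \<Longrightarrow> (\<lambda>x. m x + m' x) \<in> dual_lattice N"
  by (auto simp: dual_lattice_def integral_linear_on_def algebra_simps)

lemma dual_lattice_scale:
  "m \<in> dual_lattice N \<Longrightarrow> c \<in> \<int> \<Longrightarrow> (\<lambda>x. c * m x) \<in> dual_lattice N"
  by (auto simp: dual_lattice_def integral_linear_on_def algebra_simps)

lemma dual_lattice_comp:
  "m \<in> dual_lattice N' \<Longrightarrow> linear U \<Longrightarrow> U ` N \<subseteq> N' \<Longrightarrow> m \<circ> U \<in> dual_lattice N"
  by (auto simp: dual_lattice_def integral_linear_on_def linear_add linear_scale image_subset_iff)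

text \<open>The coordinate functionals of a lattice basis generate the dual lattice over the
  integers. Being finitely many, they can be adjoined one by one when a character is
  extended.\<close>

lemma dual_lattice_generators:
  fixes N :: "'n::real_vector set"
  assumes "full_lattice N"
  obtains B :: "'n set" and f where "finite B" "\<And>b. b \<in> B \<Longrightarrow> f b \<in> dual_lattice N"
    "\<And>m. m \<in> dual_lattice N \<Longrightarrow> \<exists>k :: 'n \<Rightarrow> int. m = (\<lambda>x. \<Sum>b\<in>B. of_int (k b) * f b x)"
proof -
  obtain B where B: "finite B" "independent B" "span B = UNIV"
    and N: "N = {(\<Sum>b\<in>B. of_int (c b) *\<^sub>R b) | c :: 'n \<Rightarrow> int. True}"
    using assms unfolding full_lattice_def by blast
  define f where "f b x = representation B x b" for b x
  have x_eq: "(\<Sum>b\<in>B. f b x *\<^sub>R b) = x" for x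
    unfolding f_def using B by (intro real_vector.sum_representation_eq) auto
  have BN: "b \<in> N" if "b \<in> B" for b
  proof -
    have "b = (\<Sum>a\<in>B. (if a = b then 1 else 0) *\<^sub>R a)"
      using B(1) that by (simp add: if_distrib[of "\<lambda>c. c *\<^sub>R _"] cong: if_cong)
    also have "\<dots> = (\<Sum>a\<in>B. of_int (if a = b then 1 else 0) *\<^sub>R a)"
      by (intro sum.cong) auto
    finally show ?thesis unfolding N by (intro CollectI exI conjI TrueI)
  qed
  have "f b \<in> dual_lattice N" if b: "b \<in> B" for b
  proof (rule dual_latticeI)
    show "linear (f b)"
      unfolding f_def using B(2,3)
      by (intro linearI) (simp_all add: real_vector.representation_add real_vector.representation_scale)
    fix x assume "x \<in> N"
    then obtain c :: "'n \<Rightarrow> int" where c: "x = (\<Sum>b\<in>B. of_int (c b) *\<^sub>R b)" unfolding N by blast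
    have "(\<Sum>b\<in>B. (f b x - of_int (c b)) *\<^sub>R b) = 0"
      using x_eq[of x] c by (simp add: scaleR_left_diff_distrib sum_subtractf)
    then have "f b x - of_int (c b) = 0"
      using independentD[OF B(2,1) order_refl, of "\<lambda>b. f b x - of_int (c b)" b] b by blast
    then show "f b x \<in> \<int>" by simp
  qed
  moreover have "\<exists>k :: 'n \<Rightarrow> int. m = (\<lambda>x. \<Sum>b\<in>B. of_int (k b) * f b x)" if m: "m \<in> dual_lattice N" for m
  proof
    \<comment> \<open>The value \<open>m b\<close> is already an integer; the floor only gives it
      the type \<open>int\<close>.\<close>
    show "m = (\<lambda>x. \<Sum>b\<in>B. of_int \<lfloor>m b\<rfloor> * f b x)"
    proof
      fix x
      have "m x = m (\<Sum>b\<in>B. f b x *\<^sub>R b)" by (simp add: x_eq)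
      also have "\<dots> = (\<Sum>b\<in>B. f b x * m b)"
        using linear_sum[OF dual_latticeD(1)[OF m], of "\<lambda>b. f b x *\<^sub>R b" B] dual_latticeD(3)[OF m]
        by simp
      also have "\<dots> = (\<Sum>b\<in>B. of_int \<lfloor>m b\<rfloor> * f b x)"
        using dual_latticeD(5)[OF m BN] by (intro sum.cong) (auto simp: of_int_floor)
      finally show "m x = (\<Sum>b\<in>B. of_int \<lfloor>m b\<rfloor> * f b x)" .
    qed
  qed
  ultimately show thesis using B(1) by (intro that)
qed

lemma cone_monoid_antimono: "\<tau> \<subseteq> \<sigma> \<Longrightarrow> cone_monoid N \<sigma> \<subseteq> cone_monoid N \<tau>"
  by (auto simp: cone_monoid_def)

lemma cone_monoid_zero: "(\<lambda>x. 0) \<in> cone_monoid N \<sigma>"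
  by (simp add: cone_monoid_def dual_lattice_zero)

lemma cone_monoid_add:
  "m \<in> cone_monoid N \<sigma> \<Longrightarrow> m' \<in> cone_monoid N \<sigma> \<Longrightarrow> (\<lambda>x. m x + m' x) \<in> cone_monoid N \<sigma>"
  by (simp add: cone_monoid_def dual_lattice_add)

lemma cone_monoid_comp:
  "m \<in> cone_monoid N' \<xi> \<Longrightarrow> linear U \<Longrightarrow> U ` N \<subseteq> N' \<Longrightarrow> U ` \<sigma> \<subseteq> \<xi> \<Longrightarrow> m \<circ> U \<in> cone_monoid N \<sigma>"
  by (auto simp: cone_monoid_def dual_lattice_comp image_subset_iff)

lemma affine_chartI:
  assumes "f (\<lambda>x. 0) = 1"
    "\<And>m m'. m \<in> cone_monoid N \<sigma> \<Longrightarrow> m' \<in> cone_monoid N \<sigma> \<Longrightarrow> f (\<lambda>x. m x + m' x) = f m * f m'"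
  shows "restrict f (cone_monoid N \<sigma>) \<in> affine_chart N \<sigma>"
  using assms by (simp add: affine_chart_def cone_monoid_zero cone_monoid_add)

lemma affine_chartD:
  assumes "\<gamma> \<in> affine_chart N \<sigma>"
  shows "\<gamma> (\<lambda>x. 0) = 1" "\<gamma> \<in> extensional (cone_monoid N \<sigma>)"
    "m \<in> cone_monoid N \<sigma> \<Longrightarrow> m' \<in> cone_monoid N \<sigma> \<Longrightarrow> \<gamma> (\<lambda>x. m x + m' x) = \<gamma> m * \<gamma> m'"
  using assms by (auto simp: affine_chart_def)

lemma restrict_affine_chart:
  assumes "\<gamma> \<in> affine_chart N \<tau>" "\<tau> \<subseteq> \<sigma>"
  shows "restrict \<gamma> (cone_monoid N \<sigma>) \<in> affine_chart N \<sigma>"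
  using affine_chartD[OF assms(1)] cone_monoid_antimono[OF assms(2)] by (intro affine_chartI) auto

lemma affine_chart_power:
  assumes \<gamma>: "\<gamma> \<in> affine_chart N \<sigma>" and m: "m \<in> cone_monoid N \<sigma>"
  shows "(\<lambda>x. real k * m x) \<in> cone_monoid N \<sigma> \<and> \<gamma> (\<lambda>x. real k * m x) = \<gamma> m ^ k"
proof (induction k)
  case 0
  then show ?case using affine_chartD(1)[OF \<gamma>] by (simp add: cone_monoid_zero)
next
  case (Suc k)
  have "(\<lambda>x. real (Suc k) * m x) = (\<lambda>x. m x + real k * m x)" by (simp add: algebra_simps)
  then show ?case
    using Suc cone_monoid_add[OF m, of "\<lambda>x. real k * m x"] affine_chartD(3)[OF \<gamma> m, of "\<lambda>x. real k * m x"]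
    by (simp only: power_Suc)
qed

lemma cone_face_subset: "cone_face \<tau> \<sigma> \<Longrightarrow> \<tau> \<subseteq> \<sigma>"
  by (simp add: cone_face_def face_of_imp_subset)

lemma glue_refl: "(p, p) \<in> glue N \<Delta>"
  by (simp add: glue_def)

lemma glue_sym: "(p, q) \<in> glue N \<Delta> \<Longrightarrow> (q, p) \<in> glue N \<Delta>"
  unfolding glue_def by (rule symD[OF sym_rtrancl[OF sym_Un_converse]])

lemma glue_trans: "(p, q) \<in> glue N \<Delta> \<Longrightarrow> (q, s) \<in> glue N \<Delta> \<Longrightarrow> (p, s) \<in> glue N \<Delta>"
  unfolding glue_def by (rule rtrancl_trans)

lemma glue_face:
  assumes "\<tau> \<in> \<Delta>" "\<sigma> \<in> \<Delta>" "cone_face \<tau> \<sigma>" "\<gamma> \<in> affine_chart N \<tau>"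
  shows "((\<tau>, \<gamma>), (\<sigma>, restrict \<gamma> (cone_monoid N \<sigma>))) \<in> glue N \<Delta>"
  unfolding glue_def face_inclusion_def using assms by (intro r_into_rtrancl UnI1) blast

lemma glue_Image_eq: "(p, q) \<in> glue N \<Delta> \<Longrightarrow> glue N \<Delta> `` {p} = glue N \<Delta> `` {q}"
  using glue_sym glue_trans by blast

section \<open>Toric morphisms on gluing classes\<close>

definition chart_map ::
    "'m::real_vector set \<Rightarrow> ('n \<Rightarrow> 'm) \<Rightarrow> 'm set \<Rightarrow> (('n \<Rightarrow> real) \<Rightarrow> 'f) \<Rightarrow> ('m \<Rightarrow> real) \<Rightarrow> 'f" where
  "chart_map N' U \<xi> \<gamma> = restrict (\<lambda>m. \<gamma> (m \<circ> U)) (cone_monoid N' \<xi>)"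

context
  fixes N :: "'n::real_vector set" and \<Delta> :: "'n set set"
    and N' :: "'m::real_vector set" and \<Xi> :: "'m set set" and U :: "'n \<Rightarrow> 'm"
  assumes \<Xi>: "fan N' \<Xi>" and U: "fan_map N \<Delta> N' \<Xi> U"
begin

lemma fan_mapD: "linear U" "U ` N \<subseteq> N'" "\<sigma> \<in> \<Delta> \<Longrightarrow> \<exists>\<xi>\<in>\<Xi>. U ` \<sigma> \<subseteq> \<xi>"
  using U by (auto simp: fan_map_def)

lemma comp_cone_monoid: "U ` \<sigma> \<subseteq> \<xi> \<Longrightarrow> m \<in> cone_monoid N' \<xi> \<Longrightarrow> m \<circ> U \<in> cone_monoid N \<sigma>"
  by (rule cone_monoid_comp[OF _ fan_mapD(1,2)])

lemma chart_map_affine_chart: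
  assumes \<gamma>: "\<gamma> \<in> affine_chart N \<sigma>" and "U ` \<sigma> \<subseteq> \<xi>"
  shows "chart_map N' U \<xi> \<gamma> \<in> affine_chart N' \<xi>"
  unfolding chart_map_def
proof (rule affine_chartI)
  show "\<gamma> ((\<lambda>x. 0) \<circ> U) = 1" using affine_chartD(1)[OF \<gamma>] by (simp add: o_def)
  show "\<gamma> ((\<lambda>x. m x + m' x) \<circ> U) = \<gamma> (m \<circ> U) * \<gamma> (m' \<circ> U)"
    if "m \<in> cone_monoid N' \<xi>" "m' \<in> cone_monoid N' \<xi>" for m m'
    using affine_chartD(3)[OF \<gamma> comp_cone_monoid[OF assms(2) that(1)] comp_cone_monoid[OF assms(2) that(2)]]
    by (simp add: o_def)
qed

lemma chart_map_restrict:
  assumes "U ` \<sigma> \<subseteq> \<xi>"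
  shows "chart_map N' U \<xi> (restrict \<gamma> (cone_monoid N \<sigma>)) = chart_map N' U \<xi> \<gamma>"
  unfolding chart_map_def using comp_cone_monoid[OF assms] by (intro restrict_ext) simp

text \<open>The intersection of the two targets still contains the image and is a common face of
  both, and the two chart points are restrictions of one point in its chart.\<close>

lemma glue_chart_map_target:
  assumes "\<gamma> \<in> affine_chart N \<sigma>" "\<xi> \<in> \<Xi>" "\<xi>' \<in> \<Xi>" "U ` \<sigma> \<subseteq> \<xi>" "U ` \<sigma> \<subseteq> \<xi>'"
  shows "((\<xi>, chart_map N' U \<xi> \<gamma>), (\<xi>', chart_map N' U \<xi>' \<gamma>)) \<in> glue N' \<Xi>"
proof -
  define \<eta> where "\<eta> = \<xi> \<inter> \<xi>'"
  have f: "cone_face \<eta> \<xi>" "cone_face \<eta> \<xi>'" and \<eta>: "\<eta> \<in> \<Xi>"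
    using \<Xi> assms unfolding fan_def \<eta>_def by blast+
  have ch: "chart_map N' U \<eta> \<gamma> \<in> affine_chart N' \<eta>"
    by (rule chart_map_affine_chart[OF assms(1)]) (use assms in \<open>auto simp: \<eta>_def\<close>)
  have "restrict (chart_map N' U \<eta> \<gamma>) (cone_monoid N' \<zeta>) = chart_map N' U \<zeta> \<gamma>"
    if "cone_face \<eta> \<zeta>" for \<zeta>
    unfolding chart_map_def using cone_monoid_antimono[OF cone_face_subset[OF that]]
    by (intro ext) auto
  then show ?thesis
    using glue_face[OF \<eta> assms(2) f(1) ch] glue_face[OF \<eta> assms(3) f(2) ch] glue_sym glue_trans
    by (metis f)
qed

text \<open>Induction along a chain of face inclusions. From a face to a larger cone, a target of
  the larger cone is also one of the face. In the opposite direction a target of the larger cone is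
  used first and then exchanged by \<open>glue_chart_map_target\<close>.\<close>

lemma glue_chart_map:
  assumes pq: "((\<sigma>, \<gamma>), q) \<in> glue N \<Delta>" and \<sigma>: "\<sigma> \<in> \<Delta>" "\<gamma> \<in> affine_chart N \<sigma>"
    and \<xi>: "\<xi> \<in> \<Xi>" "U ` \<sigma> \<subseteq> \<xi>"
  shows "fst q \<in> \<Delta> \<and> snd q \<in> affine_chart N (fst q) \<and>
    (\<forall>\<xi>'\<in>\<Xi>. U ` fst q \<subseteq> \<xi>' \<longrightarrow>
       ((\<xi>, chart_map N' U \<xi> \<gamma>), (\<xi>', chart_map N' U \<xi>' (snd q))) \<in> glue N' \<Xi>)"
  using pq unfolding glue_def[of N \<Delta>]
proof (induction rule: rtrancl_induct)
  case base
  then show ?case using \<sigma> \<xi> glue_chart_map_target by auto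
next
  case (step p q)
  show ?case
  proof (cases "(p, q) \<in> face_inclusion N \<Delta>")
    case True
    then obtain \<tau> \<sigma>' \<delta> where e: "p = (\<tau>, \<delta>)" "q = (\<sigma>', restrict \<delta> (cone_monoid N \<sigma>'))"
      and *: "\<tau> \<in> \<Delta>" "\<sigma>' \<in> \<Delta>" "cone_face \<tau> \<sigma>'" "\<delta> \<in> affine_chart N \<tau>"
      unfolding face_inclusion_def by blast
    have "U ` \<tau> \<subseteq> \<xi>'" if "U ` \<sigma>' \<subseteq> \<xi>'" for \<xi>'
      using that cone_face_subset[OF *(3)] by blast
    moreover have "\<forall>\<xi>'\<in>\<Xi>. U ` \<tau> \<subseteq> \<xi>' \<longrightarrow>
        ((\<xi>, chart_map N' U \<xi> \<gamma>), (\<xi>', chart_map N' U \<xi>' \<delta>)) \<in> glue N' \<Xi>"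
      using step.IH by (simp add: e)
    ultimately show ?thesis
      unfolding e fst_conv snd_conv
      using *(2) restrict_affine_chart[OF *(4) cone_face_subset[OF *(3)]]
      by (metis chart_map_restrict)
  next
    case False
    then have "(q, p) \<in> face_inclusion N \<Delta>" using step.hyps by auto
    then obtain \<tau> \<sigma>' \<delta> where e: "q = (\<tau>, \<delta>)" "p = (\<sigma>', restrict \<delta> (cone_monoid N \<sigma>'))"
      and *: "\<tau> \<in> \<Delta>" "\<sigma>' \<in> \<Delta>" "cone_face \<tau> \<sigma>'" "\<delta> \<in> affine_chart N \<tau>"
      unfolding face_inclusion_def by blast
    obtain \<xi>'' where \<xi>'': "\<xi>'' \<in> \<Xi>" "U ` \<sigma>' \<subseteq> \<xi>''" using fan_mapD(3) *(2) by blast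
    have g: "((\<xi>, chart_map N' U \<xi> \<gamma>), (\<xi>'', chart_map N' U \<xi>'' \<delta>)) \<in> glue N' \<Xi>"
      using step.IH \<xi>'' chart_map_restrict[OF \<xi>''(2), of \<delta>] unfolding e fst_conv snd_conv by metis
    have "U ` \<tau> \<subseteq> \<xi>''" using \<xi>'' cone_face_subset[OF *(3)] by blast
    then show ?thesis
      using * glue_trans[OF g] glue_chart_map_target[OF *(4) \<xi>''(1)] by (simp add: e)
  qed
qed

text \<open>Well-definedness: the unions in \<open>toric_morphism\<close> collapse to a single
  class, so one representative and one target cone suffice from here on.\<close>

lemma toric_morphism_class:
  assumes \<sigma>: "\<sigma> \<in> \<Delta>" "\<gamma> \<in> affine_chart N \<sigma>" and \<xi>: "\<xi> \<in> \<Xi>" "U ` \<sigma> \<subseteq> \<xi>"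
  shows "toric_morphism N \<Delta> N' \<Xi> U (glue N \<Delta> `` {(\<sigma>, \<gamma>)}) = glue N' \<Xi> `` {(\<xi>, chart_map N' U \<xi> \<gamma>)}"
    (is "?L = ?R")
proof
  show "?L \<subseteq> ?R"
  proof
    fix y assume "y \<in> ?L"
    then obtain p \<xi>' where p: "((\<sigma>, \<gamma>), p) \<in> glue N \<Delta>" and \<xi>': "\<xi>' \<in> \<Xi>" "U ` fst p \<subseteq> \<xi>'"
      and y: "((\<xi>', chart_map N' U \<xi>' (snd p)), y) \<in> glue N' \<Xi>"
      unfolding toric_morphism_def case_prod_unfold chart_map_def by blast
    show "y \<in> ?R"
      using glue_chart_map[OF p \<sigma> \<xi>] \<xi>' glue_trans[OF _ y] by blast
  qed
  show "?R \<subseteq> ?L"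
  proof
    fix y assume y: "y \<in> ?R"
    have "(\<sigma>, \<gamma>) \<in> glue N \<Delta> `` {(\<sigma>, \<gamma>)}" using glue_refl by blast
    moreover have "\<xi> \<in> {\<xi> \<in> \<Xi>. U ` fst (\<sigma>, \<gamma>) \<subseteq> \<xi>}" using \<xi> by simp
    moreover have "y \<in> glue N' \<Xi> `` {(\<xi>, restrict (\<lambda>m. snd (\<sigma>, \<gamma>) (m \<circ> U)) (cone_monoid N' \<xi>))}"
      using y by (simp only: chart_map_def snd_conv)
    ultimately show "y \<in> ?L"
      unfolding toric_morphism_def case_prod_unfold by (intro UN_I)
  qed
qed

end

text \<open>
  A geometric point of the chart of \<open>\<xi>\<close> is supported on \<open>\<xi>\<^sup>\<or> \<inter> \<tau>\<^sup>\<bottom>\<close> for a face \<open>\<tau>\<close> of \<open>\<xi>\<close>, i.e. it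
  lies in the torus orbit of \<open>\<tau>\<close>.
\<close>

lemma affine_chart_support:
  fixes N' :: "'m::real_vector set"
  assumes \<xi>: "rational_cone N' \<xi>" and \<gamma>: "\<gamma> \<in> affine_chart N' \<xi>"
  obtains \<tau> where "cone_face \<tau> \<xi>"
    "\<And>m. m \<in> cone_monoid N' \<xi> \<Longrightarrow> \<gamma> m \<noteq> 0 \<longleftrightarrow> (\<forall>y\<in>\<tau>. m y = 0)"
proof -
  obtain A where A: "finite A" "A \<subseteq> N'" "\<xi> = convex_cone hull A"
    using \<xi> unfolding rational_cone_def by blast
  have cc: "convex_cone \<xi>" unfolding A(3) by (rule convex_cone_convex_cone_hull)
  define C where "C = cone_monoid N' \<xi>"
  define S where "S = {m \<in> C. \<gamma> m \<noteq> 0}"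
  have C: "m \<in> dual_lattice N'" "0 \<le> m y" if "m \<in> C" "y \<in> \<xi>" for m y
    using that by (auto simp: C_def cone_monoid_def)
  have S_C: "S \<subseteq> C" by (auto simp: S_def)
  have S0: "(\<lambda>x. 0) \<in> S"
    using affine_chartD(1)[OF \<gamma>] by (simp add: S_def C_def cone_monoid_zero)
  have S_add: "(\<lambda>x. m x + m' x) \<in> S" if "m \<in> S" "m' \<in> S" for m m'
    using that affine_chartD(3)[OF \<gamma>] by (simp add: S_def C_def cone_monoid_add)
  \<comment> \<open>The generators at which some character with nonzero value under
    \<open>\<gamma>\<close> is nonzero. Adding such characters produces a single \<open>s\<close>
    positive on all of \<open>A'\<close>, and the zero set of \<open>s\<close> in
    \<open>\<xi>\<close> is the face sought.\<close>
  define A' where "A' = {a \<in> A. \<exists>m\<in>S. m a \<noteq> 0}"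
  have fin: "finite A'" using A(1) by (simp add: A'_def)
  have "\<exists>s\<in>S. \<forall>a\<in>F. 0 < s a" if "F \<subseteq> A'" for F
    using finite_subset[OF that fin] that
  proof (induction F rule: finite_induct)
    case empty
    then show ?case using S0 by blast
  next
    case (insert a F)
    then obtain s where s: "s \<in> S" "\<forall>a\<in>F. 0 < s a" by auto
    obtain m where m: "m \<in> S" "m a \<noteq> 0" using insert.prems by (auto simp: A'_def)
    have nn: "0 \<le> f b" if "f \<in> S" "b \<in> insert a F" for f b
    proof -
      have "b \<in> A" using that insert.prems by (auto simp: A'_def)
      then have "b \<in> \<xi>" unfolding A(3) by (rule hull_inc)
      then show ?thesis using C(2)[of f b] S_C that(1) by blast
    qed
    have "0 < s b + m b" if b: "b \<in> insert a F" for b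
    proof (cases "b = a")
      case True
      then show ?thesis using nn[OF s(1) b] nn[OF m(1) b] m(2) by simp
    next
      case False
      then have "0 < s b" using b s(2) by blast
      then show ?thesis using nn[OF m(1) b] by simp
    qed
    then show ?case using S_add[OF s(1) m(1)] by (intro bexI[of _ "\<lambda>x. s x + m x"]) auto
  qed
  from this[OF order_refl] obtain s where s: "s \<in> S" "\<And>a. a \<in> A' \<Longrightarrow> 0 < s a" by blast
  have sC: "s \<in> C" using s(1) S_C by blast
  have s_dual: "s \<in> dual_lattice N'" using sC by (simp add: C_def cone_monoid_def)
  define \<tau> where "\<tau> = {y \<in> \<xi>. s y = 0}"
  have "convex_cone \<tau>"
    using cc unfolding convex_cone_iff \<tau>_def
    by (auto simp: dual_latticeD[OF s_dual])
  moreover have "a \<in> \<tau>" if "a \<in> \<xi>" "b \<in> \<xi>" "a + b \<in> \<tau>" for a b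
    using that C(2)[OF sC that(1)] C(2)[OF sC that(2)]
    by (auto simp: \<tau>_def dual_latticeD(2)[OF s_dual])
  ultimately have "\<tau> face_of \<xi> \<and> \<tau> \<noteq> {}"
    unfolding face_of_convex_cone_iff[OF cc] by (auto simp: \<tau>_def)
  then have face: "cone_face \<tau> \<xi>" by (simp add: cone_face_def)
  have \<tau>_hull: "\<tau> = convex_cone hull (A \<inter> \<tau>)"
    using face unfolding cone_face_def A(3) by (intro face_of_convex_cone_hull A(1)) auto
  have vanish: "m y = 0" if m: "m \<in> S" and y: "y \<in> \<tau>" for m y
  proof -
    have d: "m \<in> dual_lattice N'" using m S_C by (auto simp: C_def cone_monoid_def)
    have "convex_cone hull (A \<inter> \<tau>) \<subseteq> {y. m y = 0}"
    proof (rule hull_minimal)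
      show "A \<inter> \<tau> \<subseteq> {y. m y = 0}"
        using s(2) m by (fastforce simp: \<tau>_def A'_def)
      show "convex_cone {y. m y = 0}"
        unfolding convex_cone_iff by (simp add: dual_latticeD[OF d])
    qed
    then show ?thesis using y \<tau>_hull by blast
  qed
  \<comment> \<open>A large multiple of \<open>s\<close> dominates \<open>m\<close> on all
    generators, since those with \<open>s a = 0\<close> lie in \<open>\<tau>\<close>, where
    \<open>m\<close> vanishes. So \<open>\<gamma> m\<close> is a factor of a power of
    \<open>\<gamma> s\<close> and cannot be zero.\<close>
  have support: "\<gamma> m \<noteq> 0" if m: "m \<in> C" and 0: "\<forall>y\<in>\<tau>. m y = 0" for m
  proof -
    have md: "m \<in> dual_lattice N'" using m by (simp add: C_def cone_monoid_def)
    have "\<exists>k::nat. m a \<le> real k * s a" if a: "a \<in> A" for a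
    proof (cases "s a = 0")
      case True
      then have "a \<in> \<tau>" using a by (simp add: \<tau>_def A(3) hull_inc)
      then show ?thesis using 0 True by simp
    next
      case False
      have "0 \<le> s a" using C(2)[OF sC] a by (simp add: A(3) hull_inc)
      then have "0 < s a" using False by simp
      then show ?thesis using ex_less_of_nat_mult[of "s a" "m a"] by (auto intro: less_imp_le)
    qed
    then obtain k :: "'m \<Rightarrow> nat" where k: "\<And>a. a \<in> A \<Longrightarrow> m a \<le> real (k a) * s a" by metis
    define l where "l = sum k A"
    define t where "t = (\<lambda>x. real l * s x - m x)"
    have td: "t \<in> dual_lattice N'"
      using dual_lattice_add[OF dual_lattice_scale[OF s_dual, of "real l"] dual_lattice_scale[OF md, of "-1"]]
      by (simp add: t_def)
    have "\<xi> \<subseteq> {y. 0 \<le> t y}"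
      unfolding A(3)
    proof (rule hull_minimal)
      show "A \<subseteq> {y. 0 \<le> t y}"
      proof
        fix a assume a: "a \<in> A"
        have "k a \<le> l" unfolding l_def using A(1) a by (intro member_le_sum) auto
        moreover have "0 \<le> s a" using C(2)[OF sC] a by (simp add: A(3) hull_inc)
        ultimately have "real (k a) * s a \<le> real l * s a" by (intro mult_right_mono) auto
        then show "a \<in> {y. 0 \<le> t y}" using k[OF a] by (simp add: t_def)
      qed
      show "convex_cone {y. 0 \<le> t y}"
        unfolding convex_cone_iff by (simp add: dual_latticeD[OF td])
    qed
    then have tC: "t \<in> C" using td by (auto simp: C_def cone_monoid_def)
    have "(\<lambda>x. real l * s x) = (\<lambda>x. m x + t x)" by (simp add: t_def)
    then have "\<gamma> m * \<gamma> t = \<gamma> s ^ l"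
      using affine_chartD(3)[OF \<gamma>, of m t] affine_chart_power[OF \<gamma>, of s l] m tC sC
      by (simp add: C_def)
    then show ?thesis using s(1) by (auto simp: S_def)
  qed
  show thesis
  proof (rule that[OF face])
    fix m assume "m \<in> cone_monoid N' \<xi>"
    then show "\<gamma> m \<noteq> 0 \<longleftrightarrow> (\<forall>y\<in>\<tau>. m y = 0)"
      using support[of m] vanish[of m] by (auto simp: S_def C_def)
  qed
qed

lemma of_int_fun: "of_int n = (\<lambda>x. of_int n)"
  by (cases n rule: int_cases2) (simp_all add: of_nat_fun fun_eq_iff)

text \<open>As \<open>U\<close> is surjective, \<open>m \<mapsto> m \<circ> U\<close> is injective:
  composing with a section of \<open>U\<close> recovers \<open>m\<close>. Hence
  \<open>\<gamma>\<close> is a character on the image of \<open>S\<close>, and it extends to a group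
  containing generators of the dual lattice of \<open>N\<close>.\<close>

lemma toric_point_lift:
  fixes N :: "'n::real_vector set" and N' :: "'m::real_vector set"
    and \<gamma> :: "('m \<Rightarrow> real) \<Rightarrow> 'f::alg_closed_field"
  assumes N: "full_lattice N" and U: "linear U" "U ` N \<subseteq> N'" "surj U"
    and S: "(\<lambda>x. 0) \<in> S" "S \<subseteq> dual_lattice N'"
      "\<And>m m'. m \<in> S \<Longrightarrow> m' \<in> S \<Longrightarrow> (\<lambda>x. m x + m' x) \<in> S \<and> \<gamma> (\<lambda>x. m x + m' x) = \<gamma> m * \<gamma> m'"
      "\<And>m. m \<in> S \<Longrightarrow> \<gamma> m \<noteq> 0"
  shows "\<exists>\<psi>. \<psi> (\<lambda>x. 0) = 1 \<and>
    (\<forall>m\<in>dual_lattice N. \<forall>m'\<in>dual_lattice N. \<psi> (\<lambda>x. m x + m' x) = \<psi> m * \<psi> m') \<and>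
    (\<forall>m\<in>S. \<psi> (m \<circ> U) = \<gamma> m)"
proof -
  define V where "V = inv_into UNIV U"
  have UV: "(m \<circ> U) \<circ> V = m" for m :: "'m \<Rightarrow> real"
    using U(3) by (simp add: V_def fun_eq_iff surj_f_inv_f)
  define T where "T = (\<lambda>m. m \<circ> U) ` S"
  define \<delta> where "\<delta> f = \<gamma> (f \<circ> V)" for f
  have "character_on T \<delta>"
    unfolding character_on_def
  proof (intro conjI ballI)
    have "(0 :: 'n \<Rightarrow> real) = (\<lambda>x. 0) \<circ> U" by (simp add: fun_eq_iff)
    then show "0 \<in> T" using S(1) unfolding T_def by blast
    show "\<delta> x \<noteq> 0" if "x \<in> T" for x using that S(4) by (auto simp: T_def \<delta>_def UV)
    fix x y assume "x \<in> T" "y \<in> T"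
    then obtain m m' where m: "x = m \<circ> U" "y = m' \<circ> U" "m \<in> S" "m' \<in> S" by (auto simp: T_def)
    have e: "x + y = (\<lambda>x. m x + m' x) \<circ> U" by (simp add: m fun_eq_iff)
    show "x + y \<in> T" unfolding e T_def using S(3)[OF m(3,4)] by blast
    show "\<delta> (x + y) = \<delta> x * \<delta> y"
      unfolding e using S(3)[OF m(3,4)] by (simp only: m(1,2) \<delta>_def UV)
  qed
  moreover obtain B :: "'n set" and f where B: "finite B" "\<And>b. b \<in> B \<Longrightarrow> f b \<in> dual_lattice N"
    "\<And>m. m \<in> dual_lattice N \<Longrightarrow> \<exists>k :: 'n \<Rightarrow> int. m = (\<lambda>x. \<Sum>b\<in>B. of_int (k b) * f b x)"
    using dual_lattice_generators[OF N] by metis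
  ultimately obtain H \<psi> where H: "character_on H \<psi>" "\<And>x. x \<in> H \<Longrightarrow> - x \<in> H" "T \<subseteq> H" "f ` B \<subseteq> H"
    "\<And>x. x \<in> T \<Longrightarrow> \<psi> x = \<delta> x"
    using character_extension[of T \<delta> "f ` B"] by blast
  have "dual_lattice N \<subseteq> H"
  proof
    fix m assume "m \<in> dual_lattice N"
    then obtain k :: "'n \<Rightarrow> int" where k: "m = (\<lambda>x. \<Sum>b\<in>B. of_int (k b) * f b x)" using B(3) by blast
    have "(\<lambda>x. \<Sum>b\<in>F. of_int (k b) * f b x) \<in> H" if "F \<subseteq> B" for F
      using finite_subset[OF that B(1)] that
    proof (induction F rule: finite_induct)
      case empty
      then show ?case using H(1) by (simp add: character_on_def zero_fun_def)
    next
      case (insert b F)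
      have "of_int (k b) * f b \<in> H"
        using character_on_int_mult[OF H(1,2), of "f b"] H(4) insert.prems by auto
      then have "of_int (k b) * f b + (\<lambda>x. \<Sum>b\<in>F. of_int (k b) * f b x) \<in> H"
        using insert H(1) by (simp add: character_on_def)
      moreover have "of_int (k b) * f b + (\<lambda>x. \<Sum>b\<in>F. of_int (k b) * f b x) =
          (\<lambda>x. \<Sum>b\<in>insert b F. of_int (k b) * f b x)"
        using insert.hyps by (simp add: fun_eq_iff of_int_fun)
      ultimately show ?case by simp
    qed
    then show "m \<in> H" unfolding k by blast
  qed
  then show ?thesis
  proof (intro exI[of _ \<psi>] conjI ballI)
    show "\<psi> (\<lambda>x. 0) = 1" using character_on_zero[OF H(1)] by (simp add: zero_fun_def)
    fix m m' assume "m \<in> dual_lattice N" "m' \<in> dual_lattice N" "dual_lattice N \<subseteq> H"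
    then have "\<psi> (m + m') = \<psi> m * \<psi> m'" using H(1) by (auto simp: character_on_def)
    then show "\<psi> (\<lambda>x. m x + m' x) = \<psi> m * \<psi> m'" by (simp add: plus_fun_def)
  next
    fix m assume "m \<in> S"
    then have "m \<circ> U \<in> T" by (simp add: T_def)
    then show "\<psi> (m \<circ> U) = \<gamma> m" using H(5) by (simp add: \<delta>_def UV)
  qed
qed

text \<open>Given a point in the orbit of a face \<open>\<tau>\<close>, take \<open>z\<close> in the
  relative interior of \<open>\<tau>\<close>, some \<open>x\<close> with \<open>U x = z\<close>, and
  a cone \<open>\<sigma>\<close> containing \<open>x\<close>. Every target cone of
  \<open>\<sigma>\<close> contains \<open>z\<close> and so has \<open>\<tau>\<close> as a face; thus
  the given point and the image of a lift can be compared in the chart of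
  \<open>\<tau>\<close>.\<close>

theorem surjective_toric_morphismI:
  fixes N :: "'n::real_vector set" and N' :: "'m::real_vector set"
  assumes N: "full_lattice N" and \<Delta>: "complete_fan N \<Delta>" and \<Xi>: "fan N' \<Xi>"
    and U: "fan_map N \<Delta> N' \<Xi> U" and surj: "surj U"
  shows "surjective_toric_morphism TYPE('k::field) N \<Delta> N' \<Xi> U"
proof -
  let ?X = "toric_variety N \<Delta> :: ('n, 'k) chart_point set set"
  let ?Y = "toric_variety N' \<Xi> :: ('m, 'k) chart_point set set"
  note lin = fan_mapD(1,2)[OF \<Xi> U] and cls = toric_morphism_class[OF \<Xi> U]
  have "toric_morphism N \<Delta> N' \<Xi> U P \<in> ?Y" if P: "P \<in> ?X" for P
  proof -
    obtain \<sigma> \<gamma> where p: "\<sigma> \<in> \<Delta>" "\<gamma> \<in> affine_chart N \<sigma>" "P = glue N \<Delta> `` {(\<sigma>, \<gamma>)}"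
      using P unfolding toric_variety_def by (auto elim!: quotientE)
    obtain \<xi> where \<xi>: "\<xi> \<in> \<Xi>" "U ` \<sigma> \<subseteq> \<xi>" using fan_mapD(3)[OF \<Xi> U p(1)] by blast
    show ?thesis
      unfolding p(3) cls[OF p(1,2) \<xi>] toric_variety_def
      using \<xi>(1) chart_map_affine_chart[OF \<Xi> U p(2) \<xi>(2)] by (intro quotientI SigmaI)
  qed
  moreover have "\<exists>P\<in>?X. toric_morphism N \<Delta> N' \<Xi> U P = Q" if Q: "Q \<in> ?Y" for Q
  proof -
    obtain \<xi> \<gamma> where q: "\<xi> \<in> \<Xi>" "\<gamma> \<in> affine_chart N' \<xi>" "Q = glue N' \<Xi> `` {(\<xi>, \<gamma>)}"
      using Q unfolding toric_variety_def by (auto elim!: quotientE)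
    have rat: "\<And>\<xi>. \<xi> \<in> \<Xi> \<Longrightarrow> rational_cone N' \<xi>" using \<Xi> by (simp add: fan_def)
    obtain \<tau> where face: "cone_face \<tau> \<xi>"
      and support: "\<And>m. m \<in> cone_monoid N' \<xi> \<Longrightarrow> \<gamma> m \<noteq> 0 \<longleftrightarrow> (\<forall>y\<in>\<tau>. m y = 0)"
      using affine_chart_support[OF rat[OF q(1)] q(2)] by blast
    have \<tau>: "\<tau> \<in> \<Xi>" using \<Xi> q(1) face unfolding fan_def by blast
    obtain A where A: "finite A" "\<tau> = convex_cone hull A"
      using rat[OF \<tau>] unfolding rational_cone_def by blast
    have cc: "convex_cone \<tau>" unfolding A(2) by (rule convex_cone_convex_cone_hull)
    define z where "z = \<Sum>A"
    have z: "z \<in> \<tau>"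
      unfolding z_def by (intro convex_cone_sum[OF cc A(1)]) (simp add: A(2) hull_inc)
    have interior: "\<exists>\<epsilon>>0. z - \<epsilon> *\<^sub>R y \<in> \<tau>" if "y \<in> \<tau>" for y
      using sum_generators_interior[OF A(1), of y] that unfolding A(2)[symmetric] z_def by blast
    have vanish: "(\<forall>y\<in>\<tau>. m y = 0) \<longleftrightarrow> m z = 0" if m: "m \<in> cone_monoid N' \<tau>" for m
    proof
      assume 0: "m z = 0"
      have d: "m \<in> dual_lattice N'" using m by (simp add: cone_monoid_def)
      show "\<forall>y\<in>\<tau>. m y = 0"
      proof
        fix y assume y: "y \<in> \<tau>"
        then obtain \<epsilon> where \<epsilon>: "0 < \<epsilon>" "z - \<epsilon> *\<^sub>R y \<in> \<tau>" using interior by blast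
        have "m (z - \<epsilon> *\<^sub>R y) = m z - \<epsilon> * m y"
          using linear_diff[OF dual_latticeD(1)[OF d]] dual_latticeD(3)[OF d] by simp
        then have "\<epsilon> * m y \<le> 0" using m \<epsilon>(2) 0 by (auto simp: cone_monoid_def)
        moreover have "0 \<le> m y" using m y by (auto simp: cone_monoid_def)
        ultimately show "m y = 0" using \<epsilon>(1) by (simp add: mult_le_0_iff)
      qed
    qed (use z in simp)
    obtain x where x: "U x = z" using surj by (metis surjD)
    obtain \<sigma> where \<sigma>: "\<sigma> \<in> \<Delta>" "x \<in> \<sigma>" using \<Delta> unfolding complete_fan_def by blast
    obtain \<xi>' where \<xi>': "\<xi>' \<in> \<Xi>" "U ` \<sigma> \<subseteq> \<xi>'" using fan_mapD(3)[OF \<Xi> U \<sigma>(1)] by blast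
    have faces: "cone_face (\<tau> \<inter> \<xi>') \<tau>" "cone_face (\<tau> \<inter> \<xi>') \<xi>'"
      using \<Xi> \<tau> \<xi>'(1) unfolding fan_def by blast+
    have "z \<in> \<tau> \<inter> \<xi>'" using z x \<sigma>(2) \<xi>'(2) by auto
    \<comment> \<open>Every \<open>y\<close> in \<open>\<tau>\<close> is, up to scaling, a summand
      of \<open>z\<close>, and \<open>\<tau> \<inter> \<xi>'\<close> is a face of
      \<open>\<tau>\<close> containing \<open>z\<close>.\<close>
    have "\<tau> \<subseteq> \<tau> \<inter> \<xi>'"
    proof
      fix y assume y: "y \<in> \<tau>"
      then obtain \<epsilon> where \<epsilon>: "0 < \<epsilon>" "z - \<epsilon> *\<^sub>R y \<in> \<tau>" using interior by blast
      have "\<epsilon> *\<^sub>R y + (z - \<epsilon> *\<^sub>R y) \<in> \<tau> \<inter> \<xi>'" using \<open>z \<in> \<tau> \<inter> \<xi>'\<close> by simp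
      moreover have "\<epsilon> *\<^sub>R y \<in> \<tau>" using \<epsilon>(1) y by (intro convex_cone_scaleR[OF cc]) auto
      ultimately have "\<epsilon> *\<^sub>R y \<in> \<tau> \<inter> \<xi>'"
        using faces(1) \<epsilon>(2) unfolding cone_face_def face_of_convex_cone_iff[OF cc] by blast
      then have "(1 / \<epsilon>) *\<^sub>R (\<epsilon> *\<^sub>R y) \<in> \<tau> \<inter> \<xi>'"
        using faces(1) \<epsilon>(1) unfolding cone_face_def face_of_convex_cone_iff[OF cc]
        by (intro convex_cone_scaleR[of "\<tau> \<inter> \<xi>'" "1 / \<epsilon>"]) auto
      moreover have "(1 / \<epsilon>) *\<^sub>R (\<epsilon> *\<^sub>R y) = y" using \<epsilon>(1) by simp
      ultimately show "y \<in> \<tau> \<inter> \<xi>'" by (simp only:)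
    qed
    then have face': "cone_face \<tau> \<xi>'" using faces(2) by (simp add: Int_absorb2)
    have mono: "cone_monoid N' \<xi> \<subseteq> cone_monoid N' \<tau>" "cone_monoid N' \<xi>' \<subseteq> cone_monoid N' \<tau>"
      using cone_monoid_antimono cone_face_subset face face' by blast+
    define S where "S = {m \<in> cone_monoid N' \<xi>. \<gamma> m \<noteq> 0}"
    have "(\<lambda>x. 0) \<in> S" using affine_chartD(1)[OF q(2)] by (simp add: S_def cone_monoid_zero)
    moreover have "S \<subseteq> dual_lattice N'" by (auto simp: S_def cone_monoid_def)
    moreover have "(\<lambda>x. m x + m' x) \<in> S \<and> \<gamma> (\<lambda>x. m x + m' x) = \<gamma> m * \<gamma> m'"
      if "m \<in> S" "m' \<in> S" for m m'
      using that affine_chartD(3)[OF q(2)] by (simp add: S_def cone_monoid_add)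
    moreover have "\<gamma> m \<noteq> 0" if "m \<in> S" for m using that by (simp add: S_def)
    ultimately have "\<exists>\<psi>. \<psi> (\<lambda>x. 0) = 1 \<and>
        (\<forall>m\<in>dual_lattice N. \<forall>m'\<in>dual_lattice N. \<psi> (\<lambda>x. m x + m' x) = \<psi> m * \<psi> m') \<and>
        (\<forall>m\<in>S. \<psi> (m \<circ> U) = \<gamma> m)"
      by (rule toric_point_lift[OF N lin surj])
    then obtain \<psi> where \<psi>: "\<psi> (\<lambda>x. 0) = 1"
      "\<And>m m'. m \<in> dual_lattice N \<Longrightarrow> m' \<in> dual_lattice N \<Longrightarrow> \<psi> (\<lambda>x. m x + m' x) = \<psi> m * \<psi> m'"
      "\<And>m. m \<in> S \<Longrightarrow> \<psi> (m \<circ> U) = \<gamma> m"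
      by blast
    \<comment> \<open>The lifted point; \<open>\<beta>\<close> is the given point seen in the chart
      of \<open>\<tau>\<close>. The value zero off \<open>m x = 0\<close> places
      \<open>\<alpha>\<close> in the orbit of the face of \<open>\<sigma>\<close> with
      \<open>x\<close> in its relative interior. Since \<open>U x = z\<close>, the two supports
      correspond under composition with \<open>U\<close>.\<close>
    define \<alpha> where "\<alpha> = restrict (\<lambda>m. if m x = 0 then \<psi> m else 0) (cone_monoid N \<sigma>)"
    define \<beta> where "\<beta> = restrict (\<lambda>m. if m z = 0 then \<psi> (m \<circ> U) else 0) (cone_monoid N' \<tau>)"
    have \<alpha>: "\<alpha> \<in> affine_chart N \<sigma>"
      unfolding \<alpha>_def
    proof (rule affine_chartI)
      fix m m' assume m: "m \<in> cone_monoid N \<sigma>" "m' \<in> cone_monoid N \<sigma>"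
      have "0 \<le> m x" "0 \<le> m' x" using m \<sigma>(2) by (auto simp: cone_monoid_def)
      then have "m x + m' x = 0 \<longleftrightarrow> m x = 0 \<and> m' x = 0" by linarith
      moreover have "\<psi> (\<lambda>x. m x + m' x) = \<psi> m * \<psi> m'"
        using m by (intro \<psi>(2)) (auto simp: cone_monoid_def)
      ultimately show "(if m x + m' x = 0 then \<psi> (\<lambda>x. m x + m' x) else 0) =
          (if m x = 0 then \<psi> m else 0) * (if m' x = 0 then \<psi> m' else 0)" by simp
    qed (simp add: \<psi>(1))
    have \<beta>: "\<beta> \<in> affine_chart N' \<tau>"
      unfolding \<beta>_def
    proof (rule affine_chartI)
      fix m m' assume m: "m \<in> cone_monoid N' \<tau>" "m' \<in> cone_monoid N' \<tau>"
      have "0 \<le> m z" "0 \<le> m' z" using m z by (auto simp: cone_monoid_def)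
      then have "m z + m' z = 0 \<longleftrightarrow> m z = 0 \<and> m' z = 0" by linarith
      moreover have "\<psi> ((\<lambda>x. m x + m' x) \<circ> U) = \<psi> (m \<circ> U) * \<psi> (m' \<circ> U)"
      proof -
        have "m \<circ> U \<in> dual_lattice N" "m' \<circ> U \<in> dual_lattice N"
          using m dual_lattice_comp[OF _ lin] by (auto simp: cone_monoid_def)
        from \<psi>(2)[OF this] show ?thesis by (simp add: o_def)
      qed
      ultimately show "(if m z + m' z = 0 then \<psi> ((\<lambda>x. m x + m' x) \<circ> U) else 0) =
          (if m z = 0 then \<psi> (m \<circ> U) else 0) * (if m' z = 0 then \<psi> (m' \<circ> U) else 0)" by simp
    qed (simp add: \<psi>(1) o_def)
    have "chart_map N' U \<xi>' \<alpha> = restrict \<beta> (cone_monoid N' \<xi>')"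
      unfolding chart_map_def
    proof (rule restrict_ext)
      fix m assume m: "m \<in> cone_monoid N' \<xi>'"
      then have "m \<circ> U \<in> cone_monoid N \<sigma>" using comp_cone_monoid[OF \<Xi> U \<xi>'(2)] by blast
      then show "\<alpha> (m \<circ> U) = \<beta> m" using m mono(2) x by (auto simp: \<alpha>_def \<beta>_def)
    qed
    then have "((\<tau>, \<beta>), (\<xi>', chart_map N' U \<xi>' \<alpha>)) \<in> glue N' \<Xi>"
      using glue_face[OF \<tau> \<xi>'(1) face' \<beta>] by simp
    moreover have "restrict \<beta> (cone_monoid N' \<xi>) = \<gamma>"
    proof (rule extensionalityI[OF restrict_extensional affine_chartD(2)[OF q(2)]])
      fix m assume m: "m \<in> cone_monoid N' \<xi>"
      then have "\<beta> m = (if m z = 0 then \<psi> (m \<circ> U) else 0)" using mono(1) by (auto simp: \<beta>_def)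
      moreover have "m z = 0 \<longleftrightarrow> m \<in> S"
        using vanish[of m] support[OF m] mono(1) m by (auto simp: S_def)
      ultimately show "restrict \<beta> (cone_monoid N' \<xi>) m = \<gamma> m"
        using m \<psi>(3)[of m] by (auto simp: S_def)
    qed
    then have "((\<tau>, \<beta>), (\<xi>, \<gamma>)) \<in> glue N' \<Xi>"
      using glue_face[OF \<tau> q(1) face \<beta>] by simp
    ultimately have "((\<xi>', chart_map N' U \<xi>' \<alpha>), (\<xi>, \<gamma>)) \<in> glue N' \<Xi>"
      using glue_sym glue_trans by blast
    then have "toric_morphism N \<Delta> N' \<Xi> U (glue N \<Delta> `` {(\<sigma>, \<alpha>)}) = Q"
      unfolding q(3) cls[OF \<sigma>(1) \<alpha> \<xi>'] by (rule glue_Image_eq)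
    moreover have "glue N \<Delta> `` {(\<sigma>, \<alpha>)} \<in> ?X"
      unfolding toric_variety_def using \<sigma>(1) \<alpha> by (intro quotientI SigmaI)
    ultimately show ?thesis by blast
  qed
  ultimately have "toric_morphism N \<Delta> N' \<Xi> U ` ?X = ?Y"
    by (intro equalityI subsetI) (blast, metis image_eqI)
  then show ?thesis
    unfolding surjective_toric_morphism_def using U by blast
qed

section \<open>The fan of a monotone family of subspaces\<close>

lemma finite_cone_faces:
  fixes A :: "'a::real_vector set"
  assumes "finite A"
  shows "finite {\<tau>. cone_face \<tau> (convex_cone hull A)}"
proof (rule finite_subset)
  show "{\<tau>. cone_face \<tau> (convex_cone hull A)} \<subseteq> (\<lambda>B. convex_cone hull B) ` Pow A"
  proof
    fix \<tau> assume "\<tau> \<in> {\<tau>. cone_face \<tau> (convex_cone hull A)}"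
    then have "\<tau> = convex_cone hull (A \<inter> \<tau>)"
      using face_of_convex_cone_hull[OF assms] by (simp add: cone_face_def)
    then show "\<tau> \<in> (\<lambda>B. convex_cone hull B) ` Pow A" by blast
  qed
qed (use assms in simp)

lemma rational_cone_convex_cone: "rational_cone N \<sigma> \<Longrightarrow> convex_cone \<sigma>"
  by (auto simp: rational_cone_def convex_cone_convex_cone_hull)

lemma rational_cone_face:
  assumes "rational_cone N \<sigma>" "cone_face \<tau> \<sigma>"
  shows "rational_cone N \<tau>"
proof -
  obtain A where A: "finite A" "A \<subseteq> N" "\<sigma> = convex_cone hull A"
    using assms(1) unfolding rational_cone_def by blast
  have "\<tau> = convex_cone hull (A \<inter> \<tau>)"
    using face_of_convex_cone_hull[OF A(1)] assms(2) by (simp add: cone_face_def A(3))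
  then show ?thesis
    unfolding rational_cone_def using A by (intro exI[of _ "A \<inter> \<tau>"]) auto
qed

text \<open>Faces of two cones that meet in a common face meet in a common face themselves, by
  \<open>face_of_Int_subface\<close>. The case \<open>\<sigma> = \<sigma>'\<close> of the hypothesis
  on intersections makes each cone a face of itself.\<close>

lemma fan_of_maximal_cones:
  fixes F :: "'n::real_vector set set"
  assumes F: "finite F" "F \<noteq> {}" "\<And>\<sigma>. \<sigma> \<in> F \<Longrightarrow> rational_cone N \<sigma>"
    and face: "\<And>\<sigma> \<sigma>'. \<sigma> \<in> F \<Longrightarrow> \<sigma>' \<in> F \<Longrightarrow> cone_face (\<sigma> \<inter> \<sigma>') \<sigma>"
  shows "fan N {\<tau>. \<exists>\<sigma>\<in>F. cone_face \<tau> \<sigma>}"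
  unfolding fan_def
proof (intro conjI ballI allI impI)
  have "{\<tau>. \<exists>\<sigma>\<in>F. cone_face \<tau> \<sigma>} = (\<Union>\<sigma>\<in>F. {\<tau>. cone_face \<tau> \<sigma>})" by blast
  moreover have "finite {\<tau>. cone_face \<tau> \<sigma>}" if "\<sigma> \<in> F" for \<sigma>
    using F(3)[OF that] finite_cone_faces unfolding rational_cone_def by auto
  ultimately show "finite {\<tau>. \<exists>\<sigma>\<in>F. cone_face \<tau> \<sigma>}" using F(1) by simp
  obtain \<sigma> where \<sigma>: "\<sigma> \<in> F" using F(2) by blast
  have "cone_face \<sigma> \<sigma>" using face[OF \<sigma> \<sigma>] by simp
  then show "{\<tau>. \<exists>\<sigma>\<in>F. cone_face \<tau> \<sigma>} \<noteq> {}" using \<sigma> by blast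
next
  fix \<tau> assume "\<tau> \<in> {\<tau>. \<exists>\<sigma>\<in>F. cone_face \<tau> \<sigma>}"
  then show "rational_cone N \<tau>" using F(3) rational_cone_face by blast
next
  fix \<tau> \<rho> assume "\<tau> \<in> {\<tau>. \<exists>\<sigma>\<in>F. cone_face \<tau> \<sigma>}" "cone_face \<rho> \<tau>"
  then show "\<rho> \<in> {\<tau>. \<exists>\<sigma>\<in>F. cone_face \<tau> \<sigma>}" unfolding cone_face_def using face_of_trans by blast
next
  fix \<tau> \<tau>' assume "\<tau> \<in> {\<tau>. \<exists>\<sigma>\<in>F. cone_face \<tau> \<sigma>}" "\<tau>' \<in> {\<tau>. \<exists>\<sigma>\<in>F. cone_face \<tau> \<sigma>}"
  then obtain \<sigma> \<sigma>' where \<sigma>: "\<sigma> \<in> F" "cone_face \<tau> \<sigma>" "\<sigma>' \<in> F" "cone_face \<tau>' \<sigma>'" by blast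
  have "(\<sigma> \<inter> \<sigma>') face_of \<sigma>" "(\<sigma> \<inter> \<sigma>') face_of \<sigma>'"
    using face[OF \<sigma>(1,3)] face[OF \<sigma>(3,1)] by (simp_all add: cone_face_def Int_commute)
  then have "(\<tau> \<inter> \<tau>') face_of \<tau> \<and> (\<tau> \<inter> \<tau>') face_of \<tau>'"
    using \<sigma> unfolding cone_face_def by (intro face_of_Int_subface) auto
  moreover have "0 \<in> \<tau> \<inter> \<tau>'"
    using rational_cone_convex_cone[OF rational_cone_face[OF F(3)]] \<sigma> convex_cone_contains_0 by blast
  ultimately show "cone_face (\<tau> \<inter> \<tau>') \<tau>" "cone_face (\<tau> \<inter> \<tau>') \<tau>'"
    unfolding cone_face_def by blast+
qed

section \<open>The quotient by the all-ones vector and its cones\<close>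

lemma linear_coord_diff: "linear (coord_diff i j)"
  by (rule linearI; transfer; simp add: algebra_simps)

lemma coord_diff_abs: "coord_diff i j (abs_quot_ones v) = v $ i - v $ j"
  by (rule coord_diff.abs_eq)

lemma linear_abs_quot_ones: "linear (abs_quot_ones :: real ^ 'r \<Rightarrow> 'r::finite quot_ones)"
  by (rule linearI) (simp_all add: plus_quot_ones.abs_eq scaleR_quot_ones.abs_eq)

lemma abs_quot_ones_eq_iff: "abs_quot_ones v = abs_quot_ones w \<longleftrightarrow> (\<exists>c. v - w = c *\<^sub>R 1)"
  by (rule quot_ones.abs_eq_iff)

lemma quot_ones_cases: obtains v where "y = abs_quot_ones v"
  by (rule that[OF Quotient_abs_rep[OF Quotient_quot_ones, symmetric]])

context subspace_assignment begin

text \<open>The image of \<open>level_cone \<L>\<close> in the quotient, described without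
  representatives. Level cones are invariant under adding constants, so the condition is the same
  for all \<open>j\<close>.\<close>

definition quot_cone :: "'r set set \<Rightarrow> 'r quot_ones set" where
  "quot_cone \<L> = {y. \<forall>j. (\<lambda>i. coord_diff i j y) \<in> level_cone \<L>}"

lemma abs_in_quot_cone: "abs_quot_ones v \<in> quot_cone \<L> \<longleftrightarrow> (\<lambda>i. v $ i) \<in> level_cone \<L>"
proof
  assume "abs_quot_ones v \<in> quot_cone \<L>"
  then have "(\<lambda>i. v $ i - v $ undefined) \<in> level_cone \<L>" by (simp add: quot_cone_def coord_diff_abs)
  from level_cone_shift[OF this, of "v $ undefined"] show "(\<lambda>i. v $ i) \<in> level_cone \<L>" by simp
next
  assume v: "(\<lambda>i. v $ i) \<in> level_cone \<L>"
  have "(\<lambda>i. v $ i - v $ j) \<in> level_cone \<L>" for j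
    using level_cone_shift[OF v, of "- (v $ j)"] by simp
  then show "abs_quot_ones v \<in> quot_cone \<L>" by (simp add: quot_cone_def coord_diff_abs)
qed

lemma convex_cone_quot_cone:
  assumes "homlattice \<L>"
  shows "convex_cone (quot_cone \<L>)"
  unfolding convex_cone_iff quot_cone_def
  using level_cone_add[OF assms] level_cone_scale[OF assms] level_cone_const[OF assms, of 0]
  by (simp add: linear_add[OF linear_coord_diff] linear_scale[OF linear_coord_diff]
      linear_0[OF linear_coord_diff])

definition indicator_class :: "'r set \<Rightarrow> 'r quot_ones" where
  "indicator_class J = abs_quot_ones (\<chi> i. if i \<in> J then 1 else 0)"

text \<open>Subtracting a multiple of the indicator of \<open>J\<close>, the set where the largest
  value \<open>M\<close> is attained, lowers \<open>M\<close> to the second largest value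
  \<open>M'\<close>. One value disappears and no new level set arises. A vector with a single value
  is zero in the quotient.\<close>

lemma abs_in_indicator_hull:
  assumes "(\<lambda>i. v $ i) \<in> level_cone \<L>"
  shows "abs_quot_ones v \<in> convex_cone hull (indicator_class ` \<L>)"
  using assms
proof (induction "card (range (\<lambda>i. v $ i))" arbitrary: v rule: less_induct)
  case less
  define M where "M = Max (range (\<lambda>i. v $ i))"
  have M_le: "v $ i \<le> M" for i unfolding M_def by (intro Max_ge) auto
  have M_in: "M \<in> range (\<lambda>i. v $ i)" unfolding M_def by (intro Max_in) auto
  define J where "J = upper_level (\<lambda>i. v $ i) M"
  have J: "i \<in> J \<longleftrightarrow> v $ i = M" for i using M_le[of i] by (auto simp: J_def upper_level_def)
  have JL: "J \<in> \<L>" using level_coneD[OF less.prems] by (simp add: J_def)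
  show ?case
  proof (cases "J = UNIV")
    case True
    then have "v - 0 = M *\<^sub>R 1" using J by (auto simp: vec_eq_iff)
    then have "abs_quot_ones v = abs_quot_ones 0" unfolding abs_quot_ones_eq_iff by blast
    then show ?thesis
      using linear_0[OF linear_abs_quot_ones] convex_cone_hull_contains_0 by metis
  next
    case False
    define M' where "M' = Max ((\<lambda>i. v $ i) ` (- J))"
    have M'_le: "v $ i \<le> M'" if "i \<notin> J" for i unfolding M'_def using that by (intro Max_ge) auto
    have "M' \<in> (\<lambda>i. v $ i) ` (- J)" unfolding M'_def using False by (intro Max_in) auto
    then obtain k where k: "k \<notin> J" "v $ k = M'" by auto
    have "M' < M" using k J[of k] M_le[of k] by auto
    define w where "w = v - (M - M') *\<^sub>R (\<chi> i. if i \<in> J then 1 else 0)"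
    have w: "w $ i = (if i \<in> J then M' else v $ i)" for i
      using J[of i] by (simp add: w_def)
    have "M \<notin> range (\<lambda>i. w $ i)" "range (\<lambda>i. w $ i) \<subseteq> range (\<lambda>i. v $ i)"
      using \<open>M' < M\<close> k J by (auto simp: w)
    then have "card (range (\<lambda>i. w $ i)) < card (range (\<lambda>i. v $ i))"
      using M_in by (intro psubset_card_mono) auto
    moreover have "(\<lambda>i. w $ i) \<in> level_cone \<L>"
      unfolding level_cone_def
    proof (intro CollectI allI)
      fix t
      show "upper_level (\<lambda>i. w $ i) t \<in> \<L>"
      proof (cases "t \<le> M'")
        case True
        then have "upper_level (\<lambda>i. w $ i) t = upper_level (\<lambda>i. v $ i) t"
          using \<open>M' < M\<close> J by (auto simp: upper_level_def w)
        then show ?thesis using level_coneD[OF less.prems] by simp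
      next
        case False
        have "w $ i \<le> M'" for i using M'_le[of i] by (simp add: w)
        then have "w $ i < t" for i using False by (meson le_less_trans not_le)
        moreover have "v $ i < M + 1" for i using M_le[of i] by simp
        \<comment> \<open>Above all values the level set is empty; it belongs to \<open>\<L>\<close>
          because it is the level set of \<open>v\<close> at \<open>M + 1\<close>.\<close>
        ultimately have "upper_level (\<lambda>i. w $ i) t = upper_level (\<lambda>i. v $ i) (M + 1)"
          by (auto simp: upper_level_def simp flip: not_less)
        then show ?thesis using level_coneD[OF less.prems] by simp
      qed
    qed
    ultimately have "abs_quot_ones w \<in> convex_cone hull (indicator_class ` \<L>)"
      by (rule less.hyps)
    moreover have "(M - M') *\<^sub>R indicator_class J \<in> convex_cone hull (indicator_class ` \<L>)"
      using \<open>M' < M\<close> JL by (intro convex_cone_hull_mul hull_inc) auto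
    moreover have "abs_quot_ones v = abs_quot_ones w + (M - M') *\<^sub>R indicator_class J"
      unfolding indicator_class_def w_def
      by (simp flip: linear_scale[OF linear_abs_quot_ones] linear_add[OF linear_abs_quot_ones])
    ultimately show ?thesis using convex_cone_hull_add by simp
  qed
qed

lemma quot_cone_hull:
  assumes "homlattice \<L>"
  shows "quot_cone \<L> = convex_cone hull (indicator_class ` \<L>)"
proof
  show "quot_cone \<L> \<subseteq> convex_cone hull (indicator_class ` \<L>)"
  proof
    fix y assume y: "y \<in> quot_cone \<L>"
    obtain v where "y = abs_quot_ones v" by (rule quot_ones_cases)
    then show "y \<in> convex_cone hull (indicator_class ` \<L>)"
      using y abs_in_quot_cone abs_in_indicator_hull by metis
  qed
  show "convex_cone hull (indicator_class ` \<L>) \<subseteq> quot_cone \<L>"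
  proof (intro hull_minimal convex_cone_quot_cone assms)
    show "indicator_class ` \<L> \<subseteq> quot_cone \<L>"
      using level_cone_indicator[OF assms] by (auto simp: indicator_class_def abs_in_quot_cone)
  qed
qed

lemma rational_cone_quot_cone:
  assumes "homlattice \<L>"
  shows "rational_cone quot_ones_lattice (quot_cone \<L>)"
proof -
  have "indicator_class J \<in> quot_ones_lattice" for J
    by (auto simp: indicator_class_def quot_ones_lattice_def)
  then show ?thesis
    unfolding rational_cone_def quot_cone_hull[OF assms]
    by (intro exI[of _ "indicator_class ` \<L>"]) auto
qed

definition chamber :: "'r list \<Rightarrow> 'r quot_ones set" where
  "chamber ys = quot_cone (compatible ys)"

lemma summand_in_chamber:
  assumes "homlattice \<L>" "a \<in> quot_cone \<L>" "b \<in> quot_cone \<L>" "enumerates ys" "a + b \<in> chamber ys"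
  shows "a \<in> chamber ys"
proof -
  have "(\<lambda>i. coord_diff i j a) \<in> level_cone (compatible ys)" for j
  proof (rule summand_in_level_cone[OF assms(1) _ _ assms(4)])
    show "(\<lambda>i. coord_diff i j a) \<in> level_cone \<L>" "(\<lambda>i. coord_diff i j b) \<in> level_cone \<L>"
      using assms(2,3) by (simp_all add: quot_cone_def)
    show "(\<lambda>i. coord_diff i j a + coord_diff i j b) \<in> level_cone (compatible ys)"
      using assms(5) by (simp add: chamber_def quot_cone_def linear_add[OF linear_coord_diff])
  qed
  then show ?thesis by (simp add: chamber_def quot_cone_def)
qed

definition bundle_fan :: "'r quot_ones set set" where
  "bundle_fan = {\<tau>. \<exists>\<sigma>\<in>chamber ` {ys. enumerates ys}. cone_face \<tau> \<sigma>}"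

lemma convex_cone_chamber: "enumerates ys \<Longrightarrow> convex_cone (chamber ys)"
  unfolding chamber_def by (intro convex_cone_quot_cone homlattice_compatible)

lemma chamber_in_bundle_fan: "enumerates ys \<Longrightarrow> chamber ys \<in> bundle_fan"
  using convex_cone_chamber[of ys]
  by (auto simp: bundle_fan_def cone_face_def face_of_refl_eq convex_cone_def)

lemma sorted_in_chamber:
  assumes "enumerates ys" "sorted_wrt (\<lambda>i j. v $ j \<le> v $ i) ys"
  shows "abs_quot_ones v \<in> chamber ys"
  unfolding chamber_def abs_in_quot_cone using assms by (rule sorted_in_level_cone)

text \<open>The lattice of the first flag takes the role of \<open>\<L>\<close> in
  \<open>summand_in_chamber\<close>, so the intersection of two chambers is closed under summands
  from the first, which is the additive face criterion.\<close>

lemma fan_bundle_fan: "fan quot_ones_lattice bundle_fan"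
  unfolding bundle_fan_def
proof (rule fan_of_maximal_cones)
  have "finite {ys :: 'r list. set ys \<subseteq> UNIV \<and> distinct ys}" by (rule finite_subset_distinct) simp
  then have "finite {ys :: 'r list. enumerates ys}"
    by (rule finite_subset[rotated]) (auto simp: enumerates_def)
  then show "finite (chamber ` {ys. enumerates ys})" by simp
  show "chamber ` {ys. enumerates ys} \<noteq> {}"
    using sorted_enumeration[of "\<lambda>_. 0"] by blast
  show "rational_cone quot_ones_lattice \<sigma>" if "\<sigma> \<in> chamber ` {ys. enumerates ys}" for \<sigma>
    using that rational_cone_quot_cone homlattice_compatible by (auto simp: chamber_def)
next
  fix \<sigma> \<sigma>' assume "\<sigma> \<in> chamber ` {ys. enumerates ys}" "\<sigma>' \<in> chamber ` {ys. enumerates ys}"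
  then obtain xs ys where xy: "enumerates xs" "\<sigma> = chamber xs" "enumerates ys" "\<sigma>' = chamber ys"
    by blast
  have "convex_cone (\<sigma> \<inter> \<sigma>')"
    using convex_cone_chamber[OF xy(1)] convex_cone_chamber[OF xy(3)]
    by (simp add: convex_cone_iff xy)
  moreover have "a \<in> \<sigma> \<inter> \<sigma>'" if "a \<in> \<sigma>" "b \<in> \<sigma>" "a + b \<in> \<sigma> \<inter> \<sigma>'" for a b
    using that summand_in_chamber[OF homlattice_compatible[OF xy(1)] _ _ xy(3)]
    by (auto simp: xy chamber_def)
  ultimately show "cone_face (\<sigma> \<inter> \<sigma>') \<sigma>"
    unfolding cone_face_def using face_of_convex_cone_iff[of \<sigma> "\<sigma> \<inter> \<sigma>'"] convex_cone_chamber[OF xy(1)]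
    by (auto simp: xy(2))
qed

lemma complete_bundle_fan: "complete_fan quot_ones_lattice bundle_fan"
  unfolding complete_fan_def
proof (intro conjI fan_bundle_fan UNIV_eq_I[symmetric])
  fix y :: "'r quot_ones"
  obtain v where y: "y = abs_quot_ones v" by (rule quot_ones_cases)
  obtain ys where "enumerates ys" "sorted_wrt (\<lambda>i j. v $ j \<le> v $ i) ys"
    by (rule sorted_enumeration)
  then show "y \<in> \<Union>bundle_fan"
    using sorted_in_chamber chamber_in_bundle_fan y by blast
qed

text \<open>Points of a permutohedral cone satisfy all weak inequalities between coordinates that
  hold at its defining point, so one sorted list serves for the whole cone.\<close>

lemma bundle_fan_coarsens: "coarsens bundle_fan permutohedral_fan"
  unfolding coarsens_def
proof
  fix \<sigma> :: "'r quot_ones set" assume "\<sigma> \<in> permutohedral_fan"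
  then obtain x where \<sigma>: "\<sigma> = {y. \<forall>i j. 0 \<le> coord_diff i j x \<longrightarrow> 0 \<le> coord_diff i j y}"
    unfolding permutohedral_fan_def by blast
  obtain v where x: "x = abs_quot_ones v" by (rule quot_ones_cases)
  obtain ys where ys: "enumerates ys" "sorted_wrt (\<lambda>i j. v $ j \<le> v $ i) ys"
    by (rule sorted_enumeration)
  have "\<sigma> \<subseteq> chamber ys"
  proof
    fix y assume y: "y \<in> \<sigma>"
    obtain w where w: "y = abs_quot_ones w" by (rule quot_ones_cases)
    have "sorted_wrt (\<lambda>i j. w $ j \<le> w $ i) ys"
      by (rule sorted_wrt_mono_rel[OF _ ys(2)]) (use y in \<open>simp add: \<sigma> x w coord_diff_abs\<close>)
    then show "y \<in> chamber ys" unfolding w by (rule sorted_in_chamber[OF ys(1)])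
  qed
  then show "\<exists>\<xi>\<in>bundle_fan. \<sigma> \<subseteq> \<xi>" using chamber_in_bundle_fan[OF ys(1)] by blast
qed

text \<open>The image of the interior point \<open>\<Sum>A\<close> lies in some chamber, and every
  other image point is, up to scaling, a summand of it within \<open>quot_cone \<L>\<close>. As
  \<open>\<L>\<close> may come from a frame rather than a flag, the summand statement has to allow
  an arbitrary \<open>homlattice\<close>.\<close>

lemma linear_image_in_chamber:
  fixes U :: "'n::real_vector \<Rightarrow> 'r quot_ones"
  assumes hl: "homlattice \<L>" and \<sigma>: "rational_cone N \<sigma>" and U: "linear U" "U ` \<sigma> \<subseteq> quot_cone \<L>"
  shows "\<exists>ys. enumerates ys \<and> U ` \<sigma> \<subseteq> chamber ys"
proof -
  obtain A where A: "finite A" "\<sigma> = convex_cone hull A" using \<sigma> unfolding rational_cone_def by blast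
  have cc: "convex_cone \<sigma>" by (rule rational_cone_convex_cone[OF \<sigma>])
  obtain v where v: "U (\<Sum>A) = abs_quot_ones v" by (rule quot_ones_cases)
  obtain ys where ys: "enumerates ys" "sorted_wrt (\<lambda>i j. v $ j \<le> v $ i) ys"
    by (rule sorted_enumeration)
  have "U x \<in> chamber ys" if x: "x \<in> \<sigma>" for x
  proof -
    obtain \<epsilon> where \<epsilon>: "0 < \<epsilon>" "\<Sum>A - \<epsilon> *\<^sub>R x \<in> \<sigma>"
      using sum_generators_interior[OF A(1), of x] x unfolding A(2)[symmetric] by blast
    have "\<epsilon> *\<^sub>R x \<in> \<sigma>" using \<epsilon>(1) x by (intro convex_cone_scaleR[OF cc]) auto
    then have "U (\<epsilon> *\<^sub>R x) \<in> quot_cone \<L>" "U (\<Sum>A - \<epsilon> *\<^sub>R x) \<in> quot_cone \<L>" using \<epsilon>(2) U(2) by auto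
    moreover have "U (\<epsilon> *\<^sub>R x) + U (\<Sum>A - \<epsilon> *\<^sub>R x) = abs_quot_ones v"
      by (simp add: linear_add[OF U(1), symmetric] v)
    then have "U (\<epsilon> *\<^sub>R x) + U (\<Sum>A - \<epsilon> *\<^sub>R x) \<in> chamber ys"
      using sorted_in_chamber[OF ys] by simp
    ultimately have "U (\<epsilon> *\<^sub>R x) \<in> chamber ys" by (rule summand_in_chamber[OF hl _ _ ys(1)])
    then have "(1 / \<epsilon>) *\<^sub>R U (\<epsilon> *\<^sub>R x) \<in> chamber ys"
      using \<epsilon>(1) by (intro convex_cone_scaleR[OF convex_cone_chamber[OF ys(1)]]) auto
    then show ?thesis using \<epsilon>(1) by (simp add: linear_scale[OF U(1)])
  qed
  then show ?thesis using ys(1) by blast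
qed

text \<open>Coordinate subspaces of a basis intersect and add like their index sets, as the
  coefficients show. The index sets on which \<open>V\<close> agrees with them inherit this, which
  supplies a lattice for each cone of \<open>\<Delta>\<close>.\<close>

lemma homlattice_basis:
  assumes b: "inj b" "independent (range b)" "span (range b) = UNIV"
  shows "homlattice {I. V I = span (b ` I)}"
proof -
  have dim_b: "dim (span (b ` I)) = card I" for I
    using independent_mono[OF b(2), of "b ` I"] b(1)
    by (simp add: dim_eq_card_independent card_image inj_on_subset[OF _ subset_UNIV] image_mono)
  have coeff: "e \<in> span (b ` I) \<longleftrightarrow> (\<forall>i. i \<notin> I \<longrightarrow> representation (range b) e (b i) = 0)" for e I
  proof
    assume e: "e \<in> span (b ` I)"
    have "representation (range b) e = representation (b ` I) e"
      using b(2) e by (intro representation_extend) auto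
    then show "\<forall>i. i \<notin> I \<longrightarrow> representation (range b) e (b i) = 0"
      using representation_ne_zero[of "b ` I" e] b(1) by (metis imageE inj_eq)
  next
    assume z: "\<forall>i. i \<notin> I \<longrightarrow> representation (range b) e (b i) = 0"
    have "e = (\<Sum>v\<in>range b. scl (representation (range b) e v) v)"
      using b(2,3) by (intro sum_representation_eq[symmetric]) auto
    also have "\<dots> \<in> span (b ` I)"
    proof (rule span_sum)
      fix v assume "v \<in> range b"
      then obtain i where i: "v = b i" by blast
      show "scl (representation (range b) e v) v \<in> span (b ` I)"
      proof (cases "i \<in> I")
        case True
        then show ?thesis unfolding i by (intro span_scale span_base) auto
      next
        case False
        then show ?thesis using z i span_zero by simp
      qed
    qed
    finally show "e \<in> span (b ` I)" .
  qed
  have Int: "span (b ` I) \<inter> span (b ` J) \<subseteq> span (b ` (I \<inter> J))" for I J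
    using coeff by blast
  show ?thesis
    unfolding homlattice_def
  proof (intro conjI ballI)
    show "{} \<in> {I. V I = span (b ` I)}"
      using subspace_dim_equal[OF subspace_span subspace_V, of "b ` {}" "{}"] subspace_0[OF subspace_V]
      by (simp add: dim_V)
    show "UNIV \<in> {I. V I = span (b ` I)}"
      using eq_V[OF subspace_span, of UNIV "range b"] dim_b[of UNIV] b(3) by simp
  next
    fix I J assume IJ: "I \<in> {I. V I = span (b ` I)}" "J \<in> {I. V I = span (b ` I)}"
    have "V (I \<inter> J) \<subseteq> span (b ` (I \<inter> J))"
      using IJ Int[of I J] mono_V[of "I \<inter> J" I] mono_V[of "I \<inter> J" J] by auto
    then have eq: "span (b ` (I \<inter> J)) = V (I \<inter> J)"
      by (intro eq_V subspace_span) (simp_all add: dim_b[unfolded dim_span])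
    then show "I \<inter> J \<in> {I. V I = span (b ` I)}" by simp
    show "meets I J" using IJ Int[of I J] eq by (simp add: meets_def)
    have "b ` I \<subseteq> V (I \<union> J)" "b ` J \<subseteq> V (I \<union> J)"
      using IJ mono_V[of I "I \<union> J"] mono_V[of J "I \<union> J"] span_superset[of "b ` I"] span_superset[of "b ` J"]
      by auto
    then have "span (b ` (I \<union> J)) \<subseteq> V (I \<union> J)"
      by (intro span_minimal subspace_V) auto
    then have "span (b ` (I \<union> J)) = V (I \<union> J)"
      by (intro subspace_dim_equal subspace_span subspace_V) (simp_all add: dim_V dim_b[unfolded dim_span])
    then show "I \<union> J \<in> {I. V I = span (b ` I)}" by simp
  qed
qed

end

section \<open>Frames and adapted valuations\<close>

context vector_space begin

lemma frame_line_generators: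
  assumes F: "frame scale F" and L: "bij_betw L UNIV F"
  obtains b where "\<And>i. b i \<noteq> 0" "\<And>i. L i = span {b i}"
proof -
  have "\<exists>v. v \<noteq> 0 \<and> L i = span {v}" for i
  proof -
    have "L i \<in> F" using L by (auto simp: bij_betw_def)
    then have Li: "subspace (L i)" "dim (L i) = 1" using F by (auto simp: frame_def)
    obtain B where B: "B \<subseteq> L i" "independent B" "L i \<subseteq> span B" "card B = dim (L i)"
      by (rule basis_exists)
    obtain v where v: "B = {v}" using B(4) Li(2) card_1_singletonE by auto
    have "L i = span {v}" using B(1,3) span_minimal[OF B(1) Li(1)] unfolding v by blast
    moreover have "v \<noteq> 0" using B(2) dependent_zero unfolding v by blast
    ultimately show ?thesis by blast
  qed
  then show thesis using that by metis
qed

text \<open>Translates valuations into filtrations: the value is at least \<open>t\<close> exactly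
  when all components on lines of smaller weight vanish. For a vector in the span the decomposition
  is written down and identified by uniqueness.\<close>

lemma adapted_valuation_ge_iff:
  fixes L :: "'r::finite \<Rightarrow> 'b set"
  assumes F: "frame scale F" and L: "bij_betw L UNIV F"
    and b: "\<And>i. b i \<noteq> 0" "\<And>i. L i = span {b i}"
  shows "ereal t \<le> adapted_valuation F a e \<longleftrightarrow> e \<in> span (b ` {i. t \<le> a (L i)})"
proof -
  define d where "d = (THE d. decomposes F e d)"
  have ex1: "\<exists>!d. decomposes F e d" using F by (simp add: frame_def)
  have d: "decomposes F e d" unfolding d_def by (rule theI'[OF ex1])
  have F_eq: "F = range L" and inj: "inj L" using L by (auto simp: bij_betw_def)
  define I where "I = {i. t \<le> a (L i)}"
  have "{ereal (a M) | M. M \<in> F \<and> d M \<noteq> 0} = (\<lambda>i. ereal (a (L i))) ` {i. d (L i) \<noteq> 0}"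
    by (auto simp: F_eq)
  then have "ereal t \<le> adapted_valuation F a e \<longleftrightarrow> (\<forall>i. d (L i) \<noteq> 0 \<longrightarrow> i \<in> I)"
    unfolding adapted_valuation_def d_def[symmetric] by (simp add: le_INF_iff I_def)
  also have "\<dots> \<longleftrightarrow> e \<in> span (b ` I)"
  proof
    assume H: "\<forall>i. d (L i) \<noteq> 0 \<longrightarrow> i \<in> I"
    have "e = (\<Sum>M\<in>F. d M)" using d by (simp add: decomposes_def)
    also have "\<dots> = (\<Sum>i\<in>UNIV. d (L i))" by (rule sum.reindex_bij_betw[OF L, symmetric])
    also have "\<dots> \<in> span (b ` I)"
    proof (rule span_sum)
      fix i
      show "d (L i) \<in> span (b ` I)"
      proof (cases "d (L i) = 0")
        case True
        then show ?thesis using span_zero by simp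
      next
        case False
        then have "i \<in> I" using H by blast
        moreover have "d (L i) \<in> span {b i}" using d b(2) by (auto simp: decomposes_def F_eq)
        ultimately show ?thesis using span_mono[of "{b i}" "b ` I"] by blast
      qed
    qed
    finally show "e \<in> span (b ` I)" .
  next
    assume e: "e \<in> span (b ` I)"
    have injb: "inj b" using inj b(2) by (metis injD injI)
    obtain u where u: "e = (\<Sum>v\<in>b ` I. u v *s v)"
      using e unfolding span_finite[OF finite_imageI[OF finite]] by blast
    then have e_eq: "e = (\<Sum>i\<in>I. u (b i) *s b i)"
      using sum.reindex[OF inj_on_subset[OF injb subset_UNIV]] by (simp add: o_def)
    define k where "k = inv_into UNIV L"
    have k: "k (L i) = i" for i unfolding k_def by (rule inv_into_f_f[OF inj]) simp
    define d' where "d' M = (if M \<in> F \<and> k M \<in> I then u (b (k M)) *s b (k M) else 0)" for M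
    have d'_L: "d' (L i) = (if i \<in> I then u (b i) *s b i else 0)" for i
      by (simp add: d'_def k F_eq)
    have "decomposes F e d'"
      unfolding decomposes_def
    proof (intro conjI ballI allI impI)
      fix M assume "M \<in> F"
      then obtain i where M: "M = L i" by (auto simp: F_eq)
      show "d' M \<in> M"
        unfolding M d'_L unfolding b(2) by (auto intro: span_zero span_scale span_base)
    next
      show "d' M = 0" if "M \<notin> F" for M using that by (simp add: d'_def)
      have "(\<Sum>M\<in>F. d' M) = (\<Sum>i\<in>UNIV. d' (L i))" by (rule sum.reindex_bij_betw[OF L, symmetric])
      also have "\<dots> = e" unfolding d'_L e_eq by (simp add: sum.If_cases)
      finally show "(\<Sum>M\<in>F. d' M) = e" .
    qed
    then have "d = d'" using ex1 d by blast
    then show "\<forall>i. d (L i) \<noteq> 0 \<longrightarrow> i \<in> I" by (simp add: d'_L)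
  qed
  finally show ?thesis by (simp add: I_def)
qed

lemma frame_basis:
  fixes L :: "'r::finite \<Rightarrow> 'b set"
  assumes F: "frame scale F" and L: "bij_betw L UNIV F"
    and b: "\<And>i. b i \<noteq> 0" "\<And>i. L i = span {b i}"
  shows "inj b" "independent (range b)" "span (range b) = UNIV"
proof -
  have F_eq: "F = range L" and inj: "inj L" using L by (auto simp: bij_betw_def)
  show injb: "inj b" using inj b(2) by (metis injD injI)
  have "e \<in> span (range b)" for e
  proof -
    \<comment> \<open>With all weights zero every index passes the threshold, so the filtration
      statement yields spanning.\<close>
    have "ereal 0 \<le> adapted_valuation F (\<lambda>_. 0) e"
      unfolding adapted_valuation_def by (rule Inf_greatest) auto
    then have "e \<in> span (b ` {i. (0::real) \<le> 0})"
      using adapted_valuation_ge_iff[OF F L b, of 0 "\<lambda>_. 0" e] by simp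
    then show ?thesis by simp
  qed
  then show "span (range b) = UNIV" by blast
  show "independent (range b)"
  proof
    assume "dependent (range b)"
    then obtain u i where u: "(\<Sum>v\<in>range b. u v *s v) = 0" "u (b i) \<noteq> 0"
      using dependent_finite[of "range b"] by auto
    have s: "(\<Sum>i\<in>UNIV. u (b i) *s b i) = 0"
      using u(1) by (simp add: sum.reindex[OF injb])
    define k where "k = inv_into UNIV L"
    have k: "k (L i) = i" for i unfolding k_def by (rule inv_into_f_f[OF inj]) simp
    define d where "d M = (if M \<in> F then u (b (k M)) *s b (k M) else 0)" for M
    have d_L: "d (L i) = u (b i) *s b i" for i by (simp add: d_def k F_eq)
    \<comment> \<open>A nontrivial relation would be a second decomposition of zero.\<close>
    have "decomposes F 0 d"
      unfolding decomposes_def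
    proof (intro conjI ballI allI impI)
      fix M assume "M \<in> F"
      then obtain i where M: "M = L i" by (auto simp: F_eq)
      show "d M \<in> M" unfolding M d_L unfolding b(2) by (intro span_scale span_base) simp
    next
      show "d M = 0" if "M \<notin> F" for M using that by (simp add: d_def)
      have "(\<Sum>M\<in>F. d M) = (\<Sum>i\<in>UNIV. d (L i))" by (rule sum.reindex_bij_betw[OF L, symmetric])
      also have "\<dots> = 0" unfolding d_L by (rule s)
      finally show "(\<Sum>M\<in>F. d M) = 0" .
    qed
    moreover have "decomposes F 0 (\<lambda>_. 0)"
      using F by (auto simp: decomposes_def frame_def subspace_0)
    moreover have "\<exists>!d. decomposes F 0 d" using F by (simp add: frame_def)
    ultimately have "d = (\<lambda>_. 0)" by blast
    then have "u (b i) *s b i = 0" using d_L[of i] by simp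
    then show False using u(2) b(1) by simp
  qed
qed

lemma basis_frame:
  fixes b :: "'r::finite \<Rightarrow> 'b"
  assumes inj: "inj b" and ind: "independent (range b)" and sp: "span (range b) = UNIV"
  defines "L \<equiv> \<lambda>i. span {b i}"
  shows "bij_betw L UNIV (range L)" "frame scale (range L)" "b i \<noteq> 0"
proof -
  show b0: "b i \<noteq> 0" for i using ind dependent_zero by (metis rangeI)
  have injL: "inj L"
  proof (rule injI, rule ccontr)
    fix i j assume ij: "L i = L j" "i \<noteq> j"
    have "b i \<in> span {b j}" using ij(1) span_base[of "b i" "{b i}"] by (simp add: L_def)
    moreover have "{b j} \<subseteq> range b - {b i}" using ij(2) inj by (auto dest: injD)
    ultimately have "b i \<in> span (range b - {b i})" using span_mono by blast
    then show False using ind unfolding dependent_def by blast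
  qed
  then show bij: "bij_betw L UNIV (range L)" by (simp add: bij_betw_def)
  define k where "k = inv_into UNIV L"
  have k: "k (L i) = i" for i unfolding k_def by (rule inv_into_f_f[OF injL]) simp
  have rsum: "(\<Sum>M\<in>range L. d M) = (\<Sum>i\<in>UNIV. d (L i))" for d :: "'b set \<Rightarrow> 'b"
    by (rule sum.reindex_bij_betw[OF bij, symmetric])
  have "\<exists>!d. decomposes (range L) e d" for e
  proof (rule ex_ex1I)
    define d where "d M = (if M \<in> range L
      then representation (range b) e (b (k M)) *s b (k M) else 0)" for M
    have d_L: "d (L i) = representation (range b) e (b i) *s b i" for i by (simp add: d_def k)
    have "decomposes (range L) e d"
      unfolding decomposes_def
    proof (intro conjI ballI allI impI)
      fix M assume "M \<in> range L"
      then obtain i where M: "M = L i" by blast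
      show "d M \<in> M" unfolding M d_L unfolding L_def by (intro span_scale span_base) simp
    next
      show "d M = 0" if "M \<notin> range L" for M using that by (simp add: d_def)
      have "(\<Sum>M\<in>range L. d M) = (\<Sum>v\<in>range b. representation (range b) e v *s v)"
        unfolding rsum d_L by (simp add: sum.reindex[OF inj])
      also have "\<dots> = e" using ind sp by (intro sum_representation_eq) auto
      finally show "(\<Sum>M\<in>range L. d M) = e" .
    qed
    then show "\<exists>d. decomposes (range L) e d" by blast
  next
    fix d d' assume dd: "decomposes (range L) e d" "decomposes (range L) e d'"
    have "\<exists>c. d (L i) = c *s b i" "\<exists>c. d' (L i) = c *s b i" for i
    proof -
      have "d (L i) \<in> span {b i}" "d' (L i) \<in> span {b i}" using dd by (auto simp: decomposes_def L_def)
      then show "\<exists>c. d (L i) = c *s b i" "\<exists>c. d' (L i) = c *s b i"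
        by (auto simp: span_singleton)
    qed
    then obtain c c' where c: "\<And>i. d (L i) = c i *s b i" "\<And>i. d' (L i) = c' i *s b i" by metis
    have "(\<Sum>i\<in>UNIV. d (L i)) = (\<Sum>i\<in>UNIV. d' (L i))"
      using dd unfolding decomposes_def rsum by simp
    then have s: "(\<Sum>i\<in>UNIV. (c i - c' i) *s b i) = 0"
      by (simp add: c scale_left_diff_distrib sum_subtractf)
    define g where "g = inv_into UNIV b"
    have g: "g (b i) = i" for i unfolding g_def by (rule inv_into_f_f[OF inj]) simp
    have "(\<Sum>v\<in>range b. (c (g v) - c' (g v)) *s v) = 0"
      using s by (simp add: sum.reindex[OF inj] g o_def)
    then have "c (g v) - c' (g v) = 0" if "v \<in> range b" for v
      using independentD[OF ind _ order_refl, of "\<lambda>v. c (g v) - c' (g v)" v] that by simp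
    from this[OF rangeI] have "c i = c' i" for i by (simp add: g)
    then have "d M = d' M" if "M \<in> range L" for M using that by (auto simp: c)
    moreover have "d M = d' M" if "M \<notin> range L" for M using that dd by (simp add: decomposes_def)
    ultimately show "d = d'" by blast
  qed
  moreover have "dim (L i) = 1" for i
  proof -
    have "independent {b i}" using independent_mono[OF ind, of "{b i}"] by simp
    then show ?thesis unfolding L_def by (simp add: dim_eq_card_independent)
  qed
  ultimately show "frame scale (range L)"
    by (auto simp: frame_def L_def subspace_span)
qed

end

text \<open>By density, real thresholds separate extended reals, infinite ones included; so
  valuations can be compared through their filtrations alone.\<close>

lemma ereal_eq_by_lower_bounds:
  fixes a b :: ereal
  assumes "\<And>t. ereal t \<le> a \<longleftrightarrow> ereal t \<le> b"
  shows "a = b"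
proof (rule antisym; rule ereal_le_real)
  show "\<And>z. b \<le> ereal z \<Longrightarrow> a \<le> ereal z"
    using assms by (metis ereal_dense2 leD le_less_trans less_imp_le not_le)
  show "\<And>z. a \<le> ereal z \<Longrightarrow> b \<le> ereal z"
    using assms by (metis ereal_dense2 leD le_less_trans less_imp_le not_le)
qed

lemma twist_valuation:
  assumes "valuation scl (\<Phi> x)"
  shows "valuation scl (twist \<Phi> m x)"
  unfolding valuation_def twist_def
proof (intro conjI allI impI)
  have v: "\<And>e. \<Phi> x e \<noteq> -\<infinity>" "\<And>e f. \<Phi> x (e + f) \<ge> min (\<Phi> x e) (\<Phi> x f)"
    "\<And>c e. c \<noteq> 0 \<Longrightarrow> \<Phi> x (scl c e) = \<Phi> x e" "\<And>e. \<Phi> x e = \<infinity> \<longleftrightarrow> e = 0"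
    using assms by (auto simp: valuation_def)
  show "\<Phi> x e + ereal (m x) \<noteq> -\<infinity>" for e using v(1)[of e] by simp
  show "min (\<Phi> x e + ereal (m x)) (\<Phi> x f + ereal (m x)) \<le> \<Phi> x (e + f) + ereal (m x)" for e f
  proof -
    have "min (\<Phi> x e + ereal (m x)) (\<Phi> x f + ereal (m x)) \<le> min (\<Phi> x e) (\<Phi> x f) + ereal (m x)"
      by (metis min_def min.cobounded1 min.cobounded2)
    also have "\<dots> \<le> \<Phi> x (e + f) + ereal (m x)" by (rule add_right_mono[OF v(2)])
    finally show ?thesis .
  qed
  show "\<Phi> x (scl c e) + ereal (m x) = \<Phi> x e + ereal (m x)" if "c \<noteq> 0" for c e using v(3)[OF that] by simp
  show "(\<Phi> x e + ereal (m x) = \<infinity>) = (e = 0)" for e using v(4)[of e] by simp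
qed

section \<open>Bundles with affinely independent Chern roots\<close>

locale bundle_with_chern_roots =
  fixes scl :: "'k::field \<Rightarrow> 'e::ab_group_add \<Rightarrow> 'e"
    and N :: "'n::real_vector set" and \<Delta> :: "'n set set"
    and \<E> :: "'n \<Rightarrow> 'e \<Rightarrow> ereal"
    and u :: "'r::finite \<Rightarrow> 'n \<Rightarrow> real"
  assumes complete: "complete_fan N \<Delta>"
    and is_bundle: "toric_vector_bundle scl CARD('r) N \<Delta> \<E>"
    and roots: "global_chern_roots scl N \<Delta> \<E> u"
    and affinely_independent: "affinely_independent_family u"
begin

sublocale vector_space scl
  using is_bundle by (simp add: toric_vector_bundle_def)

lemma fan_\<Delta>: "fan N \<Delta>"
  using complete by (simp add: complete_fan_def)

lemma obtain_cone: obtains \<delta> where "\<delta> \<in> \<Delta>" "x \<in> \<delta>"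
  using complete unfolding complete_fan_def by blast

lemma root_dual: "u i \<in> dual_lattice N"
  using roots by (simp add: global_chern_roots_def)

lemmas root_linear = dual_latticeD[OF root_dual]

text \<open>The form in which the global roots are used: on one cone the filtration consists of
  coordinate subspaces of one basis, numbered so that the \<open>i\<close>-th vector has weight
  \<open>u i\<close>.\<close>

lemma cone_basis:
  assumes "\<delta> \<in> \<Delta>"
  obtains b :: "'r \<Rightarrow> 'e" where "inj b" "independent (range b)" "span (range b) = UNIV"
    "\<And>x t e. x \<in> \<delta> \<Longrightarrow> ereal t \<le> \<E> x e \<longleftrightarrow> e \<in> span (b ` upper_level (\<lambda>i. u i x) t)"
proof -
  obtain F T L where F: "local_chern_roots scl N \<E> \<delta> F T" and L: "bij_betw L UNIV F"
    and T: "\<forall>i. \<forall>x\<in>Real_Vector_Spaces.span \<delta>. T (L i) x = u i x"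
    using roots assms unfolding global_chern_roots_def by blast
  have frame: "frame scl F" and \<E>: "\<And>x. x \<in> \<delta> \<Longrightarrow> \<E> x = adapted_valuation F (\<lambda>L. T L x)"
    using F by (auto simp: local_chern_roots_def)
  obtain b where b: "\<And>i. b i \<noteq> 0" "\<And>i. L i = local.span {b i}"
    using frame_line_generators[OF frame L] by blast
  show thesis
  proof (rule that[OF frame_basis[OF frame L b]])
    fix x t e assume x: "x \<in> \<delta>"
    have "T (L i) x = u i x" for i using T x by (simp add: real_vector.span_base)
    then show "ereal t \<le> \<E> x e \<longleftrightarrow> e \<in> local.span (b ` upper_level (\<lambda>i. u i x) t)"
      unfolding \<E>[OF x] adapted_valuation_ge_iff[OF frame L b] upper_level_def by simp
  qed
qed

text \<open>
  Along the segment joining two points the subspace for the index set \<open>I\<close> is constant on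
  each cone, and the segment is covered by finitely many closed intervals lying in cones.
\<close>

lemma level_space_constant:
  assumes level: "upper_level (\<lambda>i. u i x) t = upper_level (\<lambda>i. u i x') t'" and e: "ereal t \<le> \<E> x e"
  shows "ereal t' \<le> \<E> x' e"
proof -
  define p where "p s = x + s *\<^sub>R (x' - x)" for s
  \<comment> \<open>The threshold moves with the point, so \<open>u i (p s) - \<tau> s\<close>
    interpolates linearly between \<open>u i x - t\<close> and \<open>u i x' - t'\<close>. Both ends
    are nonnegative or both are negative, which keeps the index set equal to
    \<open>I\<close>.\<close>
  define \<tau> where "\<tau> s = t + s * (t' - t)" for s
  define I where "I = upper_level (\<lambda>i. u i x) t"
  have I: "i \<in> I \<longleftrightarrow> t \<le> u i x" "i \<in> I \<longleftrightarrow> t' \<le> u i x'" for i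
    using level unfolding I_def upper_level_def by blast+
  have lev: "upper_level (\<lambda>i. u i (p s)) (\<tau> s) = I" if s: "s \<in> {0..1}" for s
  proof -
    have eq: "u i (p s) - \<tau> s = (1 - s) * (u i x - t) + s * (u i x' - t')" for i
    proof -
      have "u i (p s) = u i x + s * u i (x' - x)" by (simp add: p_def root_linear(2,3))
      also have "u i (x' - x) = u i x' - u i x" by (rule linear_diff[OF root_linear(1)])
      finally show ?thesis by (simp add: \<tau>_def algebra_simps)
    qed
    have "\<tau> s \<le> u i (p s) \<longleftrightarrow> i \<in> I" for i
    proof (cases "i \<in> I")
      case True
      then have "0 \<le> (1 - s) * (u i x - t) + s * (u i x' - t')"
        using I[of i] s by (intro add_nonneg_nonneg mult_nonneg_nonneg) auto
      then show ?thesis using eq[of i] True by simp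
    next
      case False
      have lt: "u i x - t < 0" "u i x' - t' < 0" using I[of i] False by auto
      have "(1 - s) * (u i x - t) + s * (u i x' - t') < 0"
      proof (cases "s = 0")
        case True
        then show ?thesis using lt by simp
      next
        case s0: False
        have "(1 - s) * (u i x - t) \<le> 0" using s lt by (intro mult_nonneg_nonpos) auto
        moreover have "s * (u i x' - t') < 0" using s s0 lt by (intro mult_pos_neg) auto
        ultimately show ?thesis by linarith
      qed
      then show ?thesis using eq[of i] False by simp
    qed
    then show ?thesis unfolding upper_level_def by blast
  qed
  define Q where "Q s \<longleftrightarrow> ereal (\<tau> s) \<le> \<E> (p s) e" for s
  define C where "C \<delta> = {0..1} \<inter> {s. p s \<in> \<delta>}" for \<delta>
  have const: "Q s \<longleftrightarrow> Q s'" if "\<delta> \<in> \<Delta>" "s \<in> C \<delta>" "s' \<in> C \<delta>" for \<delta> s s'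
  proof -
    obtain b :: "'r \<Rightarrow> 'e" where "\<And>x t e. x \<in> \<delta> \<Longrightarrow>
        ereal t \<le> \<E> x e \<longleftrightarrow> e \<in> local.span (b ` upper_level (\<lambda>i. u i x) t)"
      using cone_basis[OF \<open>\<delta> \<in> \<Delta>\<close>] by metis
    then show ?thesis using that lev by (simp add: Q_def C_def)
  qed
  have closed_C: "closed (C \<delta>)" if \<delta>: "\<delta> \<in> \<Delta>" for \<delta>
  proof -
    have "rational_cone N \<delta>" using fan_\<Delta> \<delta> by (simp add: fan_def)
    then obtain A where A: "finite A" "\<delta> = convex_cone hull A" unfolding rational_cone_def by blast
    show ?thesis
      unfolding C_def p_def A(2) by (intro closed_Int closed_convex_cone_hull_line A(1)) simp
  qed
  \<comment> \<open>Stated for a general predicate because it is used for \<open>Q\<close> and for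
    its negation: both sets are finite unions of closed pieces, so connectedness of the interval
    leaves one of them empty.\<close>
  have closed: "closed {s \<in> {0..1}. R s}"
    if R: "\<And>\<delta> s s'. \<delta> \<in> \<Delta> \<Longrightarrow> s \<in> C \<delta> \<Longrightarrow> s' \<in> C \<delta> \<Longrightarrow> R s \<Longrightarrow> R s'" for R
  proof -
    have "{s \<in> {0..1}. R s} = (\<Union>\<delta>\<in>{\<delta> \<in> \<Delta>. \<exists>s\<in>C \<delta>. R s}. C \<delta>)"
    proof (intro equalityI subsetI)
      fix s assume s: "s \<in> {s \<in> {0..1}. R s}"
      obtain \<delta> where \<delta>: "\<delta> \<in> \<Delta>" "p s \<in> \<delta>" by (rule obtain_cone)
      then have "s \<in> C \<delta>" using s by (simp add: C_def)
      then show "s \<in> (\<Union>\<delta>\<in>{\<delta> \<in> \<Delta>. \<exists>s\<in>C \<delta>. R s}. C \<delta>)" using s \<delta>(1) by blast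
    next
      fix s assume "s \<in> (\<Union>\<delta>\<in>{\<delta> \<in> \<Delta>. \<exists>s\<in>C \<delta>. R s}. C \<delta>)"
      then obtain \<delta> r where \<delta>: "\<delta> \<in> \<Delta>" "r \<in> C \<delta>" "R r" "s \<in> C \<delta>" by blast
      have "R s" by (rule R[OF \<delta>(1,2,4,3)])
      then show "s \<in> {s \<in> {0..1}. R s}" using \<delta>(4) by (simp add: C_def)
    qed
    moreover have "finite {\<delta> \<in> \<Delta>. \<exists>s\<in>C \<delta>. R s}" using fan_\<Delta> by (simp add: fan_def)
    ultimately show ?thesis using closed_C by (auto intro: closed_UN)
  qed
  have "closed {s \<in> {0..1}. Q s}" "closed {s \<in> {0..1}. \<not> Q s}"
    by (rule closed; use const in blast)+
  moreover have "{s \<in> {0..1}. Q s} \<union> {s \<in> {0..1}. \<not> Q s} = {0..1}"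
    "{s \<in> {0..1}. Q s} \<inter> {s \<in> {0..1}. \<not> Q s} = {}" by auto
  moreover have "connected {0..1::real}" by (rule connected_Icc)
  ultimately have "{s \<in> {0..1}. Q s} = {} \<or> {s \<in> {0..1}. \<not> Q s} = {}"
    using connected_closed_set[of "{0..1::real}"] closed_atLeastAtMost by blast
  moreover have "Q 0" using e by (simp add: Q_def p_def \<tau>_def)
  ultimately have "Q 1" by fastforce
  then show ?thesis by (simp add: Q_def p_def \<tau>_def)
qed

text \<open>A vector orthogonal to all root vectors and to the all-ones vector is an affine relation
  among the roots, hence zero. This gives surjectivity of \<open>chern_root_map u\<close> and points
  realizing any index set.\<close>

lemma prescribed_roots: "\<exists>x c. \<forall>i. u i x = v i + c"
proof -
  define S where "S = {(\<chi> i. u i x) + c *\<^sub>R (1 :: real ^ 'r) | x c. True}"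
  have S: "Real_Vector_Spaces.subspace S"
    unfolding real_vector.subspace_def
  proof (intro conjI ballI allI)
    have "(0 :: real ^ 'r) = (\<chi> i. u i 0) + 0 *\<^sub>R 1" by (simp add: vec_eq_iff root_linear(4))
    then show "0 \<in> S" unfolding S_def by blast
  next
    fix a b assume "a \<in> S" "b \<in> S"
    then obtain x c y d where "a = (\<chi> i. u i x) + c *\<^sub>R 1" "b = (\<chi> i. u i y) + d *\<^sub>R 1"
      unfolding S_def by blast
    then have "a + b = (\<chi> i. u i (x + y)) + (c + d) *\<^sub>R 1"
      by (simp add: vec_eq_iff root_linear(2) algebra_simps)
    then show "a + b \<in> S" unfolding S_def by blast
  next
    fix r :: real and a assume "a \<in> S"
    then obtain x c where "a = (\<chi> i. u i x) + c *\<^sub>R 1" unfolding S_def by blast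
    then have "r *\<^sub>R a = (\<chi> i. u i (r *\<^sub>R x)) + (r * c) *\<^sub>R 1"
      by (simp add: vec_eq_iff root_linear(3) algebra_simps)
    then show "r *\<^sub>R a \<in> S" unfolding S_def by blast
  qed
  have "S = UNIV"
  proof (rule ccontr)
    assume "S \<noteq> UNIV"
    then have "Real_Vector_Spaces.span S \<noteq> UNIV" using S by (metis real_vector.span_eq_iff)
    then obtain a where a: "a \<noteq> 0" "\<And>s. s \<in> S \<Longrightarrow> a \<bullet> s = 0"
      using span_not_UNIV_orthogonal[of S] real_vector.span_base by blast
    have "(1 :: real ^ 'r) = (\<chi> i. u i 0) + 1 *\<^sub>R 1" by (simp add: vec_eq_iff root_linear(4))
    then have "a \<bullet> 1 = 0" using a(2) unfolding S_def by blast
    then have 1: "(\<Sum>i\<in>UNIV. a $ i) = 0" by (simp add: inner_vec_def)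
    have "(\<chi> i. u i x) + 0 *\<^sub>R 1 \<in> S" for x unfolding S_def by blast
    then have "a \<bullet> (\<chi> i. u i x) = 0" for x using a(2) by fastforce
    then have 2: "(\<Sum>i\<in>UNIV. a $ i * u i x) = 0" for x by (simp add: inner_vec_def)
    have "\<forall>i. a $ i = 0"
      using affinely_independent 1 2 unfolding affinely_independent_family_def by blast
    then show False using a(1) by (simp add: vec_eq_iff)
  qed
  then have "(\<chi> i. v i) \<in> S" by simp
  then obtain x c where "(\<chi> i. v i) = (\<chi> i. u i x) + c *\<^sub>R (1 :: real ^ 'r)" unfolding S_def by blast
  then have "v i = u i x + c" for i by (simp add: vec_eq_iff)
  then have "u i x = v i + (- c)" for i by (metis add.commute add_uminus_conv_diff diff_add_cancel add_diff_cancel_right')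
  then show ?thesis by blast
qed

lemma linear_chern_root_map: "linear (chern_root_map u)"
proof (rule linearI)
  show "chern_root_map u (x + y) = chern_root_map u x + chern_root_map u y" for x y
    unfolding chern_root_map_def linear_add[OF linear_abs_quot_ones, symmetric]
    by (rule arg_cong[of _ _ abs_quot_ones]) (simp add: vec_eq_iff root_linear(2))
  show "chern_root_map u (c *\<^sub>R x) = c *\<^sub>R chern_root_map u x" for c x
    unfolding chern_root_map_def linear_scale[OF linear_abs_quot_ones, symmetric]
    by (rule arg_cong[of _ _ abs_quot_ones]) (simp add: vec_eq_iff root_linear(3))
qed

lemma surj_chern_root_map: "surj (chern_root_map u)"
  unfolding surj_def
proof
  fix y :: "'r quot_ones"
  obtain v where y: "y = abs_quot_ones v" by (rule quot_ones_cases)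
  obtain x c where x: "\<forall>i. u i x = v $ i + c" using prescribed_roots[of "\<lambda>i. v $ i"] by blast
  have "(\<chi> i. u i x) - v = c *\<^sub>R 1" using x by (simp add: vec_eq_iff)
  then have "chern_root_map u x = y" unfolding chern_root_map_def y abs_quot_ones_eq_iff by blast
  then show "\<exists>x. y = chern_root_map u x" by blast
qed

lemma coord_diff_chern_root_map: "coord_diff i j (chern_root_map u x) = u i x - u j x"
  by (simp add: chern_root_map_def coord_diff_abs)

text \<open>The definition ranges over all pairs realizing \<open>I\<close>; by
  \<open>level_space_constant\<close> any one of them decides membership.\<close>

definition level_space :: "'r set \<Rightarrow> 'e set" where
  "level_space I = {e. \<exists>x t. upper_level (\<lambda>i. u i x) t = I \<and> ereal t \<le> \<E> x e}"

lemma in_level_space_iff: "e \<in> level_space (upper_level (\<lambda>i. u i x) t) \<longleftrightarrow> ereal t \<le> \<E> x e"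
  unfolding level_space_def using level_space_constant by blast

lemma level_space_span:
  assumes "x \<in> \<delta>"
    "\<And>x t e. x \<in> \<delta> \<Longrightarrow> ereal t \<le> \<E> x e \<longleftrightarrow> e \<in> span (b ` upper_level (\<lambda>i. u i x) t)"
  shows "level_space (upper_level (\<lambda>i. u i x) t) = local.span (b ` upper_level (\<lambda>i. u i x) t)"
  using assms in_level_space_iff by blast

lemma level_space_basis:
  obtains b :: "'r \<Rightarrow> 'e" where "inj b" "independent (range b)" "level_space I = span (b ` I)"
proof -
  obtain x c where x: "\<forall>i. u i x = (if i \<in> I then 1 else 0) + c"
    using prescribed_roots[of "\<lambda>i. if i \<in> I then 1 else 0"] by blast
  have I: "upper_level (\<lambda>i. u i x) (1 + c) = I"
    unfolding upper_level_def using x by (auto split: if_splits)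
  obtain \<delta> where \<delta>: "\<delta> \<in> \<Delta>" "x \<in> \<delta>" by (rule obtain_cone)
  obtain b :: "'r \<Rightarrow> 'e" where b: "inj b" "independent (range b)"
    "\<And>x t e. x \<in> \<delta> \<Longrightarrow> ereal t \<le> \<E> x e \<longleftrightarrow> e \<in> local.span (b ` upper_level (\<lambda>i. u i x) t)"
    using cone_basis[OF \<delta>(1)] by metis
  show thesis using level_space_span[OF \<delta>(2) b(3), of "1 + c"] unfolding I by (rule that[OF b(1,2)])
qed

text \<open>Up to a constant, the roots at the chosen point are 2 on \<open>I\<close>, 1 on the rest
  of \<open>J\<close> and 0 elsewhere. Both sets are then level sets at one point, and the higher
  threshold gives the smaller subspace.\<close>

lemma level_space_mono:
  assumes "I \<subseteq> J" shows "level_space I \<subseteq> level_space J"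
proof -
  obtain x c where x: "\<forall>i. u i x = ((if i \<in> I then 1 else 0) + (if i \<in> J then 1 else 0)) + c"
    using prescribed_roots[of "\<lambda>i. (if i \<in> I then 1 else 0) + (if i \<in> J then 1 else 0)"] by blast
  have I: "upper_level (\<lambda>i. u i x) (2 + c) = I"
    unfolding upper_level_def using x assms by (auto split: if_splits)
  have J: "upper_level (\<lambda>i. u i x) (1 + c) = J"
    unfolding upper_level_def using x assms by (auto split: if_splits)
  have "ereal (1 + c) \<le> \<E> x e" if "ereal (2 + c) \<le> \<E> x e" for e
    using that by (rule order_trans[rotated]) simp
  then show ?thesis using in_level_space_iff[of _ x "2 + c"] in_level_space_iff[of _ x "1 + c"]
    unfolding I J by blast
qed

lemma subspace_assignment_level_space:
  "\<exists>Basis. subspace_assignment scl Basis level_space"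
proof -
  obtain \<delta> where \<delta>: "\<delta> \<in> \<Delta>" "undefined \<in> \<delta>" by (rule obtain_cone)
  obtain b :: "'r \<Rightarrow> 'e" where b: "independent (range b)" "local.span (range b) = UNIV"
    using cone_basis[OF \<delta>(1)] by metis
  have "subspace_assignment scl (range b) level_space"
  proof unfold_locales
    show "finite (range b)" by simp
    show "independent (range b)" "local.span (range b) = UNIV" by (rule b)+
    fix I J :: "'r set"
    obtain f :: "'r \<Rightarrow> 'e" where f: "inj f" "independent (range f)" "level_space I = local.span (f ` I)"
      by (rule level_space_basis)
    show "local.subspace (level_space I)" unfolding f(3) by (rule subspace_span)
    show "local.dim (level_space I) = card I"
      using independent_mono[OF f(2), of "f ` I"] f(1) unfolding f(3)
      by (simp add: dim_eq_card_independent card_image inj_on_subset[OF _ subset_UNIV] image_mono)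
    show "I \<subseteq> J \<Longrightarrow> level_space I \<subseteq> level_space J" by (rule level_space_mono)
  qed
  then show ?thesis by blast
qed

section \<open>Descent of the twisted bundle to the quotient\<close>

definition base_index :: 'r where
  "base_index = undefined"

text \<open>Subtracting one root, no matter which, leaves only differences of roots, and these are
  functions on the quotient.\<close>

definition base_character :: "'n \<Rightarrow> real" where
  "base_character x = - u base_index x"

lemma base_character_dual: "base_character \<in> dual_lattice N"
  using dual_lattice_scale[OF root_dual, of "-1" base_index] by (simp add: base_character_def[abs_def])

text \<open>The choice of preimage is immaterial: by \<open>twist_ge_iff\<close> the twisted
  valuation depends on \<open>x\<close> only through its image.\<close>

definition descended :: "'r quot_ones \<Rightarrow> 'e \<Rightarrow> ereal" where
  "descended y = twist \<E> base_character (SOME x. chern_root_map u x = y)"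

lemma twist_ge_iff:
  "ereal t \<le> twist \<E> base_character x e \<longleftrightarrow>
     e \<in> level_space (upper_level (\<lambda>i. coord_diff i base_index (chern_root_map u x)) t)"
proof -
  have "ereal t \<le> twist \<E> base_character x e \<longleftrightarrow> ereal (t + u base_index x) \<le> \<E> x e"
    by (cases "\<E> x e") (auto simp: twist_def base_character_def)
  also have "\<dots> \<longleftrightarrow> e \<in> level_space (upper_level (\<lambda>i. u i x) (t + u base_index x))"
    by (rule in_level_space_iff[symmetric])
  also have "upper_level (\<lambda>i. u i x) (t + u base_index x) =
      upper_level (\<lambda>i. coord_diff i base_index (chern_root_map u x)) t"
    by (auto simp: upper_level_def coord_diff_chern_root_map)
  finally show ?thesis .
qed

lemma descended_witness: obtains x where "chern_root_map u x = y" "descended y = twist \<E> base_character x"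
proof -
  have "\<exists>x. chern_root_map u x = y" using surj_chern_root_map by (metis surjD)
  from someI_ex[OF this] show thesis by (rule that) (simp add: descended_def)
qed

lemma descended_ge_iff:
  "ereal t \<le> descended y e \<longleftrightarrow> e \<in> level_space (upper_level (\<lambda>i. coord_diff i base_index y) t)"
proof -
  obtain x where x: "chern_root_map u x = y" "descended y = twist \<E> base_character x"
    by (rule descended_witness)
  show ?thesis using twist_ge_iff[of t x e] by (simp add: x)
qed

lemma descended_chern_root_map: "descended (chern_root_map u x) e = twist \<E> base_character x e"
  by (rule ereal_eq_by_lower_bounds) (simp add: descended_ge_iff twist_ge_iff)

lemma valuation_descended: "valuation scl (descended y)"
proof -
  obtain x where x: "descended y = twist \<E> base_character x" by (rule descended_witness)
  obtain \<delta> where "\<delta> \<in> \<Delta>" "x \<in> \<delta>" by (rule obtain_cone)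
  then show ?thesis
    unfolding x using is_bundle by (intro twist_valuation) (auto simp: toric_vector_bundle_def)
qed

end

lemma coord_diff_lattice:
  assumes "y \<in> quot_ones_lattice" shows "coord_diff i j y \<in> \<int>"
  using assms by (auto simp: quot_ones_lattice_def coord_diff_abs)

theorem theorem1p3:
  fixes scl :: "'k::field \<Rightarrow> 'e::ab_group_add \<Rightarrow> 'e"
    and N :: "'n::real_vector set" and \<Delta> :: "'n set set"
    and \<E> :: "'n \<Rightarrow> 'e \<Rightarrow> ereal"
    and u :: "'r::finite \<Rightarrow> 'n \<Rightarrow> real"
  assumes "full_lattice N"
    and "complete_fan N \<Delta>"
    and "toric_vector_bundle scl CARD('r) N \<Delta> \<E>"
    and "trivial_chern_class scl N \<Delta> \<E>"
    and "global_chern_roots scl N \<Delta> \<E> u"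
    and "affinely_independent_family u"
  shows "\<exists>(\<Xi> :: 'r quot_ones set set) (\<F> :: 'r quot_ones \<Rightarrow> 'e \<Rightarrow> ereal). \<exists>m \<in> dual_lattice N.
     complete_fan quot_ones_lattice \<Xi> \<and>
     coarsens \<Xi> permutohedral_fan \<and>
     toric_vector_bundle scl CARD('r) quot_ones_lattice \<Xi> \<F> \<and>
     surjective_toric_morphism TYPE('k) N \<Delta> quot_ones_lattice \<Xi> (chern_root_map u) \<and>
     equivariantly_isomorphic scl scl \<Delta>
       (twist \<E> m) (pullback (chern_root_map u) \<F>)"
proof -
  interpret bundle_with_chern_roots scl N \<Delta> \<E> u
    using assms by unfold_locales
  obtain Basis where "subspace_assignment scl Basis level_space"
    using subspace_assignment_level_space by blast
  then interpret S: subspace_assignment scl Basis level_space .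
  let ?U = "chern_root_map u"
  have dim: "vector_space.dim scl UNIV = CARD('r)" using is_bundle by (simp add: toric_vector_bundle_def)
  have level_UNIV: "level_space UNIV = UNIV"
    using S.eq_V[of UNIV UNIV] dim by simp
  have map: "fan_map N \<Delta> quot_ones_lattice S.bundle_fan ?U"
    unfolding fan_map_def
  proof (intro conjI ballI linear_chern_root_map)
    show "?U ` N \<subseteq> quot_ones_lattice"
      using root_linear(5) by (auto simp: chern_root_map_def quot_ones_lattice_def)
    fix \<sigma> assume \<sigma>: "\<sigma> \<in> \<Delta>"
    obtain b :: "'r \<Rightarrow> 'e" where b: "inj b" "\<not> module.dependent scl (range b)" "module.span scl (range b) = UNIV"
      "\<And>x t e. x \<in> \<sigma> \<Longrightarrow> ereal t \<le> \<E> x e \<longleftrightarrow> e \<in> module.span scl (b ` upper_level (\<lambda>i. u i x) t)"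
      using cone_basis[OF \<sigma>] by metis
    \<comment> \<open>On \<open>\<sigma>\<close> one basis \<open>b\<close> splits the subspaces of
      all level sets; its lattice is the one passed to
      \<open>linear_image_in_chamber\<close>.\<close>
    have "?U x \<in> S.quot_cone {I. level_space I = module.span scl (b ` I)}" if "x \<in> \<sigma>" for x
      unfolding chern_root_map_def S.abs_in_quot_cone S.level_cone_def
      using level_space_span[OF that b(4)] by (simp add: vec_lambda_inverse)
    moreover have "rational_cone N \<sigma>" using fan_\<Delta> \<sigma> by (simp add: fan_def)
    ultimately show "\<exists>\<xi>\<in>S.bundle_fan. ?U ` \<sigma> \<subseteq> \<xi>"
      using S.linear_image_in_chamber[OF S.homlattice_basis[OF b(1-3)] _ linear_chern_root_map]
        S.chamber_in_bundle_fan by (metis (no_types, lifting) image_subsetI)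
  qed
  have "toric_vector_bundle scl CARD('r) quot_ones_lattice S.bundle_fan descended"
    unfolding toric_vector_bundle_def
  proof (intro conjI ballI valuation_descended)
    show "vector_space scl" "vector_space.dim scl UNIV = CARD('r)"
      using is_bundle by (simp_all add: toric_vector_bundle_def)
    fix \<tau> assume "\<tau> \<in> S.bundle_fan"
    \<comment> \<open>A face takes over the frame and the roots of a chamber containing it.\<close>
    then obtain ys where ys: "enumerates ys" "\<tau> \<subseteq> S.chamber ys"
      unfolding S.bundle_fan_def using cone_face_subset by blast
    obtain b where b: "inj b" "\<not> module.dependent scl (range b)"
      "\<And>J. J \<in> S.compatible ys \<Longrightarrow> level_space J = module.span scl (b ` J)"
      using S.compatible_basis[OF ys(1)] by metis
    have "module.span scl (range b) = UNIV"
      using b(3)[of UNIV] S.homlattice_compatible[OF ys(1)] level_UNIV by (simp add: S.homlattice_def)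
    note frame = basis_frame[OF b(1,2) this]
    define L where "L i = module.span scl {b i}" for i
    have L: "bij_betw L UNIV (range L)" "frame scl (range L)" "\<And>i. b i \<noteq> 0" "\<And>i. L i = module.span scl {b i}"
      using frame by (simp_all add: L_def[abs_def])
    define k where "k = inv_into UNIV L"
    have k: "k (L i) = i" for i
      unfolding k_def using L(1) by (intro inv_into_f_f) (auto simp: bij_betw_def)
    \<comment> \<open>The roots of the descended bundle are the coordinate differences to
      \<open>base_index\<close>, where \<open>k\<close> recovers the index of a line.\<close>
    have "local_chern_roots scl quot_ones_lattice descended \<tau> (range L) (\<lambda>M. coord_diff (k M) base_index)"
      unfolding local_chern_roots_def
    proof (intro conjI ballI L(2))
      show "integral_linear_on quot_ones_lattice (Real_Vector_Spaces.span \<tau>) (coord_diff (k M) base_index)" for M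
        using coord_diff_lattice
        by (auto simp: integral_linear_on_def linear_add[OF linear_coord_diff] linear_scale[OF linear_coord_diff])
      fix y assume "y \<in> \<tau>"
      then have y: "upper_level (\<lambda>i. coord_diff i base_index y) t \<in> S.compatible ys" for t
        using ys(2) by (auto simp: S.chamber_def S.quot_cone_def S.level_cone_def)
      show "descended y = adapted_valuation (range L) (\<lambda>M. coord_diff (k M) base_index y)"
      proof (rule ext, rule ereal_eq_by_lower_bounds)
        fix e t
        show "ereal t \<le> descended y e \<longleftrightarrow>
            ereal t \<le> adapted_valuation (range L) (\<lambda>M. coord_diff (k M) base_index y) e"
          unfolding descended_ge_iff b(3)[OF y] adapted_valuation_ge_iff[OF L(2,1,3,4)] k
          by (simp add: upper_level_def)
      qed
    qed
    then show "\<exists>F T. local_chern_roots scl quot_ones_lattice descended \<tau> F T" by blast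
  qed
  moreover have "surjective_toric_morphism TYPE('k) N \<Delta> quot_ones_lattice S.bundle_fan ?U"
    by (rule surjective_toric_morphismI[OF assms(1,2) S.fan_bundle_fan map surj_chern_root_map])
  moreover have "equivariantly_isomorphic scl scl \<Delta> (twist \<E> base_character) (pullback ?U descended)"
    unfolding equivariantly_isomorphic_def pullback_def
    by (intro exI[of _ id] conjI linear_id bij_id ballI allI) (simp add: descended_chern_root_map)
  ultimately show ?thesis
    using base_character_dual S.complete_bundle_fan S.bundle_fan_coarsens by blast
qed

end
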